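(* For every $t \in \mathbb{N}$ there is a constant $B_t > 0$ depending only on $t$ such that for every $n$ with $t < n/2$ there exist real numbers $x_1,\dots,x_F$ with $\max_j |x_j| \leq B_t/(2n-2)!!$ such that the matrix $\widetilde{A} = \sum_{j=1}^F x_j A_{\rho^{(j)}}$ has eigenvalues on the eigenspaces $2\lambda^{(1)},\dots,2\lambda^{(F)}$ given by \[\eta_i = \sum_{j=1}^F x_j P_{\lambda^{(i)},\rho^{(j)}} = \begin{cases} 1 & \text{if } i = 1,\\ \zeta & \text{if } 1 < i \leq F.\end{cases}\]
   Context: $\mathcal{M}_{2n}$ is the set of perfect matchings of $K_{2n}$. For $m,m'\in\mathcal{M}_{2n}$ the multigraph union $m\cup m'$ is a disjoint union of even cycles (a common edge is a $2$-cycle); listing cycle lengths as $2\rho_1\ge2\rho_2\ge\dots$ gives the cycle type $d(m,m')=\rho\vdash n$. For $\rho \vdash n$ the associate $A_\rho$ is the $\mathcal{M}_{2n}\times\mathcal{M}_{2n}$ 0/1 matrix with $(A_\rho)_{m,m'}=1$ iff $d(m,m')=\rho$. The permutation module $\mathbb{R}[\mathcal{M}_{2n}]$ of $S_{2n}$ decomposes multiplicity-freely as $\bigoplus_{\lambda\vdash n} S^{2\lambda}$ where $2\lambda=(2\lambda_1,2\lambda_2,\dots)$; each $S^{2\lambda}$ is an eigenspace of every $A_\rho$, and $P_{\lambda,\rho}$ denotes the eigenvalue of $A_\rho$ on $S^{2\lambda}$. Partitions of $n$ are ordered reverse-lexicographically ($\mu\le\lambda$ iff $\mu=\lambda$ or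 $\mu_j<\lambda_j$ at the first differing index $j$); $\lambda\vdash n$ is fat if $\lambda\ge(n-t,1^t)$. $F_t$ is the number of fat partitions of $n$ (which depends only on $t$ for $t<n/2$), $F = F_t-1$, and $\lambda^{(1)} > \lambda^{(2)} > \dots > \lambda^{(F)}$ and $\rho^{(1)} > \dots > \rho^{(F)}$ both denote the first $F$ partitions of $n$ in reverse-lexicographic order (i.e. the fat partitions other than $(n-t,1^t)$). $\zeta = -1/\big((2n-1)(2n-3)\cdots(2n-2t+1) - 1\big)$, and $(2k)!! = 2^k k!$. *)

theory Defs
  imports Complex_Main "HOL-Library.Multiset" "HOL-Combinatorics.Permutations"
begin

definition matchings :: "nat \<Rightarrow> nat set set set" where
  "matchings n = {m. (\<forall>e\<in>m. e \<subseteq> {..<2*n} \<and> card e = 2) \<and>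
                     (\<forall>v<2*n. \<exists>!e. e \<in> m \<and> v \<in> e)}"

definition union_adj :: "nat set set \<Rightarrow> nat set set \<Rightarrow> (nat \<times> nat) set" where
  "union_adj m m' = {(a, b). {a, b} \<in> m \<or> {a, b} \<in> m'}"

definition comp :: "nat set set \<Rightarrow> nat set set \<Rightarrow> nat \<Rightarrow> nat set" where
  "comp m m' v = {w. (v, w) \<in> (union_adj m m')\<^sup>*}"

(* cycle type d(m,m'): cycle lengths 2 rho_1 \<ge> 2 rho_2 \<ge> ..., as a
   nonincreasing list rho_1 \<ge> rho_2 \<ge> ... *)
definition cycle_type :: "nat \<Rightarrow> nat set set \<Rightarrow> nat set set \<Rightarrow> nat list" where
  "cycle_type n m m' =
     rev (sorted_list_of_multiset
       (image_mset (\<lambda>C. card C div 2) (mset_set (comp m m' ` {..<2*n}))))"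

definition partitions :: "nat \<Rightarrow> nat list set" where
  "partitions n = {xs. sorted_wrt (\<ge>) xs \<and> 0 \<notin> set xs \<and> sum_list xs = n}"

definition plt :: "nat list \<Rightarrow> nat list \<Rightarrow> bool" where
  "plt mu la = (\<exists>j. j < length mu \<and> j < length la \<and> take j mu = take j la \<and> mu ! j < la ! j)"

definition vecs :: "nat \<Rightarrow> (nat set set \<Rightarrow> real) set" where
  "vecs n = {f. \<forall>m. m \<notin> matchings n \<longrightarrow> f m = 0}"

definition assoc_op :: "nat \<Rightarrow> nat list \<Rightarrow> (nat set set \<Rightarrow> real) \<Rightarrow> (nat set set \<Rightarrow> real)" where
  "assoc_op n rho f = (\<lambda>m. if m \<in> matchings n then
       (\<Sum>m'\<in>matchings n. if cycle_type n m m' = rho then f m' else 0) else 0)"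

definition perm_match :: "(nat \<Rightarrow> nat) \<Rightarrow> nat set set \<Rightarrow> nat set set" where
  "perm_match s m = (\<lambda>e. s ` e) ` m"

definition act :: "(nat \<Rightarrow> nat) \<Rightarrow> (nat set set \<Rightarrow> real) \<Rightarrow> (nat set set \<Rightarrow> real)" where
  "act s f = (\<lambda>m. f (perm_match (inv s) m))"

(* row-major Young tableau of shape mu filled with 0,...,|mu|-1 *)
definition rowof :: "nat list \<Rightarrow> nat \<Rightarrow> nat" where
  "rowof mu i = (LEAST k. i < sum_list (take (Suc k) mu))"

definition colof :: "nat list \<Rightarrow> nat \<Rightarrow> nat" where
  "colof mu i = i - sum_list (take (rowof mu i) mu)"

definition row_group :: "nat \<Rightarrow> nat list \<Rightarrow> (nat \<Rightarrow> nat) set" where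
  "row_group N mu = {s. s permutes {..<N} \<and> (\<forall>i<N. rowof mu (s i) = rowof mu i)}"

definition col_group :: "nat \<Rightarrow> nat list \<Rightarrow> (nat \<Rightarrow> nat) set" where
  "col_group N mu = {s. s permutes {..<N} \<and> (\<forall>i<N. colof mu (s i) = colof mu i)}"

definition young :: "nat \<Rightarrow> nat list \<Rightarrow> (nat set set \<Rightarrow> real) \<Rightarrow> (nat set set \<Rightarrow> real)" where
  "young N mu f = (\<lambda>m. \<Sum>r\<in>row_group N mu. \<Sum>c\<in>col_group N mu.
                         real_of_int (sign c) * act (r \<circ> c) f m)"

definition lspan :: "(nat set set \<Rightarrow> real) set \<Rightarrow> (nat set set \<Rightarrow> real) set" where
  "lspan G = {g. \<exists>S a. finite S \<and> S \<subseteq> G \<and> g = (\<lambda>m. \<Sum>v\<in>S. a v * v m)}"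

(* S^{2 lambda} inside R[M_{2n}]: the isotypic component of the Specht module
   S^{2 lambda}, i.e. the S_{2n}-submodule generated by c_{2 lambda} R[M_{2n}] *)
definition specht_space :: "nat \<Rightarrow> nat list \<Rightarrow> (nat set set \<Rightarrow> real) set" where
  "specht_space n la = lspan {act s (young (2*n) (map (\<lambda>k. 2*k) la) f) | s f.
                               s permutes {..<2*n} \<and> f \<in> vecs n}"

definition P :: "nat \<Rightarrow> nat list \<Rightarrow> nat list \<Rightarrow> real" where
  "P n la rho = (THE c. \<forall>f\<in>specht_space n la. assoc_op n rho f = (\<lambda>m. c * f m))"

definition hook :: "nat \<Rightarrow> nat \<Rightarrow> nat list" where
  "hook n t = (n - t) # replicate t 1"

definition fat_list :: "nat \<Rightarrow> nat \<Rightarrow> nat list list" where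
  "fat_list n t = (THE L. sorted_wrt (\<lambda>a b. plt b a) L \<and>
                          set L = {la \<in> partitions n. plt (hook n t) la})"

definition zeta :: "nat \<Rightarrow> nat \<Rightarrow> real" where
  "zeta n t = - 1 / ((\<Prod>k<t. real (2*n - 1 - 2*k)) - 1)"

(* (2k)!! = 2^k k! *)
definition dfact_even :: "nat \<Rightarrow> real" where
  "dfact_even k = 2 ^ k * fact k"

end

theory Submission
  imports Defs
begin

text \<open>For a list \<open>Xs\<close> of disjoint even blocks let \<open>f\<^sub>X\<^sub>s\<close> be the indicator of the
  matchings all of whose edges lie inside blocks.  A function on matchings that is invariant under
  permutations inside the blocks of \<open>Xs\<close>, and orthogonal to \<open>f\<^sub>X\<^sub>s\<close> and to all \<open>f\<^sub>Y\<^sub>s\<close> with \<open>Ys\<close> of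
  larger type, vanishes.  This shows that the Young symmetrizer of shape $2\lambda$ has rank one
  on $\mathbb{R}[\mathcal{M}_{2n}]$, so that $P_{\lambda,\rho}$ is well defined, and also that the
  eigenvalue condition on $\widetilde{A}$ follows from the equality of the quadratic forms of
  $\widetilde{A}$ and $\zeta + (1-\zeta)E$ ($E$ the projection onto constants) at the row blocks of every
  fat $\lambda$.  In these equations the coefficient of $x_\rho$ counts pairs of type $\rho$ inside the
  rows of $\lambda$.  It vanishes unless $\rho \le \lambda$, so the system is triangular, of a size
  depending only on $t$; counting Hamiltonian completions of the long cycle shows that each row is
  dominated by its diagonal entry up to a constant depending only on $t$, and back substitution
  gives the bound.\<close>

section \<open>Perfect matchings and transpositions\<close>

text \<open>\<open>P\<close> is a definite description, so it has a usable value only once every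
  associate is known to act by a scalar on a nonzero \<open>specht_space\<close>. Everything is done
  with functions on matchings: the vanishing criterion takes the place of Schur's lemma and Young's
  rule. The scale (2n-2)!! is the number of matchings that form a single cycle of length 2n with a
  given one. For a fat partition with first part p, the diagonal coefficient is only known to be at
  least (2p-2)!! times the number of matchings refining the rows, and (2p-2)!! may be smaller than
  (2n-2)!! by a factor of order n^(n-p). The right-hand side makes up for this: the absolute value
  of zeta is at most n^(-t), hence at most n^(-(n-p)), and the fraction of all matchings that refine
  the rows is O(n^(-(n-p))) with a constant depending on t. So in every equation the right-hand side
  divided by the diagonal entry is O(1/(2n-2)!!), which back substitution preserves.\<close>

definition PM :: "nat set \<Rightarrow> nat set set set" where
  "PM V = {m. (\<forall>e\<in>m. e \<subseteq> V \<and> card e = 2) \<and> (\<forall>v\<in>V. \<exists>!e. e \<in> m \<and> v \<in> e)}"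

definition RM :: "nat set \<Rightarrow> nat set list \<Rightarrow> nat set set set" where
  "RM V Xs = {m \<in> PM V. \<forall>e\<in>m. \<exists>X\<in>set Xs. e \<subseteq> X}"

text \<open>An ordered list, because \<open>plt\<close> compares the sizes position by position. The
  sizes need not decrease: inductions over block lists run through compositions, not only
  partitions.\<close>

definition blocks :: "nat set \<Rightarrow> nat set list \<Rightarrow> bool" where
  "blocks V Xs \<longleftrightarrow> \<Union>(set Xs) = V \<and> sorted_wrt (\<lambda>A B. A \<inter> B = {}) Xs \<and>
     (\<forall>X\<in>set Xs. finite X \<and> X \<noteq> {} \<and> even (card X))"

definition sizes :: "nat set list \<Rightarrow> nat list" where
  "sizes Xs = map (\<lambda>X. card X div 2) Xs"

lemma matchings_eq_PM: "matchings n = PM {..<2*n}"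
  unfolding matchings_def PM_def by auto

lemma PM_iff:
  "m \<in> PM V \<longleftrightarrow> (\<forall>e\<in>m. card e = 2) \<and> \<Union>m = V \<and> (\<forall>e\<in>m. \<forall>f\<in>m. \<forall>v. v \<in> e \<longrightarrow> v \<in> f \<longrightarrow> e = f)"
  unfolding PM_def by (auto; blast)

lemma PM_card: "m \<in> PM V \<Longrightarrow> e \<in> m \<Longrightarrow> card e = 2"
  by (auto simp: PM_iff)

lemma PM_subset: "m \<in> PM V \<Longrightarrow> e \<in> m \<Longrightarrow> e \<subseteq> V"
  by (auto simp: PM_iff)

lemma PM_unique: "m \<in> PM V \<Longrightarrow> e \<in> m \<Longrightarrow> f \<in> m \<Longrightarrow> v \<in> e \<Longrightarrow> v \<in> f \<Longrightarrow> e = f"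
  by (auto simp: PM_iff)

lemma finite_PM: "finite V \<Longrightarrow> finite (PM V)"
  by (rule finite_subset[of _ "Pow (Pow V)"]) (auto simp: PM_iff)

lemma PM_finite: "finite V \<Longrightarrow> m \<in> PM V \<Longrightarrow> finite m"
  by (rule finite_subset[of _ "Pow V"]) (auto simp: PM_iff)

lemma PM_edge: "m \<in> PM V \<Longrightarrow> e \<in> m \<Longrightarrow> v \<in> e \<Longrightarrow> \<exists>w. w \<noteq> v \<and> w \<in> V \<and> e = {v, w}"
  using PM_card[of m V e] PM_subset[of m V e] by (auto simp: card_2_iff)

lemma PM_partner:
  assumes "m \<in> PM V" "v \<in> V"
  obtains w where "w \<noteq> v" "w \<in> V" "{v, w} \<in> m"
proof -
  from assms obtain e where "e \<in> m" "v \<in> e" by (auto simp: PM_iff)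
  with PM_edge[OF assms(1)] that show ?thesis by blast
qed

lemma PM_pair_unique: "m \<in> PM V \<Longrightarrow> {x, z} \<in> m \<Longrightarrow> {y, z} \<in> m \<Longrightarrow> x = y"
proof -
  assume a: "m \<in> PM V" "{x, z} \<in> m" "{y, z} \<in> m"
  have "{x, z} = {y, z}" by (rule PM_unique[OF a, of z]) auto
  then show "x = y" by (auto simp: doubleton_eq_iff)
qed

lemma PM_subset_eq:
  assumes "m \<in> PM V" "m' \<in> PM V" "m' \<subseteq> m" shows "m = m'"
proof (intro equalityI subsetI)
  fix e assume e: "e \<in> m"
  obtain v where v: "v \<in> e" using PM_card[OF assms(1) e] by fastforce
  with e assms obtain f where "f \<in> m'" "v \<in> f" by (metis PM_iff UnionE UnionI)
  with PM_unique[OF assms(1) e, of f v] v assms(3) show "e \<in> m'" by blast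
qed (use assms in blast)

lemma card_PM_edges:
  assumes "finite V" "m \<in> PM V" shows "card V = 2 * card m"
proof -
  have "card (\<Union>m) = sum card m"
    by (rule card_Union_disjoint)
       (use assms PM_unique[OF assms(2)] in \<open>auto simp: pairwise_def disjnt_iff PM_iff intro: card_ge_0_finite\<close>)
  also have "\<dots> = 2 * card m" using PM_card[OF assms(2)] by simp
  finally show ?thesis using assms(2) by (simp add: PM_iff)
qed

lemma perm_match_PM:
  assumes s: "inj_on s V" and m: "m \<in> PM V" shows "perm_match s m \<in> PM (s ` V)"
proof -
  have sub: "e \<subseteq> V" if "e \<in> m" for e using PM_subset[OF m that] .
  have u: "\<Union>m = V" using m by (simp add: PM_iff)
  show ?thesis unfolding PM_iff
  proof (intro conjI ballI allI impI)
    fix e assume "e \<in> perm_match s m"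
    then obtain e' where "e' \<in> m" "e = s ` e'" by (auto simp: perm_match_def)
    then show "card e = 2" using PM_card[OF m, of e'] sub[of e'] s
      by (simp add: card_image inj_on_subset)
  next
    show "\<Union> (perm_match s m) = s ` V" using u by (auto simp: perm_match_def)
  next
    fix e f v assume e: "e \<in> perm_match s m" "f \<in> perm_match s m" "v \<in> e" "v \<in> f"
    then obtain e' f' where *: "e' \<in> m" "e = s ` e'" "f' \<in> m" "f = s ` f'" by (auto simp: perm_match_def)
    with e obtain a b where "v = s a" "v = s b" "a \<in> e'" "b \<in> f'"
      by (metis imageE)
    moreover from this have "a = b" using s sub * by (metis inj_onD subsetD)
    ultimately show "e = f" using PM_unique[OF m, of e' f' a] * by auto
  qed
qed

lemma perm_match_PM_permutes: "s permutes V \<Longrightarrow> m \<in> PM V \<Longrightarrow> perm_match s m \<in> PM V"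
  using perm_match_PM[of s V m] by (metis permutes_image permutes_inj_on)

lemma perm_match_comp: "perm_match (s \<circ> t) m = perm_match s (perm_match t m)"
  by (simp add: perm_match_def image_image image_comp o_def)

lemma perm_match_id [simp]: "perm_match id m = m"
  by (simp add: perm_match_def)

lemma perm_match_inv: "bij s \<Longrightarrow> perm_match (inv s) (perm_match s m) = m"
  by (metis perm_match_comp perm_match_id bij_is_inj inv_o_cancel)

lemma perm_match_inv': "bij s \<Longrightarrow> perm_match s (perm_match (inv s) m) = m"
  by (metis perm_match_comp perm_match_id bij_is_surj surj_iff)

lemma inj_perm_match: "bij s \<Longrightarrow> inj (perm_match s)"
  by (metis injI perm_match_inv)

lemma perm_match_transpose2 [simp]:
  "perm_match (transpose x y) (perm_match (transpose x y) m) = m"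
  by (simp flip: perm_match_comp)

text \<open>Two matchings with the same edges inside $X$ are connected by transpositions of points outside
  $X$: each such move gains an edge of the target.\<close>

lemma transposition_connected:
  assumes V: "finite V" "V = X0 \<union> X" "X0 \<inter> X = {}"
    and inv: "\<And>x y m. x \<in> X0 \<Longrightarrow> y \<in> X0 \<Longrightarrow> m \<in> PM V \<Longrightarrow> g (perm_match (transpose x y) m) = g m"
    and m: "m \<in> PM V" and m': "m' \<in> PM V" and eq: "m \<inter> Pow X = m' \<inter> Pow X"
  shows "g m = g m'"
  using m eq
proof (induction "card (m' - m)" arbitrary: m rule: less_induct)
  case (less m)
  show ?case
  proof (cases "m = m'")
    case False
    note m = less.prems(1) and eq = less.prems(2)
    \<comment> \<open>Wanted: an edge {x, z} of \<open>m'\<close> missing in \<open>m\<close> such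
      that x and the \<open>m\<close>-partner y of z both lie in \<open>X0\<close>. Swapping x and y
      then turns {y, z} into {x, z}.\<close>
    have "\<exists>x y z. x \<in> X0 \<and> y \<in> X0 \<and> {x, z} \<in> m' \<and> {x, z} \<notin> m \<and> {y, z} \<in> m"
    proof (cases "\<exists>x\<in>X0. \<exists>z\<in>X. {x, z} \<in> m' \<and> {x, z} \<notin> m")
      case True
      then obtain x z where xz: "x \<in> X0" "z \<in> X" "{x, z} \<in> m'" "{x, z} \<notin> m" by blast
      then obtain y where y: "y \<in> V" "{z, y} \<in> m" using PM_partner[OF m, of z] V by blast
      have "y \<in> X0"
      proof (rule ccontr)
        assume "y \<notin> X0"
        then have "{y, z} \<in> m \<inter> Pow X" using y xz V by (auto simp: insert_commute)
        then have "{y, z} \<in> m'" using eq by blast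
        then have "x = y" using PM_pair_unique[OF m'] xz by blast
        then show False using \<open>y \<notin> X0\<close> xz by simp
      qed
      then show ?thesis using xz y by (metis insert_commute)
    next
      \<comment> \<open>The missing edge now lies inside \<open>X0\<close>. If y were in X, its edge
        in \<open>m'\<close> would belong to \<open>m\<close> too, hence be {y, z}, which clashes
        with {x, z} in \<open>m'\<close>.\<close>
      case nA: False
      from PM_subset_eq[OF m m'] False obtain e where e: "e \<in> m'" "e \<notin> m" by blast
      then have "\<not> e \<subseteq> X" using eq by blast
      then obtain x where x: "x \<in> e" "x \<in> X0" using PM_subset[OF m' e(1)] V by blast
      then obtain z where z: "e = {x, z}" "z \<in> V" using PM_edge[OF m' e(1)] by blast
      with nA x e have zX: "z \<notin> X" by blast
      then obtain y where y: "y \<in> V" "{z, y} \<in> m" using PM_partner[OF m, of z] z by blast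
      have "y \<in> X0"
      proof (rule ccontr)
        assume "y \<notin> X0"
        then have yX: "y \<in> X" using y V by blast
        obtain w where w: "w \<in> V" "{y, w} \<in> m'" using PM_partner[OF m', of y] y by blast
        have "{y, w} \<in> m"
        proof (cases "w \<in> X")
          case True
          then have "{y, w} \<in> m' \<inter> Pow X" using w yX by auto
          then show ?thesis using eq by blast
        next
          case False
          then show ?thesis using nA w yX V by (metis UnE insert_commute)
        qed
        then have "w = z" using PM_pair_unique[OF m] y by (metis insert_commute)
        then have "x = y" using PM_pair_unique[OF m'] w e z by blast
        then show False using x \<open>y \<notin> X0\<close> by simp
      qed
      then show ?thesis using x z y e by (metis insert_commute)
    qed
    then obtain x y z where xy: "x \<in> X0" "y \<in> X0" "{x, z} \<in> m'" "{x, z} \<notin> m" "{y, z} \<in> m" by blast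
    then have ne: "x \<noteq> y" "z \<noteq> x" "z \<noteq> y"
      using PM_card[OF m xy(5)] PM_card[OF m' xy(3)] by auto
    let ?t = "transpose x y"
    let ?m1 = "perm_match ?t m"
    have perm: "?t permutes V" using xy V by (auto intro: permutes_swap_id)
    have m1: "?m1 \<in> PM V" by (rule perm_match_PM_permutes[OF perm m])
    have unmoved: "?t ` e = e" if "x \<notin> e" "y \<notin> e" for e using that by simp
    have stay: "e \<in> ?m1 \<longleftrightarrow> e \<in> m" if "x \<notin> e" "y \<notin> e" for e
    proof -
      have "e \<in> ?m1 \<longleftrightarrow> ?t ` e \<in> perm_match ?t ?m1"
        by (metis (no_types, lifting) image_eqI perm_match_def perm_match_transpose2 unmoved that)
      then show ?thesis using unmoved[OF that] by simp
    qed
    \<comment> \<open>No edge of the target is lost: the edge of \<open>m'\<close> at x is {x, z},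
      which \<open>m\<close> lacks, and the edge of \<open>m\<close> at y is {y, z}, which
      \<open>m'\<close> cannot contain beside {x, z}.\<close>
    have "m' - ?m1 \<subset> m' - m"
    proof
      show "m' - ?m1 \<subseteq> m' - m"
      proof
        fix e assume e: "e \<in> m' - ?m1"
        have "e \<notin> m"
        proof
          assume em: "e \<in> m"
          have "x \<notin> e" using PM_unique[OF m', of e "{x, z}" x] e em xy by auto
          moreover have "y \<notin> e"
          proof
            assume "y \<in> e"
            then have "e = {y, z}" using PM_unique[OF m em xy(5), of y] by auto
            then show False using PM_pair_unique[OF m', of x z y] xy e ne by auto
          qed
          ultimately show False using stay em e by blast
        qed
        then show "e \<in> m' - m" using e by blast
      qed
      have "?t ` {y, z} = {x, z}" using ne by auto
      then have "{x, z} \<in> ?m1" using xy by (metis imageI perm_match_def)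
      then show "m' - ?m1 \<noteq> m' - m" using xy by blast
    qed
    then have "card (m' - ?m1) < card (m' - m)"
      using PM_finite[OF V(1) m'] by (simp add: psubset_card_mono)
    moreover have "?m1 \<inter> Pow X = m' \<inter> Pow X"
    proof -
      have "?m1 \<inter> Pow X = m \<inter> Pow X" using stay xy V by blast
      then show ?thesis using eq by simp
    qed
    ultimately have "g ?m1 = g m'" using less.hyps m1 by blast
    then show ?thesis using inv[OF xy(1,2) m] by simp
  qed simp
qed

section \<open>A vanishing criterion for block-invariant functions\<close>

lemma card_Union_edges:
  assumes "finite V" "m \<in> PM V" "p \<subseteq> m" shows "card (\<Union>p) = 2 * card p"
proof -
  have "card (\<Union>p) = sum card p"
  proof (rule card_Union_disjoint)
    show "pairwise disjnt p"
      using PM_unique[OF assms(2)] assms(3) unfolding pairwise_def disjnt_iff by (metis subsetD)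
    show "finite e" if "e \<in> p" for e
      using PM_subset[OF assms(2)] assms(1,3) that by (meson finite_subset subsetD)
  qed
  also have "\<dots> = sum (\<lambda>_. 2) p" using PM_card[OF assms(2)] assms(3) by (intro sum.cong) auto
  finally show ?thesis by simp
qed

lemma PM_sub_eq:
  assumes "m \<in> PM V" "p \<in> PM X" "p \<subseteq> m" shows "m \<inter> Pow X = p"
proof (intro equalityI subsetI)
  fix e assume e: "e \<in> m \<inter> Pow X"
  then obtain v where v: "v \<in> e" using PM_card[OF assms(1), of e] by fastforce
  with e have "v \<in> X" by auto
  then obtain f where f: "f \<in> p" "v \<in> f" using assms(2) by (auto simp: PM_iff)
  with PM_unique[OF assms(1), of e f v] v e assms(3) show "e \<in> p" by auto
qed (use assms PM_subset in blast)

lemma restrict_PM: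
  assumes "m \<in> PM V" "\<Union>(m \<inter> Pow X) = X" shows "m \<inter> Pow X \<in> PM X"
  using assms unfolding PM_iff by blast

text \<open>Each matching on the left contains exactly one perfect matching p of X, its restriction,
  so the sum splits over p. This transfers hypotheses about g on V to the summed function on
  X.\<close>

lemma sum_RM_Cons:
  fixes g :: "nat set set \<Rightarrow> real"
  assumes V: "finite V" "V = X0 \<union> X" "X0 \<inter> X = {}" and Ys: "\<Union>(set Ys) = X"
  shows "sum g (RM V (X0 # Ys)) = (\<Sum>p\<in>RM X Ys. sum g {m \<in> PM V. p \<subseteq> m})"
proof -
  have "RM V (X0 # Ys) = (\<Union>p\<in>RM X Ys. {m \<in> PM V. p \<subseteq> m})"
  proof (intro equalityI subsetI)
    fix m assume m: "m \<in> RM V (X0 # Ys)"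
    then have mP: "m \<in> PM V" by (simp add: RM_def)
    have ref: "e \<subseteq> X0 \<or> (\<exists>Y\<in>set Ys. e \<subseteq> Y)" if "e \<in> m" for e using m that by (auto simp: RM_def)
    have cov: "\<Union>(m \<inter> Pow X) = X"
    proof (intro equalityI subsetI)
      fix v assume v: "v \<in> X"
      then obtain e where e: "e \<in> m" "v \<in> e" using mP V by (auto simp: PM_iff)
      then have "\<not> e \<subseteq> X0" using v V by blast
      then have "e \<subseteq> X" using ref[OF e(1)] Ys by blast
      then show "v \<in> \<Union>(m \<inter> Pow X)" using e by blast
    qed blast
    have "m \<inter> Pow X \<in> RM X Ys"
      unfolding RM_def
    proof (clarsimp simp: restrict_PM[OF mP cov])
      fix e assume e: "e \<in> m" "e \<subseteq> X"
      have "e \<noteq> {}" using PM_card[OF mP e(1)] by auto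
      then have "\<not> e \<subseteq> X0" using e V by blast
      then show "\<exists>Y\<in>set Ys. e \<subseteq> Y" using ref[OF e(1)] by blast
    qed
    then show "m \<in> (\<Union>p\<in>RM X Ys. {m \<in> PM V. p \<subseteq> m})" using mP by blast
  next
    fix m assume "m \<in> (\<Union>p\<in>RM X Ys. {m \<in> PM V. p \<subseteq> m})"
    then obtain p where p: "p \<in> RM X Ys" and m: "m \<in> PM V" "p \<subseteq> m" by blast
    then have pP: "p \<in> PM X" by (simp add: RM_def)
    have "\<exists>Y\<in>set (X0 # Ys). e \<subseteq> Y" if e: "e \<in> m" for e
    proof (cases "e \<in> p")
      case True
      then show ?thesis using p by (auto simp: RM_def)
    next
      case False
      have "e \<inter> X = {}"
      proof (rule ccontr)
        assume "e \<inter> X \<noteq> {}"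
        then obtain v where v: "v \<in> e" "v \<in> X" by blast
        then obtain f where "f \<in> p" "v \<in> f" using pP by (auto simp: PM_iff)
        then show False using PM_unique[OF m(1) e, of f v] v m(2) False by auto
      qed
      then have "e \<subseteq> X0" using PM_subset[OF m(1) e] V by blast
      then show ?thesis by simp
    qed
    then show "m \<in> RM V (X0 # Ys)" using m by (auto simp: RM_def)
  qed
  moreover have "sum g (\<Union>p\<in>RM X Ys. {m \<in> PM V. p \<subseteq> m}) = (\<Sum>p\<in>RM X Ys. sum g {m \<in> PM V. p \<subseteq> m})"
  proof (rule sum.UNION_disjoint)
    show "finite (RM X Ys)" 
      by (rule finite_subset[of _ "PM X"]) (use finite_PM[of X] V in \<open>auto simp: RM_def\<close>)
    show "\<forall>p\<in>RM X Ys. finite {m \<in> PM V. p \<subseteq> m}"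
      by (intro ballI finite_subset[OF _ finite_PM[OF V(1)]]) blast
    show "\<forall>p\<in>RM X Ys. \<forall>q\<in>RM X Ys. p \<noteq> q \<longrightarrow> {m \<in> PM V. p \<subseteq> m} \<inter> {m \<in> PM V. q \<subseteq> m} = {}"
    proof (intro ballI impI)
      fix p q assume "p \<in> RM X Ys" "q \<in> RM X Ys" and ne: "p \<noteq> q"
      then have pq: "p \<in> PM X" "q \<in> PM X" by (simp_all add: RM_def)
      have False if "m \<in> PM V" "p \<subseteq> m" "q \<subseteq> m" for m
        using PM_sub_eq[OF that(1) pq(1) that(2)] PM_sub_eq[OF that(1) pq(2) that(3)] ne by simp
      then show "{m \<in> PM V. p \<subseteq> m} \<inter> {m \<in> PM V. q \<subseteq> m} = {}" by blast
    qed
  qed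
  ultimately show ?thesis by simp
qed

text \<open>A block with two points forces its edge, so containing a given partial matching is a
  refinement condition. The rest is listed first so that \<open>plt\<close> is decided by its
  size.\<close>

lemma partial_blocks:
  assumes V: "finite V" and m0: "m0 \<in> PM V" and ps: "set ps \<subseteq> m0" "distinct ps"
    and ne: "V \<noteq> \<Union>(set ps)"
  shows "blocks V ((V - \<Union>(set ps)) # ps)"
    and "RM V ((V - \<Union>(set ps)) # ps) = {m \<in> PM V. set ps \<subseteq> m}"
proof -
  let ?R = "V - \<Union>(set ps)"
  have sub: "\<Union>(set ps) \<subseteq> V" using ps m0 by (auto simp: PM_iff)
  have ev: "even (card ?R)"
    using card_Diff_subset[OF finite_subset[OF sub V] sub] card_Union_edges[OF V m0 ps(1)]
      card_PM_edges[OF V m0] by simp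
  have disj: "ps ! i \<inter> ps ! j = {}" if "i < j" "j < length ps" for i j
  proof -
    have "ps ! i \<noteq> ps ! j" using that ps(2) by (simp add: nth_eq_iff_index_eq)
    then show ?thesis using PM_unique[OF m0, of "ps ! i" "ps ! j"] ps(1) that by (auto simp: subset_iff)
  qed
  have edges: "card e = 2" if "e \<in> set ps" for e using PM_card[OF m0] that ps by blast
  then show "blocks V (?R # ps)"
  proof -
    have "sorted_wrt (\<lambda>A B. A \<inter> B = {}) ps"
      unfolding sorted_wrt_iff_nth_less using disj by simp
    moreover have "finite X \<and> X \<noteq> {} \<and> even (card X)" if "X \<in> set ps" for X
      using edges[OF that] by (auto intro: card_ge_0_finite)
    moreover have "finite ?R" "?R \<noteq> {}" using V ne sub by auto
    ultimately show ?thesis using sub ev unfolding blocks_def by auto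
  qed
  show "RM V (?R # ps) = {m \<in> PM V. set ps \<subseteq> m}"
  proof (intro equalityI subsetI)
    fix m assume m: "m \<in> RM V (?R # ps)"
    then have mP: "m \<in> PM V" by (simp add: RM_def)
    have "f \<in> m" if f: "f \<in> set ps" for f
    proof -
      obtain v where v: "v \<in> f" using edges[OF f] by fastforce
      then obtain e where e: "e \<in> m" "v \<in> e" using mP sub f by (auto simp: PM_iff)
      then obtain X where X: "X \<in> set (?R # ps)" "e \<subseteq> X" using m by (auto simp: RM_def)
      then have "X = f" using v e f PM_unique[OF m0, of X f v] ps by auto
      then have "e = f" using X edges[OF f] PM_card[OF mP e(1)]
        by (metis card_subset_eq card_ge_0_finite zero_less_numeral)
      then show ?thesis using e by simp
    qed
    then show "m \<in> {m \<in> PM V. set ps \<subseteq> m}" using mP by blast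
  next
    fix m assume m: "m \<in> {m \<in> PM V. set ps \<subseteq> m}"
    have "\<exists>X\<in>set (?R # ps). e \<subseteq> X" if e: "e \<in> m" for e
    proof (cases "e \<in> set ps")
      case False
      have "v \<notin> f" if "v \<in> e" "f \<in> set ps" for v f
        using PM_unique[of m V e f v] m e that False by blast
      then have "e \<subseteq> ?R" using PM_subset[of m V e] m e by blast
      then show ?thesis by simp
    qed auto
    then show "m \<in> RM V (?R # ps)" using m by (auto simp: RM_def)
  qed
qed

lemma plt_Cons: "plt (a # as) (b # bs) \<longleftrightarrow> a < b \<or> (a = b \<and> plt as bs)"
proof
  assume "plt (a # as) (b # bs)"
  then obtain j where "j < length (a # as)" "j < length (b # bs)"
    "take j (a # as) = take j (b # bs)" "(a # as) ! j < (b # bs) ! j" by (auto simp: plt_def)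
  then show "a < b \<or> (a = b \<and> plt as bs)" by (cases j) (auto simp: plt_def)
next
  assume "a < b \<or> (a = b \<and> plt as bs)"
  then show "plt (a # as) (b # bs)"
  proof (elim disjE conjE)
    assume "a < b"
    then show ?thesis by (auto simp: plt_def intro: exI[of _ 0])
  next
    assume "a = b" "plt as bs"
    then obtain j where "j < length as" "j < length bs" "take j as = take j bs" "as ! j < bs ! j"
      by (auto simp: plt_def)
    with \<open>a = b\<close> show ?thesis unfolding plt_def by (intro exI[of _ "Suc j"]) auto
  qed
qed

lemma plt_Nil [simp]: "\<not> plt [] bs" "\<not> plt as []"
  by (auto simp: plt_def)

text \<open>Summing $g$ over the matchings containing a perfect matching $p$ of the smaller blocks gives a
  function of $p$ to which induction applies; partial matchings $p$ are handled by the block lists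
  consisting of the edges of $p$ and the rest, which are larger.\<close>

lemma block_invariant_eq_0:
  fixes g :: "nat set set \<Rightarrow> real"
  assumes "finite V" "blocks V Xs"
    and "\<And>X x y m. X \<in> set Xs \<Longrightarrow> x \<in> X \<Longrightarrow> y \<in> X \<Longrightarrow> m \<in> PM V \<Longrightarrow> g (perm_match (transpose x y) m) = g m"
    and "sum g (RM V Xs) = 0"
    and "\<And>Ys. blocks V Ys \<Longrightarrow> plt (sizes Xs) (sizes Ys) \<Longrightarrow> sum g (RM V Ys) = 0"
    and "m \<in> PM V"
  shows "g m = 0"
  using assms
proof (induction Xs arbitrary: V g m)
  case Nil
  then have "V = {}" by (simp add: blocks_def)
  moreover have "m' = {}" if "m' \<in> PM V" for m'
    using PM_subset[OF that] PM_card[OF that] \<open>V = {}\<close> by fastforce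
  ultimately have "RM V [] = {m}" using Nil.prems(6) by (auto simp: RM_def)
  then show ?case using Nil.prems(4) by simp
next
  case (Cons X0 Xs)
  define X where "X = \<Union>(set Xs)"
  note V = Cons.prems(1) and inv = Cons.prems(3) and larger = Cons.prems(5)
  have bl: "V = X0 \<union> X" "X0 \<inter> X = {}" "blocks X Xs" "finite X0" "X0 \<noteq> {}" "even (card X0)"
    using Cons.prems(2) by (auto simp: blocks_def X_def)
  have finX: "finite X" using V bl by simp
  define g' where "g' p = sum g {m \<in> PM V. p \<subseteq> m}" for p
  have sum_g': "sum g' (RM X Ys) = sum g (RM V (X0 # Ys))" if "blocks X Ys" for Ys
    using sum_RM_Cons[OF V bl(1,2), of Ys g] that by (simp add: g'_def blocks_def)
  have g'0: "g' p = 0" if p: "p \<in> PM X" for p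
  proof (rule Cons.IH[OF finX bl(3) _ _ _ p])
    fix Y x y q assume Y: "Y \<in> set Xs" "x \<in> Y" "y \<in> Y" and q: "q \<in> PM X"
    let ?t = "perm_match (transpose x y)"
    have xy: "x \<in> V" "y \<in> V" using Y X_def bl by auto
    have perm: "transpose x y permutes V" using xy by (simp add: permutes_swap_id)
    have mono: "?t a \<subseteq> ?t b" if "a \<subseteq> b" for a b
      using that by (auto simp: perm_match_def)
    have swap: "?t a \<subseteq> b \<longleftrightarrow> a \<subseteq> ?t b" for a b
      using mono[of "?t a" b] mono[of a "?t b"] by auto
    have "g' (?t q) = (\<Sum>m\<in>{m \<in> PM V. q \<subseteq> m}. g (?t m))"
      unfolding g'_def
      by (rule sum.reindex_bij_witness[of _ ?t ?t])
         (use perm_match_PM_permutes[OF perm] swap in auto)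
    also have "\<dots> = g' q" unfolding g'_def
      by (rule sum.cong) (use inv[of Y x y] Y in auto)
    finally show "g' (?t q) = g' q" .
  next
    show "sum g' (RM X Xs) = 0" using sum_g'[OF bl(3)] Cons.prems(4) by simp
  next
    fix Ys assume Ys: "blocks X Ys" "plt (sizes Xs) (sizes Ys)"
    then have "blocks V (X0 # Ys)" using bl by (auto simp: blocks_def)
    moreover have "plt (sizes (X0 # Xs)) (sizes (X0 # Ys))" using Ys by (simp add: sizes_def plt_Cons)
    ultimately show "sum g' (RM X Ys) = 0" using larger sum_g'[OF Ys(1)] by simp
  qed
  \<comment> \<open>If the edges of \<open>m\<close> inside X cover X, this is a value of
    \<open>g'\<close>. Otherwise the uncovered points of X make the rest strictly larger than
    \<open>X0\<close>, and the list from \<open>partial_blocks\<close> is of larger type.\<close>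
  have super0: "sum g {m' \<in> PM V. m \<inter> Pow X \<subseteq> m'} = 0" if m: "m \<in> PM V" for m
  proof (cases "\<Union>(m \<inter> Pow X) = X")
    case True
    then show ?thesis using g'0 restrict_PM[OF m] by (simp add: g'_def)
  next
    case False
    let ?p = "m \<inter> Pow X"
    have "finite ?p" using PM_finite[OF V m] by (rule finite_Int[OF disjI1])
    from finite_distinct_list[OF this] obtain ps where ps: "set ps = ?p" "distinct ps" by blast
    have "\<Union>?p \<subset> X" using False by blast
    then have less: "card (\<Union>?p) < card X" by (rule psubset_card_mono[OF finX])
    have cR: "card (V - \<Union>?p) = card V - card (\<Union>?p)"
    proof (rule card_Diff_subset)
      show "finite (\<Union>?p)" using finX by (rule finite_subset[rotated]) blast
      show "\<Union>?p \<subseteq> V" using bl(1) by blast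
    qed
    have cV: "card V = card X0 + card X" using bl finX by (simp add: card_Un_disjoint)
    have gt: "card X0 < card (V - \<Union>?p)" using less cR cV by simp
    have ne: "V \<noteq> \<Union>(set ps)" using gt ps by auto
    note pb = partial_blocks[OF V m _ ps(2) ne, unfolded ps(1)]
    have "even (card (V - \<Union>?p))" using pb(1) by (auto simp: blocks_def)
    then have "card X0 div 2 < card (V - \<Union>?p) div 2" using gt bl(6) by (auto elim!: evenE)
    then show ?thesis using larger[OF pb(1)] pb(2) by (simp add: sizes_def plt_Cons)
  qed
  \<comment> \<open>Descending induction on the number of edges inside X: among the matchings
    containing \<open>?p\<close>, those with further edges inside X contribute 0, and on the others
    g is constant by \<open>transposition_connected\<close>. So \<open>super0\<close> gives a
    positive multiple of \<open>g m\<close>.\<close>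
  show ?case using Cons.prems(6)
  proof (induction "card X - card (m \<inter> Pow X)" arbitrary: m rule: less_induct)
    case less
    let ?p = "m \<inter> Pow X"
    let ?A = "{m' \<in> PM V. ?p \<subseteq> m'}" and ?B = "{m' \<in> PM V. m' \<inter> Pow X = ?p}"
    have fin: "finite ?A" "finite ?B"
      by (rule finite_subset[OF _ finite_PM[OF V]], blast)+
    have "sum g ?A = sum g ?B"
    proof (rule sum.mono_neutral_right[OF fin(1)])
      show "\<forall>m'\<in>?A - ?B. g m' = 0"
      proof
        fix m' assume m': "m' \<in> ?A - ?B"
        then have "?p \<subset> m' \<inter> Pow X" by auto
        moreover have f: "finite (m' \<inter> Pow X)" using m' PM_finite[OF V] by auto
        ultimately have "card ?p < card (m' \<inter> Pow X)" by (rule psubset_card_mono[rotated])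
        moreover have "card (m' \<inter> Pow X) \<le> card X"
        proof -
          have "2 * card (m' \<inter> Pow X) = card (\<Union>(m' \<inter> Pow X))"
            using card_Union_edges[OF V, of m' "m' \<inter> Pow X"] m' by auto
          also have "\<dots> \<le> card X" using finX by (intro card_mono) auto
          finally show ?thesis by simp
        qed
        ultimately show "g m' = 0" using less(1)[of m'] m' by auto
      qed
    qed auto
    also have "sum g ?B = sum (\<lambda>_. g m) ?B"
    proof (rule sum.cong[OF refl])
      fix m' assume m': "m' \<in> ?B"
      show "g m' = g m"
        by (rule transposition_connected[OF V bl(1,2)]) (use m' less.prems inv[of X0] in auto)
    qed
    finally have "real (card ?B) * g m = 0" using super0[OF less.prems] by simp
    moreover have "m \<in> ?B" using less.prems by simp
    then have "card ?B \<noteq> 0" using fin(2) by (metis card_0_eq empty_iff)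
    ultimately show ?case by simp
  qed
qed

section \<open>Tableaux\<close>

lemma sum_take_mono:
  fixes mu :: "nat list"
  assumes "a \<le> b" shows "sum_list (take a mu) \<le> sum_list (take b mu)"
proof -
  have "take b mu = take a mu @ drop a (take b mu)"
    using assms by (metis append_take_drop_id min.absorb1 take_take)
  then show ?thesis by (metis le_add1 sum_list_append)
qed

lemma sum_take_Suc:
  "k < length mu \<Longrightarrow> sum_list (take (Suc k) mu) = sum_list (take k mu) + (mu ! k :: nat)"
  by (simp add: take_Suc_conv_app_nth)

lemma rowof_eqI:
  assumes "k < length mu" "sum_list (take k mu) \<le> v" "v < sum_list (take (Suc k) mu)"
  shows "rowof mu v = k"
  unfolding rowof_def
proof (rule Least_equality[where P = "\<lambda>k. v < sum_list (take (Suc k) mu)", OF assms(3)])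
  fix y assume y: "v < sum_list (take (Suc y) mu)"
  show "k \<le> y"
  proof (rule ccontr)
    assume "\<not> k \<le> y"
    then have "sum_list (take (Suc y) mu) \<le> sum_list (take k mu)" by (intro sum_take_mono) simp
    then show False using y assms by simp
  qed
qed

lemma rowof_bounds:
  assumes "v < sum_list mu"
  shows "rowof mu v < length mu" "sum_list (take (rowof mu v) mu) \<le> v"
    "v < sum_list (take (Suc (rowof mu v)) mu)"
proof -
  have pos: "length mu > 0" using assms by (cases mu) auto
  then have ex: "v < sum_list (take (Suc (length mu - 1)) mu)" using assms by simp
  show A: "v < sum_list (take (Suc (rowof mu v)) mu)"
    unfolding rowof_def by (rule LeastI[where P = "\<lambda>k. v < sum_list (take (Suc k) mu)", OF ex])
  have "rowof mu v \<le> length mu - 1" unfolding rowof_def by (rule Least_le[where P = "\<lambda>k. v < sum_list (take (Suc k) mu)", OF ex])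
  then show "rowof mu v < length mu" using pos by linarith
  show "sum_list (take (rowof mu v) mu) \<le> v"
  proof (cases "rowof mu v")
    case (Suc k)
    then have "\<not> v < sum_list (take (Suc k) mu)"
      unfolding rowof_def using not_less_Least[of k "\<lambda>k. v < sum_list (take (Suc k) mu)"] by simp
    then show ?thesis using Suc by simp
  qed simp
qed

lemma rowof_eq_iff:
  assumes "v < sum_list mu" "k < length mu"
  shows "rowof mu v = k \<longleftrightarrow> sum_list (take k mu) \<le> v \<and> v < sum_list (take (Suc k) mu)"
  using rowof_bounds[OF assms(1)] rowof_eqI[OF assms(2)] by blast

lemma colof_bounds:
  assumes "v < sum_list mu"
  shows "colof mu v < mu ! rowof mu v" "v = sum_list (take (rowof mu v) mu) + colof mu v"
  using rowof_bounds[OF assms] by (auto simp: colof_def sum_take_Suc)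

lemma cell:
  assumes "k < length mu" "j < mu ! k"
  shows "rowof mu (sum_list (take k mu) + j) = k" "colof mu (sum_list (take k mu) + j) = j"
    "sum_list (take k mu) + j < sum_list mu"
proof -
  show r: "rowof mu (sum_list (take k mu) + j) = k"
    by (rule rowof_eqI) (use assms in \<open>auto simp: sum_take_Suc\<close>)
  then show "colof mu (sum_list (take k mu) + j) = j" by (simp add: colof_def)
  have "sum_list (take (Suc k) mu) \<le> sum_list (take (length mu) mu)"
    by (rule sum_take_mono) (use assms in simp)
  then show "sum_list (take k mu) + j < sum_list mu" using assms by (simp add: sum_take_Suc)
qed

section \<open>Rows of a tableau as block lists, and dominance of types\<close>

definition row_blocks :: "nat list \<Rightarrow> nat set list" where
  "row_blocks mu = map (\<lambda>k. {v. v < sum_list mu \<and> rowof mu v = k}) [0..<length mu]"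

lemma row_interval:
  assumes "k < length mu"
  shows "{v. v < sum_list mu \<and> rowof mu v = k} = {sum_list (take k mu)..<sum_list (take (Suc k) mu)}"
proof -
  have "sum_list (take (Suc k) mu) \<le> sum_list (take (length mu) mu)"
    by (rule sum_take_mono) (use assms in simp)
  then have "rowof mu v = k \<longleftrightarrow> v \<in> {sum_list (take k mu)..<sum_list (take (Suc k) mu)}" if "v < sum_list mu" for v
    using rowof_eq_iff[OF that assms] by simp
  moreover have "v < sum_list mu" if "v < sum_list (take (Suc k) mu)" for v
    using that \<open>sum_list (take (Suc k) mu) \<le> sum_list (take (length mu) mu)\<close> by simp
  ultimately show ?thesis unfolding set_eq_iff mem_Collect_eq by (metis atLeastLessThan_iff)
qed

lemma card_row: "k < length mu \<Longrightarrow> card {v. v < sum_list mu \<and> rowof mu v = k} = mu ! k"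
  by (simp add: row_interval sum_take_Suc)

abbreviation dbl :: "nat list \<Rightarrow> nat list" where
  "dbl la \<equiv> map (\<lambda>k. 2 * k) la"

lemma sum_dbl: "sum_list (dbl la) = 2 * sum_list la"
  by (induction la) auto

lemma sum_take_dbl: "sum_list (take k (dbl la)) = 2 * sum_list (take k la)"
  by (simp add: take_map sum_dbl)

lemma blocks_row_blocks:
  assumes "la \<in> partitions n" shows "blocks {..<2*n} (row_blocks (dbl la))"
  unfolding blocks_def
proof (intro conjI ballI)
  have s: "sum_list (dbl la) = 2 * n" using assms by (simp add: sum_dbl partitions_def)
  show "\<Union> (set (row_blocks (dbl la))) = {..<2 * n}"
    using rowof_bounds(1)[of _ "dbl la"] s by (auto simp: row_blocks_def)
  show "sorted_wrt (\<lambda>A B. A \<inter> B = {}) (row_blocks (dbl la))"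
    by (auto simp: row_blocks_def sorted_wrt_iff_nth_less)
  fix X assume "X \<in> set (row_blocks (dbl la))"
  then obtain k where k: "k < length la" "X = {v. v < sum_list (dbl la) \<and> rowof (dbl la) v = k}"
    by (auto simp: row_blocks_def)
  then have c: "card X = 2 * la ! k" using card_row[of k "dbl la"] by simp
  moreover have "la ! k \<noteq> 0" using assms nth_mem[OF k(1)] by (metis (mono_tags, lifting) partitions_def mem_Collect_eq)
  ultimately show "finite X" "X \<noteq> {}" "even (card X)" using card_ge_0_finite[of X] by auto
qed

lemma sizes_row_blocks: "sizes (row_blocks (dbl la)) = la"
proof -
  have "map (\<lambda>k. card {v. v < sum_list (dbl la) \<and> rowof (dbl la) v = k} div 2) [0..<length la] = map ((!) la) [0..<length la]"
    by (rule map_cong[OF refl]) (use card_row[of _ "dbl la"] in auto)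
  then show ?thesis by (simp add: sizes_def row_blocks_def o_def map_nth del: map_eq_conv)
qed

text \<open>At the first differing index the partial sums up to and including it would be ordered
  the wrong way.\<close>

lemma not_pltI:
  assumes "\<And>k. sum_list (take k nu) \<le> sum_list (take k la)" shows "\<not> plt la nu"
proof
  assume "plt la nu"
  then obtain j where j: "j < length la" "j < length nu" "take j la = take j nu" "la ! j < nu ! j"
    by (auto simp: plt_def)
  then show False using assms[of "Suc j"] by (simp add: sum_take_Suc)
qed

lemma sum_list_sizes:
  assumes "sorted_wrt (\<lambda>A B. A \<inter> B = {}) Xs" "\<forall>X\<in>set Xs. finite X \<and> even (card X)"
  shows "card (\<Union>(set Xs)) = 2 * sum_list (sizes Xs)"
  using assms
proof (induction Xs)
  case (Cons X Xs)
  have "card (X \<union> \<Union>(set Xs)) = card X + card (\<Union>(set Xs))"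
    by (rule card_Un_disjoint) (use Cons.prems in auto)
  then show ?case using Cons by (auto simp: sizes_def)
qed (simp add: sizes_def)

text \<open>If the blocks meet every column at most once, at most \<open>k\<close> points of a column lie in
  the first \<open>k\<close> blocks, hence at most as many as in the first \<open>k\<close> rows.\<close>

lemma same_block_same_column:
  assumes mu: "sorted_wrt (\<ge>) mu" "sum_list mu = N" and la: "mu = dbl la"
    and bl: "blocks {..<N} Xs" and plt: "plt la (sizes Xs)"
  obtains X x y where "X \<in> set Xs" "x \<in> X" "y \<in> X" "x \<noteq> y" "colof mu x = colof mu y"
proof (rule ccontr)
  assume nt: "\<not> thesis"
  note found = that
  have one: "x = y" if "X \<in> set Xs" "x \<in> X" "y \<in> X" "colof mu x = colof mu y" for X x y
    using nt found that by blast
  have "sum_list (take k (sizes Xs)) \<le> sum_list (take k la)" for k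
  proof -
    define A where "A = \<Union>(set (take k Xs))"
    define C where "C = {v. v < N \<and> rowof mu v < k}"
    have A: "A \<subseteq> {..<N}" using bl set_take_subset[of k Xs] by (auto simp: A_def blocks_def)
    have finA: "finite A" using A by (rule finite_subset) simp
    have "card A = 2 * sum_list (sizes (take k Xs))"
      unfolding A_def by (rule sum_list_sizes)
        (use bl set_take_subset[of k Xs] in \<open>auto simp: blocks_def\<close>)
    then have cA: "card A = 2 * sum_list (take k (sizes Xs))" by (simp add: sizes_def take_map)
    have "C = {..<sum_list (take k mu)}"
    proof (intro equalityI subsetI)
      fix v assume "v \<in> C"
      then have v: "v < sum_list mu" "rowof mu v < k" using mu by (auto simp: C_def)
      have "sum_list (take (Suc (rowof mu v)) mu) \<le> sum_list (take k mu)"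
        by (rule sum_take_mono) (use v in simp)
      then show "v \<in> {..<sum_list (take k mu)}" using rowof_bounds(3)[OF v(1)] by simp
    next
      fix v assume v: "v \<in> {..<sum_list (take k mu)}"
      have "sum_list (take k mu) \<le> sum_list mu" using sum_take_mono[of k "max k (length mu)" mu] by simp
      then have vN: "v < sum_list mu" using v by simp
      have "rowof mu v < k"
      proof (rule ccontr)
        assume "\<not> rowof mu v < k"
        then have "sum_list (take k mu) \<le> sum_list (take (rowof mu v) mu)" by (intro sum_take_mono) simp
        then show False using rowof_bounds(2)[OF vN] v by simp
      qed
      then show "v \<in> C" using vN mu by (simp add: C_def)
    qed
    then have cC: "card C = sum_list (take k mu)" by simp
    have col: "card {v \<in> A. colof mu v = j} \<le> card {v \<in> C. colof mu v = j}" for j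
    \<comment> \<open>If column j has at least k cells, then k of them lie in the first k rows.
      Otherwise the whole column lies in these rows.\<close>
    proof (cases "k \<le> length mu \<and> (k > 0 \<longrightarrow> j < mu ! (k - 1))")
      case True
      have "{v \<in> A. colof mu v = j} = (\<Union>X\<in>set (take k Xs). {v \<in> X. colof mu v = j})"
        by (auto simp: A_def)
      then have "card {v \<in> A. colof mu v = j} \<le> (\<Sum>X\<in>set (take k Xs). card {v \<in> X. colof mu v = j})"
        by (simp add: card_UN_le)
      also have "\<dots> \<le> (\<Sum>X\<in>set (take k Xs). 1)"
      proof (rule sum_mono)
        fix X assume "X \<in> set (take k Xs)"
        then have "X \<in> set Xs" by (meson in_set_takeD)
        then have "u = v" if "u \<in> {v \<in> X. colof mu v = j}" "v \<in> {v \<in> X. colof mu v = j}" for u v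
          using one[of X u v] that by simp
        then show "card {v \<in> X. colof mu v = j} \<le> 1"
          by (cases "finite {v \<in> X. colof mu v = j}") (simp_all add: card_le_Suc0_iff_eq)
      qed
      also have "\<dots> \<le> k" using card_length[of "take k Xs"] by simp
      also have "k = card ((\<lambda>i. sum_list (take i mu) + j) ` {..<k})"
      proof -
        have jlt: "j < mu ! i" if "i < k" for i
        proof -
          have "mu ! (k - 1) \<le> mu ! i"
            using sorted_wrt_nth_less[OF mu(1), of i "k - 1"] that True by (cases "i = k - 1") auto
          then show ?thesis using True that by auto
        qed
        have "inj_on (\<lambda>i. sum_list (take i mu) + j) {..<k}"
        proof (rule inj_onI)
          fix a b assume ab: "a \<in> {..<k}" "b \<in> {..<k}" "sum_list (take a mu) + j = sum_list (take b mu) + j"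
          have "rowof mu (sum_list (take a mu) + j) = a" by (rule cell) (use ab True jlt in auto)
          moreover have "rowof mu (sum_list (take b mu) + j) = b" by (rule cell) (use ab True jlt in auto)
          ultimately show "a = b" using ab(3) by metis
        qed
        then show ?thesis by (simp add: card_image)
      qed
      also have "\<dots> \<le> card {v \<in> C. colof mu v = j}"
      proof (rule card_mono)
        show "finite {v \<in> C. colof mu v = j}" by (simp add: C_def)
        have "sum_list (take i mu) + j \<in> {v \<in> C. colof mu v = j}" if i: "i < k" for i
        proof -
          have "mu ! (k - 1) \<le> mu ! i"
            using sorted_wrt_nth_less[OF mu(1), of i "k - 1"] i True by (cases "i = k - 1") auto
          then have "i < length mu" "j < mu ! i" using True i by auto
          from cell[OF this] show ?thesis using i mu by (simp add: C_def)
        qed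
        then show "(\<lambda>i. sum_list (take i mu) + j) ` {..<k} \<subseteq> {v \<in> C. colof mu v = j}" by blast
      qed
      finally show ?thesis .
    next
      case False
      have "{v \<in> A. colof mu v = j} \<subseteq> {v \<in> C. colof mu v = j}"
      proof
        fix v assume v: "v \<in> {v \<in> A. colof mu v = j}"
        then have vN: "v < sum_list mu" using A mu by auto
        have "rowof mu v < k"
        proof (rule ccontr)
          assume nk: "\<not> rowof mu v < k"
          then have kl: "k \<le> length mu" using rowof_bounds(1)[OF vN] by simp
          with False have k0: "k > 0" "mu ! (k - 1) \<le> j" by auto
          have "mu ! rowof mu v \<le> mu ! (k - 1)"
            using sorted_wrt_nth_less[OF mu(1), of "k - 1" "rowof mu v"] nk k0 rowof_bounds(1)[OF vN] by auto
          then show False using colof_bounds(1)[OF vN] v k0 by simp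
        qed
        then show "v \<in> {v \<in> C. colof mu v = j}" using v vN mu by (simp add: C_def)
      qed
      then show ?thesis by (intro card_mono) (auto simp: C_def)
    qed
    have cols: "card S = (\<Sum>j<N. card {v \<in> S. colof mu v = j})" if S: "S \<subseteq> {..<N}" for S
    proof -
      have f: "finite S" using S by (rule finite_subset) simp
      have "colof mu ` S \<subseteq> {..<N}" using S by (auto simp: colof_def intro: le_less_trans[OF diff_le_self])
      from sum.group[OF f _ this, of "\<lambda>_. 1::nat"] show ?thesis by simp
    qed
    have "card A \<le> card C"
      unfolding cols[OF A] cols[of C, simplified C_def, folded C_def] using col by (subst (2) cols) (auto simp: C_def intro: sum_mono)
    then show ?thesis using cA cC la by (simp add: sum_take_dbl)
  qed
  then have "\<not> plt la (sizes Xs)" by (rule not_pltI)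
  then show False using plt by simp
qed

section \<open>Young symmetrizers\<close>

text \<open>Row and column groups are both stabilizers of a labelling, so reindexing by a
  transposition is proved once for both.\<close>

definition label_group :: "nat \<Rightarrow> (nat \<Rightarrow> nat) \<Rightarrow> (nat \<Rightarrow> nat) set" where
  "label_group N \<phi> = {s. s permutes {..<N} \<and> (\<forall>i<N. \<phi> (s i) = \<phi> i)}"

lemma row_group_eq: "row_group N mu = label_group N (rowof mu)"
  and col_group_eq: "col_group N mu = label_group N (colof mu)"
  by (simp_all add: row_group_def col_group_def label_group_def)

lemma label_group_permutes: "s \<in> label_group N \<phi> \<Longrightarrow> s permutes {..<N}"
  by (simp add: label_group_def)

lemma finite_label_group: "finite (label_group N \<phi>)"
  by (rule finite_subset[OF _ finite_permutations[of "{..<N}"]]) (auto simp: label_group_def)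

lemma id_label_group: "id \<in> label_group N \<phi>"
  by (simp add: label_group_def)

lemma comp_label_group:
  assumes "s \<in> label_group N \<phi>" "t \<in> label_group N \<phi>" shows "s \<circ> t \<in> label_group N \<phi>"
proof -
  have "t i < N" if "i < N" for i
    using permutes_in_image[of t "{..<N}" i] assms that by (simp add: label_group_def)
  then show ?thesis using assms by (auto simp: label_group_def permutes_compose)
qed

lemma transpose_label_group:
  "x < N \<Longrightarrow> y < N \<Longrightarrow> \<phi> x = \<phi> y \<Longrightarrow> transpose x y \<in> label_group N \<phi>"
  by (auto simp: label_group_def permutes_swap_id transpose_def)

lemma sum_label_group_transpose:
  assumes "x < N" "y < N" "\<phi> x = \<phi> y"
  shows "(\<Sum>s\<in>label_group N \<phi>. F (transpose x y \<circ> s)) = (\<Sum>s\<in>label_group N \<phi>. F s)"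
proof -
  have inv: "transpose x y \<circ> (transpose x y \<circ> s) = s" for s :: "nat \<Rightarrow> nat"
    by (simp flip: comp_assoc)
  show ?thesis
    by (rule sum.reindex_bij_witness[of _ "(\<circ>) (transpose x y)" "(\<circ>) (transpose x y)"])
       (use comp_label_group[OF transpose_label_group[OF assms]] inv in auto)
qed

lemma RM_perm:
  assumes s: "s permutes V"
  shows "perm_match s m \<in> RM V (map ((`) s) Xs) \<longleftrightarrow> m \<in> RM V Xs"
proof -
  have "perm_match s m \<in> PM V \<longleftrightarrow> m \<in> PM V"
    using perm_match_PM_permutes[OF s, of m] perm_match_PM_permutes[OF permutes_inv[OF s], of "perm_match s m"]
    by (auto simp: perm_match_inv[OF permutes_bij[OF s]])
  moreover have "s ` e \<subseteq> s ` X \<longleftrightarrow> e \<subseteq> X" for e X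
    using permutes_inj[OF s] by (rule inj_image_subset_iff)
  ultimately show ?thesis by (auto simp: RM_def perm_match_def)
qed

lemma blocks_perm:
  assumes s: "s permutes V" and bl: "blocks V Xs"
  shows "blocks V (map ((`) s) Xs)" "sizes (map ((`) s) Xs) = sizes Xs"
proof -
  have c: "card (s ` X) = card X" for X
    by (rule card_image) (use permutes_inj_on[OF s] in blast)
  have "\<Union>(set (map ((`) s) Xs)) = s ` V" using bl by (auto simp: blocks_def)
  moreover have "sorted_wrt (\<lambda>A B. A \<inter> B = {}) (map ((`) s) Xs)"
    using bl permutes_inj[OF s]
    by (auto simp: blocks_def sorted_wrt_map inj_image_eq_iff simp flip: image_Int elim: sorted_wrt_mono_rel[rotated])
  ultimately show "blocks V (map ((`) s) Xs)"
    using bl c permutes_image[OF s] by (auto simp: blocks_def)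
  show "sizes (map ((`) s) Xs) = sizes Xs" by (simp add: sizes_def c)
qed

text \<open>Shifts the row permutation onto the blocks, so that only the column permutation still
  acts on the matching.\<close>

lemma RM_perm_comp:
  assumes r: "r permutes V"
  shows "perm_match (r \<circ> c) m \<in> RM V Xs \<longleftrightarrow> perm_match c m \<in> RM V (map ((`) (inv r)) Xs)"
proof -
  have "map ((`) r) (map ((`) (inv r)) Xs) = Xs"
    using permutes_surj[OF r] by (simp add: image_comp surj_iff o_def image_image cong: map_cong)
  then show ?thesis using RM_perm[OF r, of "perm_match c m" "map ((`) (inv r)) Xs"]
    by (simp add: perm_match_comp)
qed

lemma blocks_image_transpose:
  assumes bl: "blocks V Xs" and X: "X \<in> set Xs" "x \<in> X" "y \<in> X"
  shows "map ((`) (transpose x y)) Xs = Xs"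
proof (rule map_idI)
  fix Y assume Y: "Y \<in> set Xs"
  have "x \<in> Y \<longleftrightarrow> y \<in> Y"
  proof (cases "X = Y")
    case False
    have "X \<inter> Y = {}"
    proof -
      obtain i j where ij: "i < length Xs" "X = Xs ! i" "j < length Xs" "Y = Xs ! j"
        using X(1) Y by (metis in_set_conv_nth)
      then have "i < j \<or> j < i" using False by (metis nat_neq_iff)
      then show ?thesis using bl ij unfolding blocks_def sorted_wrt_iff_nth_less
        by (metis Int_commute)
    qed
    then show ?thesis using X by blast
  qed (use X in simp)
  then show "transpose x y ` Y = Y" by (rule transpose_image_eq)
qed

text \<open>Sign-reversing pairing: composing c with the transposition of x and y stays in the
  group, flips the sign, and does not affect refinement because x and y share a block.\<close>

lemma alternating_sum_zero:
  assumes bl: "blocks {..<N} Xs" and X: "X \<in> set Xs" "x \<in> X" "y \<in> X" "x \<noteq> y" "\<phi> x = \<phi> y"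
  shows "(\<Sum>c\<in>label_group N \<phi>. real_of_int (sign c) * of_bool (perm_match c m \<in> RM {..<N} Xs)) = 0"
    (is "?S = 0")
proof -
  have xy: "x < N" "y < N" using bl X by (auto simp: blocks_def)
  let ?t = "transpose x y"
  have perm: "?t permutes {..<N}" using xy by (simp add: permutes_swap_id)
  have "?S = (\<Sum>c\<in>label_group N \<phi>. real_of_int (sign (?t \<circ> c)) * of_bool (perm_match (?t \<circ> c) m \<in> RM {..<N} Xs))"
    by (rule sum_label_group_transpose[OF xy X(5), symmetric])
  also have "\<dots> = (\<Sum>c\<in>label_group N \<phi>. - (real_of_int (sign c) * of_bool (perm_match c m \<in> RM {..<N} Xs)))"
  proof (rule sum.cong[OF refl])
    fix c assume "c \<in> label_group N \<phi>"
    then have "permutation c"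
      using label_group_permutes permutes_imp_permutation by blast
    then have "sign (?t \<circ> c) = - sign c"
      using X(4) by (simp add: sign_compose permutation_swap_id sign_swap_id)
    moreover have "perm_match (?t \<circ> c) m \<in> RM {..<N} Xs \<longleftrightarrow> perm_match c m \<in> RM {..<N} Xs"
      using RM_perm[OF perm, of "perm_match c m" Xs] blocks_image_transpose[OF bl X(1-3)]
      by (simp add: perm_match_comp)
    ultimately show "real_of_int (sign (?t \<circ> c)) * of_bool (perm_match (?t \<circ> c) m \<in> RM {..<N} Xs) =
      - (real_of_int (sign c) * of_bool (perm_match c m \<in> RM {..<N} Xs))" by simp
  qed
  also have "\<dots> = - ?S" by (simp add: sum_negf)
  finally show ?thesis by simp
qed

text \<open>In \<open>r \<circ> c\<close> the row permutation is applied last, so a transposition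
  within a row is absorbed by reindexing the sum over r.\<close>

lemma young_row_invariant:
  assumes xy: "x < N" "y < N" "rowof mu x = rowof mu y"
  shows "young N mu f (perm_match (transpose x y) m) = young N mu f m"
proof -
  let ?t = "transpose x y"
  have "act (r \<circ> c) f (perm_match ?t m) = act (?t \<circ> r \<circ> c) f m"
    if "r \<in> row_group N mu" "c \<in> col_group N mu" for r c
  proof -
    have b: "bij r" "bij c" using that label_group_permutes permutes_bij
      unfolding row_group_eq col_group_eq by blast+
    then have "inv (?t \<circ> (r \<circ> c)) = inv (r \<circ> c) \<circ> inv ?t"
      by (intro o_inv_distrib bij_comp) simp_all
    then show ?thesis by (simp add: act_def perm_match_comp comp_assoc)
  qed
  then have "young N mu f (perm_match ?t m) =
    (\<Sum>r\<in>row_group N mu. \<Sum>c\<in>col_group N mu. real_of_int (sign c) * act (?t \<circ> r \<circ> c) f m)"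
    by (simp add: young_def)
  also have "\<dots> = young N mu f m"
    unfolding young_def row_group_eq
    using sum_label_group_transpose[of x N y "rowof mu"
        "\<lambda>r. \<Sum>c\<in>col_group N mu. real_of_int (sign c) * act (r \<circ> c) f m", OF xy] by simp
  finally show ?thesis .
qed

text \<open>Moves the symmetrizer from f to the refinement condition. What remains to study is a
  signed count over the column group for one fixed matching.\<close>

lemma sum_young_RM:
  "sum (young N mu f) (RM {..<N} Xs) =
    (\<Sum>r\<in>row_group N mu. \<Sum>m\<in>PM {..<N}. f m *
       (\<Sum>c\<in>col_group N mu. real_of_int (sign c) * of_bool (perm_match (r \<circ> c) m \<in> RM {..<N} Xs)))"
proof -
  let ?V = "{..<N}"
  have one: "(\<Sum>m\<in>RM ?V Xs. act s f m) = (\<Sum>m\<in>PM ?V. f m * of_bool (perm_match s m \<in> RM ?V Xs))"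
    if s: "s permutes ?V" for s
  proof -
    have b: "bij s" using s by (rule permutes_bij)
    have "(\<Sum>m\<in>PM ?V. f m * of_bool (perm_match s m \<in> RM ?V Xs)) =
      (\<Sum>m\<in>PM ?V. act s f m * of_bool (m \<in> RM ?V Xs))"
      by (rule sum.reindex_bij_witness[of _ "perm_match (inv s)" "perm_match s"])
         (use b s in \<open>auto simp: perm_match_inv perm_match_inv' act_def perm_match_PM_permutes permutes_inv\<close>)
    also have "\<dots> = (\<Sum>m\<in>PM ?V. if m \<in> RM ?V Xs then act s f m else 0)"
      by (intro sum.cong) auto
    also have "\<dots> = (\<Sum>m\<in>PM ?V \<inter> RM ?V Xs. act s f m)"
      by (simp add: sum.inter_restrict finite_PM)
    also have "PM ?V \<inter> RM ?V Xs = RM ?V Xs" by (auto simp: RM_def)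
    finally show ?thesis by simp
  qed
  have "sum (young N mu f) (RM ?V Xs) =
    (\<Sum>r\<in>row_group N mu. \<Sum>c\<in>col_group N mu. real_of_int (sign c) * (\<Sum>m\<in>RM ?V Xs. act (r \<circ> c) f m))"
    unfolding young_def
    by (simp add: sum.swap[of _ _ "RM ?V Xs"] sum_distrib_left)
  also have "\<dots> = (\<Sum>r\<in>row_group N mu. \<Sum>c\<in>col_group N mu. real_of_int (sign c) *
     (\<Sum>m\<in>PM ?V. f m * of_bool (perm_match (r \<circ> c) m \<in> RM ?V Xs)))"
  proof (intro sum.cong refl)
    fix r c assume "r \<in> row_group N mu" "c \<in> col_group N mu"
    then have "r \<circ> c permutes ?V"
      unfolding row_group_eq col_group_eq by (intro permutes_compose label_group_permutes)
    from one[OF this] show "real_of_int (sign c) * (\<Sum>m\<in>RM ?V Xs. act (r \<circ> c) f m) =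
      real_of_int (sign c) * (\<Sum>m\<in>PM ?V. f m * of_bool (perm_match (r \<circ> c) m \<in> RM ?V Xs))" by simp
  qed
  also have "\<dots> = (\<Sum>r\<in>row_group N mu. \<Sum>m\<in>PM ?V. f m *
       (\<Sum>c\<in>col_group N mu. real_of_int (sign c) * of_bool (perm_match (r \<circ> c) m \<in> RM ?V Xs)))"
    by (simp add: sum_distrib_left sum.swap[of _ _ "PM ?V"] mult.left_commute)
  finally show ?thesis .
qed

text \<open>The inverse of r carries \<open>Xs\<close> to blocks of the same sizes. As their type is
  larger than \<open>la\<close>, some block meets a column twice, and the signed count
  cancels.\<close>

lemma sum_young_larger:
  assumes la: "la \<in> partitions n" and bl: "blocks {..<2*n} Xs" and plt: "plt la (sizes Xs)"
  shows "sum (young (2*n) (dbl la) f) (RM {..<2*n} Xs) = 0"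
  unfolding sum_young_RM
proof (intro sum.neutral ballI)
  let ?V = "{..<2*n}"
  fix r m assume r: "r \<in> row_group (2*n) (dbl la)" "m \<in> PM ?V"
  then have rp: "r permutes ?V" unfolding row_group_eq by (blast dest: label_group_permutes)
  let ?Ys = "map ((`) (inv r)) Xs"
  note bl' = blocks_perm[OF permutes_inv[OF rp] bl]
  have srt: "sorted_wrt (\<ge>) (dbl la)" "sum_list (dbl la) = 2 * n"
    using la by (auto simp: partitions_def sum_dbl sorted_wrt_map)
  obtain X x y where X: "X \<in> set ?Ys" "x \<in> X" "y \<in> X" "x \<noteq> y" "colof (dbl la) x = colof (dbl la) y"
    using same_block_same_column[OF srt refl bl'(1)] plt bl'(2) by metis
  show "f m * (\<Sum>c\<in>col_group (2 * n) (dbl la). real_of_int (sign c) *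
      of_bool (perm_match (r \<circ> c) m \<in> RM ?V Xs)) = 0"
    using alternating_sum_zero[OF bl'(1) X] by (simp add: RM_perm_comp[OF rp] col_group_eq)
qed

text \<open>With \<sigma> exchanging the two ends of every domino and d the action of c on even
  numbers only, c is the product of d and its conjugate by \<sigma>. The two factors have equal
  sign.\<close>

lemma sign_domino:
  fixes n :: nat
  assumes c: "c permutes {..<2*n}"
    and dom: "\<And>i. i < n \<Longrightarrow> even (c (2*i)) \<and> c (2*i+1) = c (2*i) + 1"
  shows "sign c = 1"
proof -
  define \<sigma> where "\<sigma> v = (if v < 2*n then if even (v::nat) then v + 1 else v - 1 else v)" for v :: nat
  define d where "d v = (if v < 2*n \<and> even v then c v else v)" for v
  have ev: "even (c v)" "c (v + 1) = c v + 1" if "v < 2*n" "even v" for v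
    using dom[of "v div 2"] that by auto
  have lt: "c v < 2 * n \<longleftrightarrow> v < 2 * n" for v using permutes_in_image[OF c, of v] by simp
  have \<sigma>\<sigma>: "\<sigma> (\<sigma> v) = v" for v
    unfolding \<sigma>_def by (auto elim!: evenE oddE)
  have "\<exists>!x. \<sigma> x = y" for y using \<sigma>\<sigma> by metis
  moreover have "\<sigma> x = x" if "x \<notin> {..<2*n}" for x using that by (simp add: \<sigma>_def)
  ultimately have \<sigma>p: "\<sigma> permutes {..<2*n}" unfolding permutes_def by blast
  have "inj_on d {..<2*n}"
    using permutes_inj[OF c] ev(1) by (auto simp: inj_on_def d_def dest: injD)
  moreover have "d ` {..<2*n} \<subseteq> {..<2*n}" using lt by (auto simp: d_def)
  ultimately have "bij_betw d {..<2*n} {..<2*n}"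
    unfolding bij_betw_def by (meson endo_inj_surj finite_lessThan)
  then have dp: "d permutes {..<2*n}" by (rule bij_imp_permutes) (simp add: d_def)
  have "c v = (d \<circ> (\<sigma> \<circ> d \<circ> \<sigma>)) v" for v
  proof -
    consider "\<not> v < 2*n" | "v < 2*n" "even v" | i where "i < n" "v = 2*i+1"
      by (metis Suc_eq_plus1 Suc_lessD mult_less_cancel1 oddE)
    then show ?thesis
    proof cases
      case 1
      then show ?thesis using c by (simp add: \<sigma>_def d_def permutes_not_in)
    next
      case 2
      then have "\<sigma> v = v + 1" by (simp add: \<sigma>_def)
      then have "\<sigma> (d (\<sigma> v)) = v" using 2 \<sigma>\<sigma>[of v] by (simp add: d_def)
      then show ?thesis using 2 by (simp add: d_def)
    next
      case 3
      then have "\<sigma> v = 2*i" by (simp add: \<sigma>_def)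
      moreover have "d (2*i) = c (2*i)" using 3 by (simp add: d_def)
      moreover have "\<sigma> (c (2*i)) = c (2*i) + 1" using dom[OF 3(1)] lt[of "2*i"] 3 by (simp add: \<sigma>_def)
      moreover have "d (c (2*i) + 1) = c (2*i) + 1" using dom[OF 3(1)] by (simp add: d_def)
      ultimately show ?thesis using dom[OF 3(1)] 3 by simp
    qed
  qed
  then have c_eq: "c = d \<circ> (\<sigma> \<circ> d \<circ> \<sigma>)" by blast
  have p: "permutation d" "permutation \<sigma>"
    using dp \<sigma>p by (auto intro: permutes_imp_permutation[OF finite_lessThan])
  have "sign c = sign d * (sign \<sigma> * sign d * sign \<sigma>)"
    unfolding c_eq by (simp add: sign_compose permutation_compose p)
  then show ?thesis by (cases d rule: sign_cases; cases \<sigma> rule: sign_cases) simp_all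
qed

definition dominoes :: "nat \<Rightarrow> nat set set" where
  "dominoes n = {{2*i, 2*i+1} | i. i < n}"

lemma dominoes_PM: "dominoes n \<in> PM {..<2*n}"
  unfolding PM_iff
proof (intro conjI ballI allI impI)
  show "\<Union>(dominoes n) = {..<2*n}"
  proof (intro equalityI subsetI)
    fix v assume v: "v \<in> {..<2*n}"
    have "v \<in> {2*(v div 2), 2*(v div 2)+1}" by (cases "even v") auto
    moreover have "v div 2 < n" using v by auto
    ultimately show "v \<in> \<Union>(dominoes n)" unfolding dominoes_def by blast
  qed (auto simp: dominoes_def)
  fix e assume "e \<in> dominoes n"
  then show "card e = 2" by (auto simp: dominoes_def)
  fix f v assume "f \<in> dominoes n" "v \<in> e" "v \<in> f"
  then show "e = f" using \<open>e \<in> dominoes n\<close> unfolding dominoes_def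
    by (auto; presburger)
qed

lemma even_sum_take_dbl: "even (sum_list (take k (dbl la)))"
  by (simp add: sum_take_dbl)

text \<open>A column permutation keeping every domino within a row moves dominoes to dominoes, hence it acts
  in the same way on the even and on the odd columns and is even.\<close>

lemma sum_young_dominoes:
  assumes la: "la \<in> partitions n"
  shows "sum (young (2*n) (dbl la) (\<lambda>m. of_bool (m = dominoes n))) (RM {..<2*n} (row_blocks (dbl la))) > 0"
proof -
  let ?V = "{..<2*n}" and ?mu = "dbl la" and ?m0 = "dominoes n" and ?Xs = "row_blocks (dbl la)"
  have N: "sum_list ?mu = 2 * n" using la by (simp add: partitions_def sum_dbl)
  have inner: "(\<Sum>c\<in>col_group (2*n) ?mu. real_of_int (sign c) * of_bool (perm_match (r \<circ> c) ?m0 \<in> RM ?V ?Xs)) > 0"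
    if r: "r \<in> row_group (2*n) ?mu" for r
  proof -
    have rp: "r permutes ?V" using r unfolding row_group_eq by (rule label_group_permutes)
    have "map ((`) (inv r)) ?Xs = ?Xs"
    proof (rule map_idI)
      fix X assume "X \<in> set ?Xs"
      then obtain k where k: "X = {v. v < 2*n \<and> rowof ?mu v = k}" using N by (auto simp: row_blocks_def)
      have memb: "v \<in> X \<longleftrightarrow> r v \<in> X" for v
        using r k permutes_in_image[OF rp, of v] by (auto simp: row_group_def)
      have "r ` X = X"
      proof (intro equalityI subsetI)
        fix x assume x: "x \<in> X"
        obtain y where "x = r y" using permutes_surj[OF rp] by (rule surjE)
        then show "x \<in> r ` X" using x memb[of y] by simp
      qed (use memb in blast)
      then show "inv r ` X = X" using image_inv_f_f[OF permutes_inj[OF rp], of X] by simp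
    qed
    then have iff: "perm_match (r \<circ> c) ?m0 \<in> RM ?V ?Xs \<longleftrightarrow> perm_match c ?m0 \<in> RM ?V ?Xs" for c
      using RM_perm_comp[OF rp, of c ?m0 ?Xs] by simp
    have sgn: "sign c = 1" if c: "c \<in> col_group (2*n) ?mu" and cm: "perm_match c ?m0 \<in> RM ?V ?Xs" for c
    proof (rule sign_domino)
      show cp: "c permutes ?V" using c unfolding col_group_eq by (rule label_group_permutes)
      fix i assume i: "i < n"
      then have "c ` {2*i, 2*i+1} \<in> perm_match c ?m0"
        unfolding perm_match_def dominoes_def by blast
      then obtain X where "X \<in> set ?Xs" "c ` {2*i, 2*i+1} \<subseteq> X" using cm by (auto simp: RM_def)
      then have row: "rowof ?mu (c (2*i)) = rowof ?mu (c (2*i+1))" by (auto simp: row_blocks_def)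
      have lt: "c (2*i) < sum_list ?mu" "c (2*i+1) < sum_list ?mu" "2*i < sum_list ?mu" "2*i+1 < sum_list ?mu"
        using permutes_in_image[OF cp, of "2*i"] permutes_in_image[OF cp, of "2*i+1"] i N by auto
      have col: "colof ?mu (c (2*i)) = colof ?mu (2*i)" "colof ?mu (c (2*i+1)) = colof ?mu (2*i+1)"
        using c i by (auto simp: col_group_def)
      let ?k = "rowof ?mu (2*i)"
      have k: "?k < length ?mu" "sum_list (take ?k ?mu) \<le> 2*i" "2*i < sum_list (take (Suc ?k) ?mu)"
        using rowof_bounds[OF lt(3)] by auto
      \<comment> \<open>Row boundaries are even numbers, so no domino straddles two rows.\<close>
      have "2*i+1 \<noteq> sum_list (take (Suc ?k) ?mu)"
        using even_sum_take_dbl[of "Suc ?k" la] by (metis even_plus_one_iff even_mult_iff even_numeral)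
      then have "rowof ?mu (2*i+1) = ?k" by (intro rowof_eqI) (use k in auto)
      then have "colof ?mu (2*i+1) = colof ?mu (2*i) + 1" using k(2) by (simp add: colof_def)
      moreover have "even (colof ?mu (2*i))"
        unfolding colof_def using even_sum_take_dbl[of ?k la] by simp
      ultimately show "even (c (2*i)) \<and> c (2*i+1) = c (2*i) + 1"
        using colof_bounds(2)[OF lt(1)] colof_bounds(2)[OF lt(2)] row col
          even_sum_take_dbl[of "rowof ?mu (c (2*i))" la]
        by (metis even_add add.assoc)
    qed
    \<comment> \<open>All surviving signs are 1, so the signed sum is a plain count, to which the
      identity contributes.\<close>
    have "(\<Sum>c\<in>col_group (2*n) ?mu. real_of_int (sign c) * of_bool (perm_match (r \<circ> c) ?m0 \<in> RM ?V ?Xs)) =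
      (\<Sum>c\<in>col_group (2*n) ?mu. of_bool (perm_match c ?m0 \<in> RM ?V ?Xs))"
      by (rule sum.cong) (use sgn iff in auto)
    also have "\<dots> > 0"
    proof (rule sum_pos2[of _ id])
      show "finite (col_group (2*n) ?mu)" "id \<in> col_group (2*n) ?mu"
        by (simp_all add: col_group_eq finite_label_group id_label_group)
      have "\<exists>X\<in>set ?Xs. {2*i, 2*i+1} \<subseteq> X" if i: "i < n" for i
      proof -
        have lt: "2*i < sum_list ?mu" using i N by simp
        let ?k = "rowof ?mu (2*i)"
        have k: "?k < length ?mu" "sum_list (take ?k ?mu) \<le> 2*i" "2*i < sum_list (take (Suc ?k) ?mu)"
          using rowof_bounds[OF lt] by auto
        have "2*i+1 \<noteq> sum_list (take (Suc ?k) ?mu)"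
          using even_sum_take_dbl[of "Suc ?k" la] by (metis even_plus_one_iff even_mult_iff even_numeral)
        then have "rowof ?mu (2*i+1) = ?k" by (intro rowof_eqI) (use k in auto)
        then have "{2*i, 2*i+1} \<subseteq> {v. v < sum_list ?mu \<and> rowof ?mu v = ?k}" using i N by auto
        then show ?thesis using k(1) by (auto simp: row_blocks_def)
      qed
      then show "0 < (of_bool (perm_match id ?m0 \<in> RM ?V ?Xs) :: real)"
        using dominoes_PM by (auto simp: RM_def dominoes_def)
    qed auto
    finally show ?thesis .
  qed
  have pick: "(\<Sum>m\<in>PM ?V. of_bool (m = ?m0) * F m) = F ?m0" for F :: "nat set set \<Rightarrow> real"
    by (subst sum.remove[OF finite_PM dominoes_PM]) (auto intro!: sum.neutral)
  show ?thesis
    unfolding sum_young_RM pick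
    by (rule sum_pos) (use inner id_label_group in \<open>auto simp: row_group_eq finite_label_group\<close>)
qed

section \<open>The associates act by scalars\<close>

lemma union_adj_perm:
  assumes s: "bij s"
  shows "(s a, s b) \<in> union_adj (perm_match s m) (perm_match s m') \<longleftrightarrow> (a, b) \<in> union_adj m m'"
proof -
  have "{s a, s b} \<in> perm_match s m \<longleftrightarrow> {a, b} \<in> m" for m
  proof
    assume "{s a, s b} \<in> perm_match s m"
    then obtain e where e: "e \<in> m" "s ` {a, b} = s ` e" by (auto simp: perm_match_def)
    then show "{a, b} \<in> m" using inj_image_eq_iff[OF bij_is_inj[OF s], of "{a, b}" e] by simp
  next
    assume "{a, b} \<in> m"
    then have "s ` {a, b} \<in> perm_match s m" unfolding perm_match_def by (rule imageI)
    then show "{s a, s b} \<in> perm_match s m" by simp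
  qed
  then show ?thesis by (simp add: union_adj_def)
qed

lemma comp_perm:
  assumes s: "bij s"
  shows "comp (perm_match s m) (perm_match s m') (s v) = s ` comp m m' v"
proof -
  have step: "s w \<in> comp (perm_match s m) (perm_match s m') (s v)"
    if "bij s" "w \<in> comp m m' v" for s m m' v w
  proof -
    have "(v, w) \<in> (union_adj m m')\<^sup>*" using that(2) by (simp add: comp_def)
    then have "(s v, s w) \<in> (union_adj (perm_match s m) (perm_match s m'))\<^sup>*"
    proof (induction rule: rtrancl_induct)
      case (step y z)
      then show ?case using union_adj_perm[OF that(1), of y z m m'] by (meson rtrancl.rtrancl_into_rtrancl)
    qed simp
    then show ?thesis by (simp add: comp_def)
  qed
  show ?thesis
  proof (intro equalityI subsetI)
    fix w assume "w \<in> comp (perm_match s m) (perm_match s m') (s v)"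
    from step[OF bij_imp_bij_inv[OF s] this] have "inv s w \<in> comp m m' v"
      using s by (simp add: perm_match_inv inv_f_f bij_is_inj)
    then show "w \<in> s ` comp m m' v" using s by (metis bij_inv_eq_iff image_eqI)
  qed (use step[OF s] in blast)
qed

lemma cycle_type_perm:
  assumes s: "s permutes {..<2*n}"
  shows "cycle_type n (perm_match s m) (perm_match s m') = cycle_type n m m'"
proof -
  let ?V = "{..<2*n}"
  have b: "bij s" using s by (rule permutes_bij)
  have "comp (perm_match s m) (perm_match s m') ` ?V = comp (perm_match s m) (perm_match s m') ` s ` ?V"
    using permutes_image[OF s] by simp
  also have "\<dots> = (`) s ` comp m m' ` ?V"
    by (simp add: image_image comp_perm[OF b])
  finally have im: "comp (perm_match s m) (perm_match s m') ` ?V = (`) s ` comp m m' ` ?V" .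
  have inj: "inj_on ((`) s) A" for A
    using bij_is_inj[OF b] by (simp add: inj_on_def inj_image_eq_iff)
  have "card (s ` C) = card C" for C
    by (rule card_image) (use bij_is_inj[OF b] in \<open>auto intro: inj_on_subset\<close>)
  then show ?thesis
    unfolding cycle_type_def im by (simp add: image_mset_mset_set[OF inj, symmetric] multiset.map_comp o_def)
qed

lemma union_adj_commute: "union_adj m m' = union_adj m' m"
  by (auto simp: union_adj_def)

lemma cycle_type_commute: "cycle_type n m m' = cycle_type n m' m"
  by (simp add: cycle_type_def comp_def union_adj_commute)

lemma assoc_op_act:
  assumes s: "s permutes {..<2*n}"
  shows "assoc_op n rho (act s f) = act s (assoc_op n rho f)"
proof
  fix m
  let ?V = "{..<2*n}"
  have si: "inv s permutes ?V" using s by (rule permutes_inv)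
  have b: "bij s" using s by (rule permutes_bij)
  have mem: "perm_match (inv s) m \<in> PM ?V \<longleftrightarrow> m \<in> PM ?V"
    using perm_match_PM_permutes[OF si, of m] perm_match_PM_permutes[OF s, of "perm_match (inv s) m"]
    by (auto simp: perm_match_inv'[OF b])
  have "(\<Sum>m'\<in>PM ?V. if cycle_type n m m' = rho then act s f m' else 0) =
     (\<Sum>m'\<in>PM ?V. if cycle_type n (perm_match (inv s) m) m' = rho then f m' else 0)"
    by (rule sum.reindex_bij_witness[of _ "perm_match s" "perm_match (inv s)"])
       (use perm_match_inv[OF b] perm_match_inv'[OF b] perm_match_PM_permutes[OF s]
          perm_match_PM_permutes[OF si] cycle_type_perm[OF si] in \<open>auto simp: act_def\<close>)
  moreover have "act s (assoc_op n rho f) m = assoc_op n rho f (perm_match (inv s) m)"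
    by (simp add: act_def)
  ultimately show "assoc_op n rho (act s f) m = act s (assoc_op n rho f) m"
    by (simp only: assoc_op_def matchings_eq_PM mem)
qed

lemma assoc_op_sum:
  "assoc_op n rho (\<lambda>m. \<Sum>i\<in>I. a i * F i m) = (\<lambda>m. \<Sum>i\<in>I. a i * assoc_op n rho (F i) m)"
proof
  fix m
  have "(\<Sum>m'\<in>matchings n. if cycle_type n m m' = rho then \<Sum>i\<in>I. a i * F i m' else 0) =
    (\<Sum>m'\<in>matchings n. \<Sum>i\<in>I. a i * (if cycle_type n m m' = rho then F i m' else 0))"
    by (intro sum.cong refl) auto
  also have "\<dots> = (\<Sum>i\<in>I. a i * (\<Sum>m'\<in>matchings n. if cycle_type n m m' = rho then F i m' else 0))"
    by (simp add: sum.swap[of _ I] sum_distrib_left)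
  finally show "assoc_op n rho (\<lambda>m. \<Sum>i\<in>I. a i * F i m) m = (\<Sum>i\<in>I. a i * assoc_op n rho (F i) m)"
    by (simp add: assoc_op_def)
qed

lemma assoc_op_scale: "assoc_op n rho (\<lambda>m. a * f m) = (\<lambda>m. a * assoc_op n rho f m)"
  using assoc_op_sum[of n rho "\<lambda>_. a" "\<lambda>_. f" "{()}"] by simp

text \<open>The symmetrizer is a linear combination of permutations, and these commute with the
  associates because cycle types are invariant.\<close>

lemma assoc_op_young:
  "assoc_op n rho (young (2*n) mu f) = young (2*n) mu (assoc_op n rho f)"
proof -
  have y: "young (2*n) mu f = (\<lambda>m. \<Sum>p\<in>row_group (2*n) mu \<times> col_group (2*n) mu.
      real_of_int (sign (snd p)) * act (fst p \<circ> snd p) f m)" for f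
    by (simp add: young_def sum.cartesian_product case_prod_unfold)
  have "assoc_op n rho (act (fst p \<circ> snd p) f) = act (fst p \<circ> snd p) (assoc_op n rho f)"
    if "p \<in> row_group (2*n) mu \<times> col_group (2*n) mu" for p
  proof (rule assoc_op_act)
    from that have "fst p permutes {..<2*n}" "snd p permutes {..<2*n}"
      by (auto simp: row_group_eq col_group_eq dest: label_group_permutes)
    then show "fst p \<circ> snd p permutes {..<2*n}" by (intro permutes_compose)
  qed
  then show ?thesis unfolding y assoc_op_sum by (intro ext sum.cong) simp_all
qed

section \<open>The image of the Young symmetrizer and the values of \<open>P\<close>\<close>

lemma vecsI: "(\<And>m. m \<notin> PM {..<2*n} \<Longrightarrow> f m = 0) \<Longrightarrow> f \<in> vecs n"
  by (simp add: vecs_def matchings_eq_PM)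

lemma assoc_op_vecs: "assoc_op n rho f \<in> vecs n"
  by (simp add: vecs_def assoc_op_def)

lemma young_vecs:
  assumes "f \<in> vecs n" shows "young (2*n) mu f \<in> vecs n"
proof (rule vecsI)
  fix m assume m: "m \<notin> PM {..<2*n}"
  show "young (2*n) mu f m = 0"
    unfolding young_def
  proof (intro sum.neutral ballI)
    fix r c assume "r \<in> row_group (2*n) mu" "c \<in> col_group (2*n) mu"
    then have s: "r \<circ> c permutes {..<2*n}"
      unfolding row_group_eq col_group_eq by (intro permutes_compose label_group_permutes)
    then have "perm_match (inv (r \<circ> c)) m \<notin> PM {..<2*n}"
      using perm_match_PM_permutes[OF s, of "perm_match (inv (r \<circ> c)) m"] m
      by (auto simp: perm_match_inv'[OF permutes_bij[OF s]])
    then show "real_of_int (sign c) * act (r \<circ> c) f m = 0"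
      using assms by (simp add: act_def vecs_def matchings_eq_PM)
  qed
qed

text \<open>By the vanishing criterion a row-invariant function orthogonal to all larger block lists is
  determined by its pairing with the rows of the tableau; hence the image of the Young symmetrizer
  is a line and every associate acts on it by a scalar.\<close>

lemma specht_eigenvector:
  assumes la: "la \<in> partitions n"
  obtains h where "\<And>rho. assoc_op n rho h = (\<lambda>m. P n la rho * h m)"
    and "sum h (RM {..<2*n} (row_blocks (dbl la))) \<noteq> 0"
    and "\<And>Xs. blocks {..<2*n} Xs \<Longrightarrow> plt la (sizes Xs) \<Longrightarrow> sum h (RM {..<2*n} Xs) = 0"
proof -
  let ?V = "{..<2*n}" and ?mu = "dbl la" and ?Xs = "row_blocks (dbl la)"
  let ?y = "young (2*n) ?mu"
  define \<delta> where "\<delta> = (\<lambda>m. of_bool (m = dominoes n) :: real)"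
  define h where "h = ?y \<delta>"
  have \<delta>: "\<delta> \<in> vecs n" using dominoes_PM by (auto simp: \<delta>_def intro!: vecsI)
  have h_vec: "h \<in> vecs n" unfolding h_def using \<delta> by (rule young_vecs)
  have pos: "sum h (RM ?V ?Xs) > 0" using sum_young_dominoes[OF la] by (simp add: h_def \<delta>_def)
  have line: "\<exists>t. ?y f = (\<lambda>m. t * h m)" if f: "f \<in> vecs n" for f
  proof -
    \<comment> \<open>This scalar makes g orthogonal to the matchings refining the rows.
      Orthogonality to larger lists comes from \<open>sum_young_larger\<close>, so the criterion
      yields g = 0.\<close>
    define t where "t = sum (?y f) (RM ?V ?Xs) / sum h (RM ?V ?Xs)"
    define g where "g m = ?y f m - t * h m" for m
    have sg: "sum g A = sum (?y f) A - t * sum h A" for A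
      by (simp add: g_def sum_subtractf sum_distrib_left)
    have "g m = 0" if m: "m \<in> PM ?V" for m
    proof (rule block_invariant_eq_0[OF _ blocks_row_blocks[OF la] _ _ _ m, of g])
      fix X x y m assume X: "X \<in> set ?Xs" "x \<in> X" "y \<in> X"
      then have "x < 2*n" "y < 2*n" "rowof ?mu x = rowof ?mu y"
        using la by (auto simp: row_blocks_def partitions_def sum_dbl)
      then show "g (perm_match (transpose x y) m) = g m"
        by (simp add: g_def h_def young_row_invariant)
    next
      show "sum g (RM ?V ?Xs) = 0" using pos by (simp add: sg t_def)
    next
      fix Ys assume "blocks ?V Ys" "plt (sizes ?Xs) (sizes Ys)"
      then show "sum g (RM ?V Ys) = 0"
        using sum_young_larger[OF la] by (simp add: sg h_def sizes_row_blocks)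
    qed simp
    moreover have "g m = 0" if "m \<notin> PM ?V" for m
      using that h_vec young_vecs[OF f, of ?mu] by (simp add: g_def vecs_def matchings_eq_PM)
    ultimately have "?y f m = t * h m" for m unfolding g_def by (cases "m \<in> PM ?V") force+
    then show ?thesis by blast
  qed
  \<comment> \<open>The description in \<open>P\<close> needs existence and uniqueness. Every
    generator of the space is a translate of a multiple of h, which gives existence; h itself lies
    in the space and is nonzero, which gives uniqueness.\<close>
  have eig: "P n la rho = t" if t: "assoc_op n rho h = (\<lambda>m. t * h m)" for rho t
    unfolding P_def
  proof (rule the_equality)
    show "\<forall>f\<in>specht_space n la. assoc_op n rho f = (\<lambda>m. t * f m)"
    proof
      fix f assume "f \<in> specht_space n la"
      then obtain S a where S: "S \<subseteq> {act s (?y f) | s f. s permutes ?V \<and> f \<in> vecs n}"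
        and f: "f = (\<lambda>m. \<Sum>v\<in>S. a v * v m)"
        by (auto simp: specht_space_def lspan_def)
      have "assoc_op n rho v = (\<lambda>m. t * v m)" if v: "v \<in> S" for v
      proof -
        obtain s f where s: "s permutes ?V" "f \<in> vecs n" "v = act s (?y f)" using S v by blast
        obtain t' where "?y f = (\<lambda>m. t' * h m)" using line[OF s(2)] by blast
        then have veq: "v = (\<lambda>m. t' * act s h m)" by (simp add: s(3) act_def)
        show ?thesis unfolding veq assoc_op_scale assoc_op_act[OF s(1)] t by (simp add: act_def mult.left_commute)
      qed
      then show "assoc_op n rho f = (\<lambda>m. t * f m)"
        unfolding f assoc_op_sum by (simp add: sum_distrib_left mult.left_commute)
    qed
    fix c assume c: "\<forall>f\<in>specht_space n la. assoc_op n rho f = (\<lambda>m. c * f m)"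
    have "act id h = h" by (simp add: act_def)
    then have "h \<in> {act s (?y f) | s f. s permutes ?V \<and> f \<in> vecs n}"
      using \<delta> unfolding h_def by (metis (mono_tags, lifting) mem_Collect_eq permutes_id)
    then have "h \<in> specht_space n la"
      unfolding specht_space_def lspan_def
      by (intro CollectI exI[of _ "{h}"] exI[of _ "\<lambda>_. 1"]) auto
    then have "(\<lambda>m. c * h m) = (\<lambda>m. t * h m)" using c t by simp
    then have "c * h m = t * h m" for m by (rule fun_cong)
    then have "c * sum h (RM ?V ?Xs) = t * sum h (RM ?V ?Xs)"
      by (simp only: sum_distrib_left)
    then show "c = t" using pos by simp
  qed
  show ?thesis
  proof (rule that)
    fix rho
    \<comment> \<open>After commuting, the associate applied to h is again a symmetrized vector,
      hence a multiple of h.\<close>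
    have "assoc_op n rho h = ?y (assoc_op n rho \<delta>)" unfolding h_def by (rule assoc_op_young)
    then obtain t where "assoc_op n rho h = (\<lambda>m. t * h m)" using line[OF assoc_op_vecs] by metis
    then show "assoc_op n rho h = (\<lambda>m. P n la rho * h m)" using eig by blast
  next
    show "sum h (RM ?V ?Xs) \<noteq> 0" using pos by simp
  next
    fix Xs assume "blocks ?V Xs" "plt la (sizes Xs)"
    then show "sum h (RM ?V Xs) = 0" unfolding h_def by (rule sum_young_larger[OF la])
  qed
qed

section \<open>Reduction to a linear system\<close>

lemma plt_trans: "plt a b \<Longrightarrow> plt b c \<Longrightarrow> plt a c"
proof (induction a arbitrary: b c)
  case (Cons x a)
  then obtain y b' z c' where "b = y # b'" "c = z # c'" by (metis plt_Nil(2) neq_Nil_conv)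
  then show ?case using Cons by (auto simp: plt_Cons)
qed simp

lemma plt_irrefl [simp]: "\<not> plt a a"
  by (auto simp: plt_def)

text \<open>\<open>plt\<close> never compares a list with a proper prefix of it. Positive entries
  and equal sums rule this case out.\<close>

lemma plt_total:
  assumes "0 \<notin> set a" "0 \<notin> set b" "sum_list a = sum_list b"
  shows "a = b \<or> plt a b \<or> plt b a"
  using assms
proof (induction a arbitrary: b)
  case Nil
  then show ?case by (cases b) auto
next
  case (Cons x a)
  then obtain y b' where b: "b = y # b'" by (cases b) auto
  show ?case
  proof (cases "x = y")
    case True
    then show ?thesis using Cons.IH[of b'] Cons.prems b by (auto simp: plt_Cons)
  next
    case False
    then show ?thesis using b by (auto simp: plt_Cons)
  qed
qed

text \<open>The head of a nonincreasing list is its maximum, so no rearrangement exceeds it. Hence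
  sorting the blocks of a fat list keeps it fat.\<close>

lemma sorted_plt:
  assumes "mset nu = mset la" "sorted_wrt (\<ge>) la" shows "nu = la \<or> plt nu la"
  using assms
proof (induction la arbitrary: nu)
  case (Cons y ys)
  then obtain z zs where nu: "nu = z # zs" by (cases nu) auto
  have "z \<in> set (y # ys)" using Cons.prems(1) nu by (metis list.set_intros(1) set_mset_mset)
  then have "z \<le> y" using Cons.prems(2) by auto
  show ?case
  proof (cases "z = y")
    case True
    then have "mset zs = mset ys" using Cons.prems(1) nu by simp
    then show ?thesis using Cons.IH[of zs] Cons.prems(2) nu True by (auto simp: plt_Cons)
  next
    case False
    then show ?thesis using \<open>z \<le> y\<close> nu by (simp add: plt_Cons)
  qed
qed simp

lemma length_le_sum_list: "0 \<notin> set xs \<Longrightarrow> length xs \<le> sum_list (xs :: nat list)"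
  by (induction xs) auto

text \<open>Sizes of block lists are compositions, so the induction over larger block lists counts
  these and not only partitions.\<close>

lemma finite_compositions: "finite {xs :: nat list. 0 \<notin> set xs \<and> sum_list xs = n}"
proof (rule finite_subset)
  show "{xs. 0 \<notin> set xs \<and> sum_list xs = n} \<subseteq> {xs. set xs \<subseteq> {..n} \<and> length xs \<le> n}"
  proof
    fix xs :: "nat list" assume xs: "xs \<in> {xs. 0 \<notin> set xs \<and> sum_list xs = n}"
    then have "x \<le> n" if "x \<in> set xs" for x using member_le_sum_list[OF that] by simp
    then show "xs \<in> {xs. set xs \<subseteq> {..n} \<and> length xs \<le> n}" using xs length_le_sum_list[of xs] by auto
  qed
qed (rule finite_lists_length_le, simp)

lemma finite_partitions: "finite (partitions n)"
  by (rule finite_subset[OF _ finite_compositions[of n]]) (auto simp: partitions_def)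

lemma plt_singleton:
  assumes "la \<in> partitions n" "n > 0" "la \<noteq> [n]" shows "plt la [n]"
proof -
  obtain x xs where x: "la = x # xs" using assms(1,2) by (cases la) (auto simp: partitions_def)
  have "x < n"
  proof (rule ccontr)
    assume "\<not> x < n"
    then have "sum_list xs = 0" "x = n" "0 \<notin> set xs" using assms(1) x by (auto simp: partitions_def)
    then have "xs = []" by (cases xs) auto
    then show False using assms(3) x \<open>x = n\<close> by simp
  qed
  then show ?thesis using x by (simp add: plt_Cons)
qed

section \<open>Block lists up to order and permutation\<close>

lemma blocks_iff:
  "blocks V Xs \<longleftrightarrow> \<Union>(set Xs) = V \<and> distinct Xs \<and> (\<forall>X\<in>set Xs. \<forall>Y\<in>set Xs. X \<noteq> Y \<longrightarrow> X \<inter> Y = {}) \<and>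
     (\<forall>X\<in>set Xs. finite X \<and> X \<noteq> {} \<and> even (card X))"
proof -
  have "sorted_wrt (\<lambda>A B. A \<inter> B = {}) Xs \<longleftrightarrow> distinct Xs \<and> (\<forall>X\<in>set Xs. \<forall>Y\<in>set Xs. X \<noteq> Y \<longrightarrow> X \<inter> Y = {})"
    if "\<forall>X\<in>set Xs. X \<noteq> {}"
    using that
  proof (induction Xs)
    case (Cons Z Zs)
    have e1: "(\<forall>Y\<in>set Zs. Z \<inter> Y = {}) \<longleftrightarrow> Z \<notin> set Zs \<and> (\<forall>Y\<in>set Zs. Z \<noteq> Y \<longrightarrow> Z \<inter> Y = {})"
      using Cons.prems by (metis Int_absorb list.set_intros(1))
    have e2: "(\<forall>X\<in>set (Z # Zs). \<forall>Y\<in>set (Z # Zs). X \<noteq> Y \<longrightarrow> X \<inter> Y = {}) \<longleftrightarrow>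
      (\<forall>Y\<in>set Zs. Z \<noteq> Y \<longrightarrow> Z \<inter> Y = {}) \<and> (\<forall>X\<in>set Zs. \<forall>Y\<in>set Zs. X \<noteq> Y \<longrightarrow> X \<inter> Y = {})"
      by (metis Int_commute set_ConsD list.set_intros)
    have e3: "sorted_wrt (\<lambda>A B. A \<inter> B = {}) Zs \<longleftrightarrow> distinct Zs \<and> (\<forall>X\<in>set Zs. \<forall>Y\<in>set Zs. X \<noteq> Y \<longrightarrow> X \<inter> Y = {})"
      using Cons by simp
    show ?case unfolding sorted_wrt.simps distinct.simps e1 e2 e3 by blast
  qed simp
  then show ?thesis unfolding blocks_def by blast
qed

lemma card_block: "blocks V Xs \<Longrightarrow> X \<in> set Xs \<Longrightarrow> card X = 2 * (card X div 2)"
  by (auto simp: blocks_def)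

lemma sizes_blocks:
  assumes "blocks {..<2*n} Xs" shows "0 \<notin> set (sizes Xs)" "sum_list (sizes Xs) = n"
proof -
  have "card X div 2 \<noteq> 0" if "X \<in> set Xs" for X
    using card_block[OF assms that] assms that card_0_eq[of X] unfolding blocks_def by (metis mult_0_right)
  then show "0 \<notin> set (sizes Xs)" by (force simp: sizes_def)
  have "card {..<2*n} = 2 * sum_list (sizes Xs)"
    using sum_list_sizes[of Xs] assms by (auto simp: blocks_def)
  then show "sum_list (sizes Xs) = n" by simp
qed

lemma disjoint_families_bij:
  assumes "map card Xs = map card Ys"
    and "sorted_wrt (\<lambda>A B. A \<inter> B = {}) Xs" "sorted_wrt (\<lambda>A B. A \<inter> B = {}) Ys"
    and "\<forall>X\<in>set Xs. finite X" "\<forall>Y\<in>set Ys. finite Y"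
  shows "\<exists>f. bij_betw f (\<Union>(set Xs)) (\<Union>(set Ys)) \<and> map ((`) f) Xs = Ys"
  using assms
proof (induction Xs arbitrary: Ys)
  case (Cons X Xs)
  then obtain Y Ys' where Ys: "Ys = Y # Ys'" by (cases Ys) auto
  obtain f where f: "bij_betw f (\<Union>(set Xs)) (\<Union>(set Ys'))" "map ((`) f) Xs = Ys'"
    using Cons.IH[of Ys'] Cons.prems Ys by auto
  obtain g where g: "bij_betw g X Y"
    using finite_same_card_bij[of X Y] Cons.prems Ys by auto
  define h where "h v = (if v \<in> X then g v else f v)" for v
  have d: "X \<inter> \<Union>(set Xs) = {}" "Y \<inter> \<Union>(set Ys') = {}" using Cons.prems Ys by auto
  have hX: "bij_betw h X Y" using g by (rule bij_betw_cong[THEN iffD1, rotated]) (simp add: h_def)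
  have hf: "h v = f v" if "v \<in> \<Union>(set Xs)" for v using d that by (auto simp: h_def)
  have "bij_betw h (\<Union>(set Xs)) (\<Union>(set Ys'))"
    using f(1) by (rule bij_betw_cong[THEN iffD1, rotated]) (simp add: hf)
  from bij_betw_combine[OF hX this d(2)]
  have "bij_betw h (\<Union>(set (X # Xs))) (\<Union>(set Ys))" using Ys by simp
  moreover have "h ` Z = f ` Z" if "Z \<in> set Xs" for Z
    by (rule image_cong[OF refl]) (use hf that in blast)
  then have "map ((`) h) (X # Xs) = Ys"
    using f(2) Ys hX by (auto simp: bij_betw_def)
  ultimately show ?case by blast
qed (auto simp: bij_betw_def)

text \<open>An invariant quantity thus depends on a block list only through its sizes, and the rows
  of a tableau can stand for every list of sorted sizes.\<close>

lemma blocks_transport: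
  assumes "blocks V Xs" "blocks V Ys" "sizes Xs = sizes Ys"
  obtains s where "s permutes V" "map ((`) s) Xs = Ys"
proof -
  have c: "map card Zs = map ((*) 2) (sizes Zs)" if "blocks V Zs" for Zs
    using card_block[OF that] by (simp add: sizes_def)
  have "map card Xs = map card Ys" using c[OF assms(1)] c[OF assms(2)] assms(3) by simp
  then obtain f where f: "bij_betw f (\<Union>(set Xs)) (\<Union>(set Ys))" "map ((`) f) Xs = Ys"
    using disjoint_families_bij[of Xs Ys] assms by (auto simp: blocks_def)
  have u: "\<Union>(set Xs) = V" "\<Union>(set Ys) = V" using assms by (auto simp: blocks_def)
  define s where "s v = (if v \<in> V then f v else v)" for v
  have "bij_betw s V V" using f(1)[unfolded u] by (rule bij_betw_cong[THEN iffD1, rotated]) (simp add: s_def)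
  then have "s permutes V" by (rule bij_imp_permutes) (simp add: s_def)
  moreover have "s ` X = f ` X" if "X \<in> set Xs" for X
    by (rule image_cong[OF refl]) (use that u(1) in \<open>auto simp: s_def\<close>)
  then have "map ((`) s) Xs = Ys" using f(2) by auto
  ultimately show ?thesis using that by blast
qed

lemma sort_blocks:
  assumes "blocks V Xs"
  obtains Ys where "blocks V Ys" "set Ys = set Xs" "mset (sizes Ys) = mset (sizes Xs)"
    "sorted_wrt (\<ge>) (sizes Ys)"
proof -
  let ?f = "\<lambda>X. card X div 2"
  define Ys where "Ys = rev (sort_key ?f Xs)"
  have m: "mset Ys = mset Xs" by (simp add: Ys_def)
  then have s: "set Ys = set Xs" by (metis set_mset_mset)
  have "distinct Ys" using m assms by (metis blocks_iff mset_eq_imp_distinct_iff)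
  then have "blocks V Ys" using assms s by (simp add: blocks_iff)
  moreover have "mset (sizes Ys) = mset (sizes Xs)" by (simp add: sizes_def m)
  moreover have "sorted (rev (sizes Ys))" by (simp add: sizes_def Ys_def rev_map)
  then have "sorted_wrt (\<ge>) (sizes Ys)" by (simp add: sorted_wrt_rev)
  ultimately show ?thesis using that s by blast
qed

text \<open>The quadratic form of the associate of \<open>rho\<close> at the indicator of the
  matchings refining the rows of \<open>la\<close>.\<close>

definition pair_count :: "nat \<Rightarrow> nat list \<Rightarrow> nat list \<Rightarrow> real" where
  "pair_count n la rho = (\<Sum>m\<in>RM {..<2*n} (row_blocks (dbl la)). \<Sum>m'\<in>RM {..<2*n} (row_blocks (dbl la)).
     of_bool (cycle_type n m m' = rho))"

text \<open>The squared norm of the same indicator. Its square divided by the number of all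
  matchings is the quadratic form of E.\<close>

definition refining :: "nat \<Rightarrow> nat list \<Rightarrow> real" where
  "refining n la = real (card (RM {..<2*n} (row_blocks (dbl la))))"

text \<open>The operator with kernel \<open>A\<close> is $\sum_\rho x_\rho A_\rho - \zeta - (1-\zeta)E$ with $E$ the
  projection onto the constants.  The hypothesis says that its quadratic form vanishes on the
  indicator of the matchings refining the rows of each fat tableau; descending induction turns this
  into the vanishing of the operator itself on all these indicators.\<close>

lemma eigenvalues_from_pair_counts:
  fixes X :: "nat list \<Rightarrow> real" and z :: real
  assumes n: "n > 0" and S: "S = {la \<in> partitions n. plt a la}"
    and sys: "\<And>la. la \<in> S \<Longrightarrow> (\<Sum>rho\<in>S. X rho * pair_count n la rho) =
        z * refining n la + (1 - z) * (refining n la)\<^sup>2 / real (card (PM {..<2*n}))"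
    and la: "la \<in> S"
  shows "(\<Sum>rho\<in>S. X rho * P n la rho) = (if la = [n] then 1 else z)"
proof -
  let ?V = "{..<2*n}"
  define N where "N = real (card (PM ?V))"
  have N0: "N \<noteq> 0" using dominoes_PM finite_PM[of ?V] by (auto simp: N_def)
  define A where "A m m' = (\<Sum>rho\<in>S. X rho * of_bool (cycle_type n m m' = rho)) - z * of_bool (m = m') - (1 - z) / N"
    for m m'
  have A_sym: "A m m' = A m' m" for m m' by (simp add: A_def cycle_type_commute eq_commute)
  have A_perm: "A (perm_match s m) (perm_match s m') = A m m'" if s: "s permutes ?V" for s m m'
    using inj_perm_match[OF permutes_bij[OF s]] by (simp add: A_def cycle_type_perm[OF s] inj_eq)
  \<comment> \<open>\<open>b Xs\<close> is the operator with kernel A applied to the indicator of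
    \<open>RM ?V Xs\<close>, and \<open>Q Xs\<close> its quadratic form there.\<close>
  define b where "b Xs m = (\<Sum>m'\<in>RM ?V Xs. A m m')" for Xs m
  define Q where "Q Xs = (\<Sum>m\<in>RM ?V Xs. b Xs m)" for Xs
  have finRM: "finite (RM ?V Xs)" for Xs
    by (rule finite_subset[OF _ finite_PM[of ?V]]) (auto simp: RM_def)
  have reindex: "(\<Sum>m\<in>RM ?V (map ((`) s) Xs). F m) = (\<Sum>m\<in>RM ?V Xs. F (perm_match s m))"
    if s: "s permutes ?V" for s Xs and F :: "nat set set \<Rightarrow> real"
  proof (rule sum.reindex_bij_witness[of _ "perm_match s" "perm_match (inv s)"])
    have b: "bij s" using s by (rule permutes_bij)
    show "perm_match (inv s) m \<in> RM ?V Xs" if "m \<in> RM ?V (map ((`) s) Xs)" for m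
      using that RM_perm[OF s, of "perm_match (inv s) m" Xs] by (simp add: perm_match_inv'[OF b])
    show "perm_match s m \<in> RM ?V (map ((`) s) Xs)" if "m \<in> RM ?V Xs" for m
      using that RM_perm[OF s] by simp
  qed (use perm_match_inv[OF permutes_bij[OF s]] perm_match_inv'[OF permutes_bij[OF s]] in auto)
  have Q_perm: "Q (map ((`) s) Xs) = Q Xs" if s: "s permutes ?V" for s Xs
    by (simp add: Q_def b_def reindex[OF s] A_perm[OF s])
  have Q0: "Q (row_blocks (dbl la)) = 0" if la: "la \<in> S" for la
  proof -
    let ?R = "RM ?V (row_blocks (dbl la))"
    have "Q (row_blocks (dbl la)) = (\<Sum>m\<in>?R. \<Sum>m'\<in>?R. \<Sum>rho\<in>S. X rho * of_bool (cycle_type n m m' = rho))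
        - z * (\<Sum>m\<in>?R. \<Sum>m'\<in>?R. of_bool (m = m')) - (\<Sum>m\<in>?R. \<Sum>m'\<in>?R. (1 - z) / N)"
      unfolding Q_def b_def A_def by (simp add: sum_subtractf sum_distrib_left)
    also have "(\<Sum>m\<in>?R. \<Sum>m'\<in>?R. \<Sum>rho\<in>S. X rho * of_bool (cycle_type n m m' = rho)) =
       (\<Sum>rho\<in>S. X rho * pair_count n la rho)"
      unfolding pair_count_def sum_distrib_left
      by (simp add: sum.swap[of _ S] cong: sum.cong)
    also have "(\<Sum>m\<in>?R. \<Sum>m'\<in>?R. of_bool (m = m')) = refining n la"
    proof -
      have "(\<Sum>m'\<in>?R. of_bool (m = m')) = (1::real)" if "m \<in> ?R" for m
        by (subst sum.remove[OF finRM that]) (auto intro: sum.neutral)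
      then show ?thesis by (simp add: refining_def)
    qed
    also have "(\<Sum>m\<in>?R. \<Sum>m'\<in>?R. (1 - z) / N) = (1 - z) * (refining n la)\<^sup>2 / N"
      by (simp add: refining_def power2_eq_square)
    finally show ?thesis using sys[OF la] by (simp add: N_def)
  qed
  have b0: "b Xs m = 0" if "blocks ?V Xs" "plt a (sizes Xs)" "m \<in> PM ?V" for Xs m
    using that
  proof (induction "card {ys. 0 \<notin> set ys \<and> sum_list ys = n \<and> plt (sizes Xs) ys}" arbitrary: Xs m rule: less_induct)
    case less
    note bl = less.prems(1) and fat = less.prems(2)
    show ?case
    proof (rule block_invariant_eq_0[OF _ bl _ _ _ less.prems(3), of "b Xs"])
      fix Y x y m assume Y: "Y \<in> set Xs" "x \<in> Y" "y \<in> Y"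
      then have "x \<in> ?V" "y \<in> ?V" using bl by (auto simp: blocks_def)
      then have t: "transpose x y permutes ?V" by (simp add: permutes_swap_id)
      have "b Xs (perm_match (transpose x y) m) = (\<Sum>m'\<in>RM ?V (map ((`) (transpose x y)) Xs). A (perm_match (transpose x y) m) m')"
        by (simp add: b_def blocks_image_transpose[OF bl Y])
      also have "\<dots> = b Xs m" unfolding reindex[OF t] by (simp add: A_perm[OF t] b_def)
      finally show "b Xs (perm_match (transpose x y) m) = b Xs m" .
    next
      \<comment> \<open>The set of refining matchings ignores the order of the blocks. Sorting can
        only raise the type, so the sorted list is still fat, and it is a permuted copy of the rows
        of a tableau, where Q vanishes.\<close>
      obtain Ys where Ys: "blocks ?V Ys" "set Ys = set Xs" "mset (sizes Ys) = mset (sizes Xs)"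
        "sorted_wrt (\<ge>) (sizes Ys)" using sort_blocks[OF bl] .
      let ?nu = "sizes Ys"
      have nu: "?nu \<in> partitions n" using sizes_blocks[OF Ys(1)] Ys(4) by (simp add: partitions_def)
      have "sizes Xs = ?nu \<or> plt (sizes Xs) ?nu" using sorted_plt[of "sizes Xs" ?nu] Ys by simp
      then have "plt a ?nu" using fat plt_trans by metis
      then have nuS: "?nu \<in> S" using nu S by simp
      obtain s where s: "s permutes ?V" "map ((`) s) (row_blocks (dbl ?nu)) = Ys"
        using blocks_transport[OF blocks_row_blocks[OF nu] Ys(1)] sizes_row_blocks by metis
      have "RM ?V Xs = RM ?V Ys" using Ys(2) by (simp add: RM_def)
      then have "Q Xs = Q Ys" by (simp add: Q_def b_def)
      also have "\<dots> = 0" using Q_perm[OF s(1), of "row_blocks (dbl ?nu)"] Q0[OF nuS] s(2) by simp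
      finally show "sum (b Xs) (RM ?V Xs) = 0" by (simp add: Q_def)
    next
      fix Ys assume Ys: "blocks ?V Ys" "plt (sizes Xs) (sizes Ys)"
      have "{ys. 0 \<notin> set ys \<and> sum_list ys = n \<and> plt (sizes Ys) ys} \<subset> {ys. 0 \<notin> set ys \<and> sum_list ys = n \<and> plt (sizes Xs) ys}"
        using Ys(2) plt_trans sizes_blocks[OF Ys(1)] plt_irrefl by blast
      moreover have "finite {ys. 0 \<notin> set ys \<and> sum_list ys = n \<and> plt (sizes Xs) ys}"
        by (rule finite_subset[OF _ finite_compositions[of n]]) blast
      ultimately have "card {ys. 0 \<notin> set ys \<and> sum_list ys = n \<and> plt (sizes Ys) ys} < card {ys. 0 \<notin> set ys \<and> sum_list ys = n \<and> plt (sizes Xs) ys}"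
        by (rule psubset_card_mono[rotated])
      note IH = less.hyps[OF this Ys(1) plt_trans[OF fat Ys(2)]]
      \<comment> \<open>By symmetry of A, pairing \<open>b Xs\<close> with the larger list
        \<open>Ys\<close> is pairing \<open>b Ys\<close> with \<open>Xs\<close>, and
        \<open>b Ys\<close> vanishes by induction.\<close>
      have "sum (b Xs) (RM ?V Ys) = (\<Sum>m'\<in>RM ?V Xs. \<Sum>m\<in>RM ?V Ys. A m m')"
        unfolding b_def by (rule sum.swap)
      also have "\<dots> = (\<Sum>m'\<in>RM ?V Xs. b Ys m')" by (simp add: b_def A_sym)
      also have "\<dots> = 0" by (rule sum.neutral) (use IH in \<open>auto simp: RM_def\<close>)
      finally show "sum (b Xs) (RM ?V Ys) = 0" .
    qed simp
  qed
  have laP: "la \<in> partitions n" "plt a la" using la S by auto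
  let ?T = "row_blocks (dbl la)"
  obtain h where h: "\<And>rho. assoc_op n rho h = (\<lambda>m. P n la rho * h m)" "sum h (RM ?V ?T) \<noteq> 0"
    "\<And>Xs. blocks ?V Xs \<Longrightarrow> plt la (sizes Xs) \<Longrightarrow> sum h (RM ?V Xs) = 0"
    using specht_eigenvector[OF laP(1)] by blast
  define c where "c = (\<Sum>rho\<in>S. X rho * P n la rho)"
  have row: "(\<Sum>m\<in>PM ?V. h m * A m m') = (c - z) * h m' - (1 - z) / N * sum h (PM ?V)"
    if m': "m' \<in> PM ?V" for m'
  proof -
    have P: "(\<Sum>m\<in>PM ?V. h m * of_bool (cycle_type n m m' = rho)) = P n la rho * h m'" for rho
    proof -
      have "(\<Sum>m\<in>PM ?V. h m * of_bool (cycle_type n m m' = rho)) = assoc_op n rho h m'"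
        unfolding assoc_op_def matchings_eq_PM using m'
        by (auto simp: cycle_type_commute[of n m'] intro!: sum.cong)
      then show ?thesis using h(1) by simp
    qed
    have "(\<Sum>m\<in>PM ?V. h m * A m m') =
       (\<Sum>rho\<in>S. X rho * (\<Sum>m\<in>PM ?V. h m * of_bool (cycle_type n m m' = rho)))
       - z * (\<Sum>m\<in>PM ?V. h m * of_bool (m = m')) - (1 - z) / N * sum h (PM ?V)"
      unfolding A_def
      by (simp add: sum_subtractf sum_distrib_left right_diff_distrib sum.swap[of _ S] mult_ac)
    also have "(\<Sum>m\<in>PM ?V. h m * of_bool (m = m')) = h m'"
      by (subst sum.remove[OF finite_PM m']) (auto intro!: sum.neutral)
    finally have E: "(\<Sum>m\<in>PM ?V. h m * A m m') =
      (\<Sum>rho\<in>S. X rho * (P n la rho * h m')) - z * h m' - (1 - z) / N * sum h (PM ?V)"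
      unfolding P .
    show ?thesis unfolding E c_def by (simp add: sum_distrib_right left_diff_distrib mult.assoc)
  qed
  \<comment> \<open>Pairing h with the vanishing function \<open>b ?T\<close> and applying the
    kernel to the eigenvector h instead leaves one scalar equation for c.\<close>
  have "0 = (\<Sum>m\<in>PM ?V. h m * b ?T m)"
    using b0[OF blocks_row_blocks[OF laP(1)]] laP(2) by (simp add: sizes_row_blocks)
  also have "\<dots> = (\<Sum>m'\<in>RM ?V ?T. \<Sum>m\<in>PM ?V. h m * A m m')"
    unfolding b_def sum_distrib_left by (rule sum.swap)
  also have "\<dots> = (\<Sum>m'\<in>RM ?V ?T. (c - z) * h m' - (1 - z) / N * sum h (PM ?V))"
    by (rule sum.cong) (use row in \<open>auto simp: RM_def\<close>)
  also have "\<dots> = (c - z) * sum h (RM ?V ?T) - refining n la * ((1 - z) / N * sum h (PM ?V))"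
    by (simp add: sum_subtractf sum_distrib_left refining_def)
  finally have main: "(c - z) * sum h (RM ?V ?T) = refining n la * ((1 - z) / N * sum h (PM ?V))" by simp
  have whole: "RM ?V [?V] = PM ?V" using PM_subset by (fastforce simp: RM_def)
  have bl1: "blocks ?V [?V]" "sizes [?V] = [n]" using n by (auto simp: blocks_def sizes_def lessThan_empty_iff)
  \<comment> \<open>For \<open>[n]\<close> both sides of \<open>main\<close> carry the same nonzero
    sum of h, so c = 1. Any other \<open>la\<close> lies below \<open>[n]\<close>, hence h is
    orthogonal to the constants, the right side vanishes and c = z.\<close>
  show ?thesis
  proof (cases "la = [n]")
    case True
    have "{v. v < 2 * n \<and> rowof [2 * n] v = 0} = ?V"
      using rowof_eqI[of 0 "[2*n]"] by auto
    then have "?T = [?V]" using True by (simp add: row_blocks_def)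
    then have "refining n la = N" "RM ?V ?T = PM ?V" by (simp_all add: refining_def N_def whole)
    then have "(c - z) * sum h (PM ?V) = (1 - z) * sum h (PM ?V)" using main N0 by simp
    then have "c = 1" using h(2) \<open>RM ?V ?T = PM ?V\<close> by simp
    then show ?thesis using True by (simp add: c_def)
  next
    case False
    have "plt la [n]" using plt_singleton[OF laP(1) n False] .
    then have "sum h (PM ?V) = 0" using h(3)[OF bl1(1)] bl1(2) whole by simp
    then show ?thesis using main h(2) False by (simp add: c_def)
  qed
qed

section \<open>Counting Hamiltonian partners\<close>

lemma PM_insert:
  assumes "m \<in> PM W" "a \<noteq> x" "a \<notin> W" "x \<notin> W"
  shows "insert {a, x} m \<in> PM (insert a (insert x W))"
proof -
  have "v \<in> W" if "e \<in> m" "v \<in> e" for e v using PM_subset[OF assms(1)] that by blast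
  then show ?thesis using assms unfolding PM_iff by auto
qed

lemma PM_remove:
  assumes "m \<in> PM V" "e \<in> m" shows "m - {e} \<in> PM (V - e)"
  using assms unfolding PM_iff by blast

lemma perm_match_transpose_PM:
  assumes "m \<in> PM W" "x \<in> W" "b \<notin> W"
  shows "perm_match (transpose x b) m \<in> PM (insert b (W - {x}))"
proof -
  have "transpose x b ` W = insert b (W - {x})"
    using assms(2,3) by (auto simp: transpose_def image_iff)
  then show ?thesis using perm_match_PM[OF inj_on_transpose assms(1), of x b] by simp
qed

text \<open>If {x, y} is the edge of \<open>m\<close> at x, it is replaced by {x, a} and {b, y}.
  When {a, b} is an edge of the other matching, this splices the path x, a, b, y into the cycle in
  place of that edge.\<close>

definition attach :: "nat \<Rightarrow> nat \<Rightarrow> nat set set \<Rightarrow> nat \<Rightarrow> nat set set" where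
  "attach a b m x = insert {a, x} (perm_match (transpose x b) m)"

lemma attach_PM:
  assumes "m \<in> PM W" "x \<in> W" "a \<notin> W" "b \<notin> W" "a \<noteq> b"
  shows "attach a b m x \<in> PM (insert a (insert b W))"
proof -
  have "insert a (insert x (insert b (W - {x}))) = insert a (insert b W)" using assms by auto
  then show ?thesis
    using PM_insert[OF perm_match_transpose_PM[OF assms(1,2,4)], of a x] assms
    unfolding attach_def by auto
qed

lemma attach_inj:
  assumes ab: "a \<notin> W" "b \<notin> W" "a \<noteq> b"
  shows "inj_on (\<lambda>(m, x). attach a b m x) (PM W \<times> W)"
proof (rule inj_onI, clarify)
  fix m x m' x'
  assume m: "m \<in> PM W" "x \<in> W" "m' \<in> PM W" "x' \<in> W" and eq: "attach a b m x = attach a b m' x'"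
  have notin: "{a, y} \<notin> perm_match (transpose y b) m" if "m \<in> PM W" "y \<in> W" for m y
    using PM_subset[OF perm_match_transpose_PM[OF that ab(2)], of "{a, y}"] ab by auto
  have "{x, a} \<in> attach a b m x" "{x', a} \<in> attach a b m x"
    using eq by (auto simp: attach_def insert_commute)
  from PM_pair_unique[OF attach_PM[OF m(1,2) ab] this] have "x = x'" .
  moreover from this have "perm_match (transpose x b) m = perm_match (transpose x b) m'"
    using eq notin[OF m(1,2)] notin[OF m(3,4)] unfolding attach_def by (metis insert_ident)
  then have "m = m'" by (metis perm_match_transpose2)
  ultimately show "m = m' \<and> x = x'" by simp
qed

text \<open>The inverse of the splicing: x is the partner of a; deleting {a, x} and renaming b to x
  contracts the path again.\<close>

lemma attach_surj:
  assumes m: "m \<in> PM V" and ab: "a \<in> V" "b \<in> V" "a \<noteq> b" "{a, b} \<notin> m"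
  obtains m' x where "m' \<in> PM (V - {a, b})" "x \<in> V - {a, b}" "m = attach a b m' x"
proof -
  obtain x where x: "x \<noteq> a" "x \<in> V" "{a, x} \<in> m" using PM_partner[OF m ab(1)] .
  have xb: "x \<noteq> b" using x ab by auto
  have "perm_match (transpose b x) (m - {{a, x}}) \<in> PM (insert x (V - {a, x} - {b}))"
    by (rule perm_match_transpose_PM[OF PM_remove[OF m x(3)]]) (use ab xb in auto)
  moreover have "insert x (V - {a, x} - {b}) = V - {a, b}" using x xb ab by auto
  ultimately have "perm_match (transpose x b) (m - {{a, x}}) \<in> PM (V - {a, b})"
    by (simp add: transpose_commute)
  moreover have "m = attach a b (perm_match (transpose x b) (m - {{a, x}})) x"
    unfolding attach_def using x(3) by auto
  ultimately show ?thesis using that x xb by blast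
qed

lemma card_PM_grow:
  assumes "finite W" "a \<notin> W" "b \<notin> W" "a \<noteq> b"
  shows "card W * card (PM W) \<le> card (PM (insert a (insert b W)))"
proof -
  have "card ((\<lambda>(m, x). attach a b m x) ` (PM W \<times> W)) = card W * card (PM W)"
    using card_image[OF attach_inj[OF assms(2-4)]] by (simp add: card_cartesian_product)
  moreover have "card ((\<lambda>(m, x). attach a b m x) ` (PM W \<times> W)) \<le> card (PM (insert a (insert b W)))"
    by (rule card_mono) (use attach_PM[OF _ _ assms(2-4)] assms(1) in \<open>auto intro: finite_PM\<close>)
  ultimately show ?thesis by simp
qed

text \<open>Each pair of new points multiplies the number of matchings by at least the number of old
  points. This later shows that few matchings respect a long first row.\<close>

lemma card_PM_power:
  assumes "finite W" "X \<subseteq> W" "card W = card X + 2 * j" "N \<le> card X"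
  shows "N ^ j * card (PM X) \<le> card (PM W)"
  using assms
proof (induction j arbitrary: W)
  case 0
  then have "X = W" by (intro card_subset_eq) auto
  then show ?case by simp
next
  case (Suc j)
  have "card (W - X) = 2 * j + 2"
    using Suc.prems by (simp add: card_Diff_subset finite_subset)
  then obtain Z where "Z \<subseteq> W - X" "card Z = 2" by (metis le_add2 obtain_subset_with_card_n)
  then obtain a b where Z: "{a, b} \<subseteq> W - X" "a \<noteq> b" by (auto simp: card_2_iff)
  define W' where "W' = W - {a, b}"
  have W: "W = insert a (insert b W')" "a \<notin> W'" "b \<notin> W'" using Z by (auto simp: W'_def)
  have fin: "finite W'" using Suc.prems by (simp add: W'_def)
  have sub: "X \<subseteq> W'" using Z Suc.prems by (auto simp: W'_def)
  have card: "card W' = card X + 2 * j" using Suc.prems(3) W fin Z(2) by simp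
  have "N ^ Suc j * card (PM X) = N * (N ^ j * card (PM X))" by simp
  also have "\<dots> \<le> card W' * card (PM W')"
    using Suc.IH[OF fin sub card Suc.prems(4)] card Suc.prems(4) by (intro mult_le_mono) auto
  also have "\<dots> \<le> card (PM W)" using card_PM_grow[OF fin W(2,3) Z(2)] W(1) by simp
  finally show ?case .
qed

text \<open>For a perfect matching \<open>m0\<close> of V, connectedness of the union says that it
  is a single cycle through all of V.\<close>

definition Ham :: "nat set \<Rightarrow> nat set set \<Rightarrow> nat set set set" where
  "Ham V m0 = {m \<in> PM V. \<forall>v\<in>V. \<forall>w\<in>V. (v, w) \<in> (union_adj m0 m)\<^sup>*}"

lemma union_adj_sym: "(v, w) \<in> union_adj m m' \<Longrightarrow> (w, v) \<in> union_adj m m'"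
  by (auto simp: union_adj_def insert_commute)

lemma union_adj_rtrancl_sym: "(v, w) \<in> (union_adj m m')\<^sup>* \<Longrightarrow> (w, v) \<in> (union_adj m m')\<^sup>*"
  by (rule symD[OF sym_rtrancl]) (auto simp: sym_def intro: union_adj_sym)

text \<open>Splicing lengthens one cycle by two points and creates no new one: edges of
  \<open>m\<close> become paths in one direction, and contracting a and b to x undoes this in the
  other.\<close>

lemma attach_Ham_iff:
  assumes m0: "m0 \<in> PM W" and m: "m \<in> PM W" and x: "x \<in> W" and ab: "a \<notin> W" "b \<notin> W" "a \<noteq> b"
  shows "attach a b m x \<in> Ham (insert a (insert b W)) (insert {a, b} m0) \<longleftrightarrow> m \<in> Ham W m0"
proof -
  let ?m = "attach a b m x" and ?t = "transpose x b"
  let ?R = "union_adj (insert {a, b} m0) ?m" and ?S = "union_adj m0 m"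
  have in_W: "u \<in> W \<and> w \<in> W" if "{u, w} \<in> m \<or> {u, w} \<in> m0" for u w
    using that PM_subset[OF m] PM_subset[OF m0] by blast
  have moved: "{?t u, ?t w} \<in> ?m" if "{u, w} \<in> m" for u w
    using that unfolding attach_def perm_match_def by (metis image_empty image_insert imageI insertI2)
  have xab: "(x, a) \<in> ?R" "(a, b) \<in> ?R" "(b, a) \<in> ?R" "(a, x) \<in> ?R"
    by (auto simp: union_adj_def attach_def insert_commute)
  then have xb: "(x, b) \<in> ?R\<^sup>*" "(b, x) \<in> ?R\<^sup>*" by (meson r_into_rtrancl rtrancl_trans)+
  have t: "(u, ?t u) \<in> ?R\<^sup>*" "(?t u, u) \<in> ?R\<^sup>*" if "u \<in> W" for u
    using that ab xb by (auto simp: transpose_def)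
  have up: "(u, w) \<in> ?R\<^sup>*" if "(u, w) \<in> ?S\<^sup>*" for u w
    using that
  proof (induction rule: rtrancl_induct)
    case (step y z)
    have "(y, z) \<in> ?R\<^sup>*"
    proof (cases "{y, z} \<in> m")
      case True
      then have "(?t y, ?t z) \<in> ?R" using moved by (simp add: union_adj_def)
      then show ?thesis using t in_W[of y z] True by (meson r_into_rtrancl rtrancl_trans)
    next
      case False
      then show ?thesis using step(2) by (auto simp: union_adj_def)
    qed
    then show ?case using step(3) by simp
  qed simp
  \<comment> \<open>The contraction sends the path x, a, b to x, so every edge of the spliced union
    becomes a loop or an edge of the old union.\<close>
  define \<phi> where "\<phi> v = (if v \<in> {a, b} then x else v)" for v
  have down: "(\<phi> u, \<phi> w) \<in> ?S\<^sup>*" if "(u, w) \<in> ?R\<^sup>*" for u w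
    using that
  proof (induction rule: rtrancl_induct)
    case (step y z)
    have "(\<phi> y, \<phi> z) \<in> ?S\<^sup>*"
    proof -
      from step(2) consider "{y, z} = {a, b}" | "{y, z} \<in> m0" | "{y, z} = {a, x}"
        | "{y, z} \<in> perm_match ?t m" by (auto simp: union_adj_def attach_def)
      then show ?thesis
      proof cases
        case 2
        then have "\<phi> y = y" "\<phi> z = z" using in_W[of y z] ab by (auto simp: \<phi>_def)
        then show ?thesis using 2 by (auto simp: union_adj_def)
      next
        case 4
        then have "?t ` {y, z} \<in> perm_match ?t (perm_match ?t m)" by (metis imageI perm_match_def)
        then have e: "{?t y, ?t z} \<in> m" by simp
        have "?t v = \<phi> v" if "?t v \<in> W" for v
          using that ab x by (auto simp: \<phi>_def transpose_def split: if_splits)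
        then show ?thesis using e in_W[of "?t y" "?t z"] by (auto simp: union_adj_def)
      qed (auto simp: \<phi>_def doubleton_eq_iff)
    qed
    then show ?case using step(3) by simp
  qed simp
  have mP: "?m \<in> PM (insert a (insert b W))" by (rule attach_PM[OF m x ab])
  show ?thesis
  proof
    assume h: "?m \<in> Ham (insert a (insert b W)) (insert {a, b} m0)"
    have "(v, w) \<in> ?S\<^sup>*" if "v \<in> W" "w \<in> W" for v w
    proof -
      have "(v, w) \<in> ?R\<^sup>*" using h that by (auto simp: Ham_def)
      moreover have "\<phi> v = v" "\<phi> w = w" using that ab by (auto simp: \<phi>_def)
      ultimately show ?thesis using down[of v w] by simp
    qed
    then show "m \<in> Ham W m0" using m by (simp add: Ham_def)
  next
    assume h: "m \<in> Ham W m0"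
    have tox: "(v, x) \<in> ?R\<^sup>*" if "v \<in> insert a (insert b W)" for v
      using that xab xb up h x by (auto simp: Ham_def)
    have "(v, w) \<in> ?R\<^sup>*" if "v \<in> insert a (insert b W)" "w \<in> insert a (insert b W)" for v w
      using tox[OF that(1)] union_adj_rtrancl_sym[OF tox[OF that(2)]] by (rule rtrancl_trans)
    then show "?m \<in> Ham (insert a (insert b W)) (insert {a, b} m0)" using mP by (simp add: Ham_def)
  qed
qed

lemma rtrancl_closed:
  assumes "(v, w) \<in> R\<^sup>*" "v \<in> C" "\<And>y z. (y, z) \<in> R \<Longrightarrow> y \<in> C \<Longrightarrow> z \<in> C"
  shows "w \<in> C"
  using assms by (induction rule: rtrancl_induct) auto

text \<open>Fix an edge {a, b} of \<open>m0\<close>. A Hamiltonian partner on more than two points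
  cannot contain it, so it arises by \<open>attach\<close> from exactly one Hamiltonian partner on
  the remaining points and one choice of x among them.\<close>

lemma card_Ham:
  assumes "finite V" "m0 \<in> PM V" "card V = 2 * Suc q"
  shows "card (Ham V m0) = 2 ^ q * fact q"
  using assms
proof (induction q arbitrary: V m0)
  case 0
  then obtain a b where V: "V = {a, b}" "a \<noteq> b" by (auto simp: card_2_iff)
  have only: "m = {V}" if m: "m \<in> PM V" for m
  proof -
    have "e = V" if "e \<in> m" for e
      using PM_subset[OF m that] PM_card[OF m that] "0.prems" by (metis card_subset_eq mult_1_right One_nat_def)
    moreover have "m \<noteq> {}" using m V by (auto simp: PM_iff)
    ultimately show ?thesis by blast
  qed
  have "m0 \<in> Ham V m0"
    using "0.prems"(2) only[OF "0.prems"(2)] V by (auto simp: Ham_def union_adj_def)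
  moreover have "m = m0" if "m \<in> Ham V m0" for m
    using only[of m] only[OF "0.prems"(2)] that by (simp add: Ham_def)
  ultimately have "Ham V m0 = {m0}" by blast
  then show ?case by simp
next
  case (Suc q)
  obtain a where "a \<in> V" using Suc.prems(3) by fastforce
  then obtain b where ab: "a \<in> V" "b \<in> V" "a \<noteq> b" "{a, b} \<in> m0" using PM_partner[OF Suc.prems(2)] by metis
  define W where "W = V - {a, b}"
  define n0 where "n0 = m0 - {{a, b}}"
  have n0: "n0 \<in> PM W" using PM_remove[OF Suc.prems(2) ab(4)] by (simp add: n0_def W_def)
  have V: "V = insert a (insert b W)" "a \<notin> W" "b \<notin> W" "m0 = insert {a, b} n0"
    using ab by (auto simp: W_def n0_def)
  have fin: "finite W" using Suc.prems by (simp add: W_def)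
  have card: "card W = 2 * Suc q" using Suc.prems(3) V fin ab(3) by simp
  have "bij_betw (\<lambda>(m, x). attach a b m x) (Ham W n0 \<times> W) (Ham V m0)"
    unfolding bij_betw_def
  proof (intro conjI equalityI subsetI)
    show "inj_on (\<lambda>(m, x). attach a b m x) (Ham W n0 \<times> W)"
      by (rule inj_on_subset[OF attach_inj[OF V(2,3) ab(3)]]) (auto simp: Ham_def)
    fix m assume "m \<in> (\<lambda>(m, x). attach a b m x) ` (Ham W n0 \<times> W)"
    then show "m \<in> Ham V m0" using attach_Ham_iff[OF n0 _ _ V(2,3) ab(3)] V(1,4) by (auto simp: Ham_def[of W])
  next
    fix m assume m: "m \<in> Ham V m0"
    then have mP: "m \<in> PM V" by (simp add: Ham_def)
    have "{a, b} \<notin> m"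
    proof
      assume e: "{a, b} \<in> m"
      have cl: "z \<in> {a, b}" if "(y, z) \<in> union_adj m0 m" "y \<in> {a, b}" for y z
      proof -
        from that(1) have "{y, z} \<in> m0 \<or> {y, z} \<in> m" by (simp add: union_adj_def)
        then have "{y, z} = {a, b}"
          using PM_unique[OF Suc.prems(2) _ ab(4), of "{y, z}" y] PM_unique[OF mP _ e, of "{y, z}" y] that(2) by blast
        then show ?thesis by auto
      qed
      have "w \<in> {a, b}" if "w \<in> V" for w
        using rtrancl_closed[of a w "union_adj m0 m" "{a, b}"] cl m that ab(1) by (auto simp: Ham_def)
      then have "W = {}" by (auto simp: W_def)
      then show False using card by simp
    qed
    then obtain m' x where m': "m' \<in> PM W" "x \<in> W" "m = attach a b m' x"
      using attach_surj[OF mP ab(1-3)] unfolding W_def by metis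
    then have "m' \<in> Ham W n0" using attach_Ham_iff[OF n0 m'(1,2) V(2,3) ab(3)] m V(1,4) by simp
    then show "m \<in> (\<lambda>(m, x). attach a b m x) ` (Ham W n0 \<times> W)" using m' by auto
  qed
  then have "card (Ham V m0) = card (Ham W n0) * card W"
    using bij_betw_same_card card_cartesian_product by metis
  then show ?case using Suc.IH[OF fin n0 card] card by (simp add: algebra_simps)
qed

section \<open>Cycle types of refining matchings\<close>

lemma comp_refl: "v \<in> comp m m' v"
  by (simp add: comp_def)

lemma comp_eq: "w \<in> comp m m' v \<Longrightarrow> comp m m' w = comp m m' v"
  unfolding comp_def by (auto dest: union_adj_rtrancl_sym intro: rtrancl_trans)

lemma comp_step: "w \<in> comp m m' v \<Longrightarrow> (w, u) \<in> union_adj m m' \<Longrightarrow> u \<in> comp m m' v"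
  by (auto simp: comp_def)

lemma comp_subset:
  assumes "v \<in> C" "\<And>y z. (y, z) \<in> union_adj m m' \<Longrightarrow> y \<in> C \<Longrightarrow> z \<in> C"
  shows "comp m m' v \<subseteq> C"
  using rtrancl_closed[of v _ "union_adj m m'" C] assms by (auto simp: comp_def)

lemma comp_subset_PM: "m \<in> PM V \<Longrightarrow> m' \<in> PM V \<Longrightarrow> v \<in> V \<Longrightarrow> comp m m' v \<subseteq> V"
  by (rule comp_subset) (auto simp: union_adj_def dest: PM_subset)

lemma restrict_comp_PM:
  assumes "m \<in> PM V" "C \<subseteq> V" "\<And>y z. {y, z} \<in> m \<Longrightarrow> y \<in> C \<Longrightarrow> z \<in> C"
  shows "m \<inter> Pow C \<in> PM C"
proof (rule restrict_PM[OF assms(1)])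
  have "v \<in> \<Union>(m \<inter> Pow C)" if v: "v \<in> C" for v
  proof -
    obtain w where w: "{v, w} \<in> m" using PM_partner[OF assms(1), of v] assms(2) v by blast
    then have "{v, w} \<in> m \<inter> Pow C" using assms(3) v by blast
    then show ?thesis by blast
  qed
  then show "\<Union>(m \<inter> Pow C) = C" by blast
qed

lemma comp_PM:
  assumes "m \<in> PM V" "m' \<in> PM V" "v \<in> V"
  shows "m \<inter> Pow (comp m m' v) \<in> PM (comp m m' v)" "m' \<inter> Pow (comp m m' v) \<in> PM (comp m m' v)"
  by (rule restrict_comp_PM[OF assms(1) comp_subset_PM[OF assms]] restrict_comp_PM[OF assms(2) comp_subset_PM[OF assms]],
      rule comp_step, assumption, simp add: union_adj_def)+

lemma desc_list_eq:
  assumes "sorted_wrt (\<ge>) xs" shows "rev (sorted_list_of_multiset (mset xs)) = (xs :: nat list)"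
proof -
  have "sort xs = rev xs" using assms by (intro properties_for_sort) (simp_all add: sorted_wrt_rev)
  then show ?thesis by simp
qed

lemma cycle_type_eqI:
  assumes "distinct Cs" "set Cs = comp m m' ` {..<2*n}" "sorted_wrt (\<ge>) (sizes Cs)"
  shows "cycle_type n m m' = sizes Cs"
proof -
  have "image_mset (\<lambda>C. card C div 2) (mset_set (comp m m' ` {..<2*n})) = mset (sizes Cs)"
    using mset_set_set[OF assms(1)] by (simp add: assms(2) sizes_def)
  then show ?thesis unfolding cycle_type_def by (simp only: desc_list_eq[OF assms(3)])
qed

text \<open>Exhibits the cycles as a sorted block list, which makes the cycle type comparable with
  types of blocks.\<close>

lemma comps_blocks:
  assumes m: "m \<in> PM {..<2*n}" "m' \<in> PM {..<2*n}"
  obtains Cs where "blocks {..<2*n} Cs" "set Cs = comp m m' ` {..<2*n}" "sizes Cs = cycle_type n m m'"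
proof -
  let ?V = "{..<2*n}"
  obtain Ds where Ds: "set Ds = comp m m' ` ?V" "distinct Ds"
    using finite_distinct_list[of "comp m m' ` ?V"] by auto
  have C: "finite C \<and> C \<noteq> {} \<and> even (card C)" if CD: "C \<in> set Ds" for C
  proof -
    obtain v where v: "v \<in> ?V" "C = comp m m' v" using CD Ds by auto
    have f: "finite C" using comp_subset_PM[OF m v(1)] v(2) finite_subset by blast
    then show ?thesis using card_PM_edges[OF f] comp_PM(1)[OF m v(1)] v(2) comp_refl[of v m m'] by auto
  qed
  have disj: "C \<inter> D = {}" if CD: "C \<in> set Ds" "D \<in> set Ds" "C \<noteq> D" for C D
  proof (rule ccontr)
    assume "C \<inter> D \<noteq> {}"
    then obtain w where "w \<in> C" "w \<in> D" by blast
    then show False using CD Ds(1) comp_eq by (metis imageE)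
  qed
  have U: "\<Union>(set Ds) = ?V"
    unfolding Ds(1) using comp_subset_PM[OF m] comp_refl by blast
  have "blocks ?V Ds" unfolding blocks_iff using Ds(2) C disj U by blast
  then obtain Cs where Cs: "blocks ?V Cs" "set Cs = set Ds" "sorted_wrt (\<ge>) (sizes Cs)"
    by (rule sort_blocks)
  have "distinct Cs" using Cs(1) by (simp add: blocks_iff)
  moreover have set: "set Cs = comp m m' ` ?V" using Cs(2) Ds(1) by simp
  ultimately have "cycle_type n m m' = sizes Cs" using Cs(3) by (rule cycle_type_eqI)
  then show ?thesis using that[OF Cs(1) set] by simp
qed

text \<open>Induction removing the largest index of I: when I has \<open>Suc k\<close> elements this
  index is at least k, so its entry is at most \<open>la ! k\<close>.\<close>

lemma sum_sorted_le_take: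
  assumes "sorted_wrt (\<ge>) la" "I \<subseteq> {..<length la}" "card I \<le> k"
  shows "(\<Sum>i\<in>I. la ! i) \<le> (sum_list (take k la) :: nat)"
  using assms
proof (induction k arbitrary: I)
  case 0
  then show ?case using finite_subset[of I] by simp
next
  case (Suc k)
  have fin: "finite I" using Suc.prems(2) by (rule finite_subset) simp
  show ?case
  proof (cases "card I \<le> k")
    case True
    then have "(\<Sum>i\<in>I. la ! i) \<le> sum_list (take k la)" using Suc by simp
    also have "\<dots> \<le> sum_list (take (Suc k) la)" by (rule sum_take_mono) simp
    finally show ?thesis .
  next
    case False
    then have c: "card I = Suc k" using Suc.prems by simp
    then have "I \<noteq> {}" by auto
    then have MI: "Max I \<in> I" using fin by simp
    have "I \<subseteq> {..Max I}" using fin by auto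
    then have "card I \<le> Suc (Max I)" by (metis card_atMost card_mono finite_atMost)
    then have kM: "k \<le> Max I" "Max I < length la" using c MI Suc.prems(2) by auto
    then have le: "la ! Max I \<le> la ! k"
      using sorted_wrt_nth_less[OF Suc.prems(1), of k "Max I"] by (cases "k = Max I") auto
    have "(\<Sum>i\<in>I - {Max I}. la ! i) \<le> sum_list (take k la)"
      by (rule Suc.IH) (use Suc.prems c MI fin in auto)
    then have "(\<Sum>i\<in>I. la ! i) \<le> la ! k + sum_list (take k la)"
      using le sum.remove[OF fin MI, of "(!) la"] by simp
    then show ?thesis using kM by (simp add: sum_take_Suc)
  qed
qed

lemma block_closed:
  assumes bl: "blocks V Xs" and m: "m \<in> RM V Xs" and X: "X \<in> set Xs" and e: "{y, z} \<in> m" "y \<in> X"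
  shows "z \<in> X"
proof -
  obtain Y where Y: "Y \<in> set Xs" "{y, z} \<subseteq> Y" using m e by (auto simp: RM_def)
  then have "Y = X" using bl X e(2) unfolding blocks_iff by blast
  then show ?thesis using Y by simp
qed

lemma restrict_block_PM:
  assumes bl: "blocks V Xs" and m: "m \<in> RM V Xs" and X: "X \<in> set Xs"
  shows "m \<inter> Pow X \<in> PM X"
  by (rule restrict_comp_PM[of m V]) (use m bl X block_closed[OF bl m X] in \<open>auto simp: RM_def blocks_def\<close>)

lemma comp_in_block:
  assumes bl: "blocks V Xs" and m: "m \<in> RM V Xs" "m' \<in> RM V Xs" and X: "X \<in> set Xs" and v: "v \<in> X"
  shows "comp m m' v \<subseteq> X"
  by (rule comp_subset[OF v]) (use block_closed[OF bl _ X] m in \<open>auto simp: union_adj_def\<close>)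

lemma length_row_blocks: "length (row_blocks (dbl la)) = length la"
  by (simp add: row_blocks_def)

lemma card_row_blocks: "i < length la \<Longrightarrow> card (row_blocks (dbl la) ! i) = 2 * la ! i"
  using card_row[of i "dbl la"] by (simp add: row_blocks_def)

lemma first_row:
  assumes "la = p # mu"
  shows "row_blocks (dbl la) ! 0 \<in> set (row_blocks (dbl la))" "card (row_blocks (dbl la) ! 0) = 2 * p"
proof -
  have "0 < length la" using assms by simp
  then show "row_blocks (dbl la) ! 0 \<in> set (row_blocks (dbl la))" "card (row_blocks (dbl la) ! 0) = 2 * p"
    using nth_mem[of 0 "row_blocks (dbl la)"] card_row_blocks[of 0 la] assms
    unfolding length_row_blocks by simp_all
qed

text \<open>Every cycle stays inside one row. The k longest cycles thus occupy at most k rows, which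
  together are no larger than the first k. This makes the linear system triangular.\<close>

lemma cycle_type_not_above:
  assumes la: "la \<in> partitions n"
    and m: "m \<in> RM {..<2*n} (row_blocks (dbl la))" "m' \<in> RM {..<2*n} (row_blocks (dbl la))"
  shows "\<not> plt la (cycle_type n m m')"
proof (rule not_pltI)
  fix k
  let ?V = "{..<2*n}" and ?T = "row_blocks (dbl la)"
  note bl = blocks_row_blocks[OF la]
  have mP: "m \<in> PM ?V" "m' \<in> PM ?V" using m by (simp_all add: RM_def)
  obtain Cs where Cs: "blocks ?V Cs" "set Cs = comp m m' ` ?V" "sizes Cs = cycle_type n m m'"
    using comps_blocks[OF mP] .
  have len: "length ?T = length la" by (simp add: row_blocks_def)
  have "\<exists>i<length la. C \<subseteq> ?T ! i" if CC: "C \<in> set Cs" for C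
  proof -
    obtain v where v: "v \<in> ?V" "C = comp m m' v" using CC Cs by auto
    then obtain X where X: "X \<in> set ?T" "v \<in> X" using bl by (auto simp: blocks_def)
    then have "C \<subseteq> X" using comp_in_block[OF bl m] v by simp
    then show ?thesis using X(1) len by (metis in_set_conv_nth)
  qed
  then obtain r where r: "\<And>C. C \<in> set Cs \<Longrightarrow> r C < length la \<and> C \<subseteq> ?T ! r C" by metis
  define I where "I = r ` set (take k Cs)"
  have sub: "set (take k Cs) \<subseteq> set Cs" by (rule set_take_subset)
  have I: "I \<subseteq> {..<length la}" using r sub by (auto simp: I_def)
  have "card I \<le> card (set (take k Cs))" unfolding I_def by (rule card_image_le) simp
  also have "\<dots> \<le> k" using card_length[of "take k Cs"] by simp
  finally have cI: "card I \<le> k" .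
  have row: "finite (?T ! i) \<and> card (?T ! i) = 2 * la ! i" if "i < length la" for i
    using card_row[of i "dbl la"] that by (simp add: row_blocks_def)
  have "2 * sum_list (sizes (take k Cs)) = card (\<Union>(set (take k Cs)))"
    by (rule sum_list_sizes[symmetric]) (use Cs(1) sub in \<open>auto simp: blocks_def\<close>)
  also have "\<dots> \<le> card (\<Union>i\<in>I. ?T ! i)"
  proof (rule card_mono)
    have "finite I" using I by (rule finite_subset) simp
    then show "finite (\<Union>i\<in>I. ?T ! i)" using row I by (intro finite_UN_I) auto
    show "\<Union>(set (take k Cs)) \<subseteq> (\<Union>i\<in>I. ?T ! i)" unfolding I_def using r sub by blast
  qed
  also have "\<dots> \<le> (\<Sum>i\<in>I. card (?T ! i))"
    by (rule card_UN_le) (use I in \<open>auto intro: finite_subset\<close>)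
  also have "\<dots> = (\<Sum>i\<in>I. 2 * la ! i)" by (rule sum.cong) (use row I in auto)
  also have "\<dots> = 2 * (\<Sum>i\<in>I. la ! i)" by (simp add: sum_distrib_left)
  also have "\<dots> \<le> 2 * sum_list (take k la)"
    using sum_sorted_le_take[OF _ I cI] la by (simp add: partitions_def)
  finally show "sum_list (take k (cycle_type n m m')) \<le> sum_list (take k la)"
    by (simp add: sizes_def take_map flip: Cs(3))
qed

lemma pair_count_eq_0:
  assumes "la \<in> partitions n" "plt la rho" shows "pair_count n la rho = 0"
  unfolding pair_count_def
  by (intro sum.neutral ballI) (use cycle_type_not_above[OF assms(1)] assms(2) in auto)

lemma Union_RM:
  assumes bl: "blocks V Xs" and \<mu>: "\<And>X. X \<in> set Xs \<Longrightarrow> \<mu> X \<in> PM X"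
  shows "(\<Union>X\<in>set Xs. \<mu> X) \<in> RM V Xs" "\<And>X. X \<in> set Xs \<Longrightarrow> (\<Union>X\<in>set Xs. \<mu> X) \<inter> Pow X = \<mu> X"
proof -
  have sub: "e \<subseteq> X" "card e = 2" if "X \<in> set Xs" "e \<in> \<mu> X" for e X
    using PM_subset[OF \<mu>] PM_card[OF \<mu>] that by blast+
  have same: "X = Y" if "X \<in> set Xs" "Y \<in> set Xs" "v \<in> X" "v \<in> Y" for X Y v
    using bl that unfolding blocks_iff by blast
  have "(\<Union>X\<in>set Xs. \<mu> X) \<in> PM V"
    unfolding PM_iff
  proof (intro conjI ballI allI impI)
    show "\<Union>(\<Union>X\<in>set Xs. \<mu> X) = V"
    proof -
      have "\<Union>(\<mu> X) = X" if "X \<in> set Xs" for X using \<mu>[OF that] by (simp add: PM_iff)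
      then have "\<Union>(\<Union>X\<in>set Xs. \<mu> X) = \<Union>(set Xs)" by blast
      then show ?thesis using bl by (simp add: blocks_def)
    qed
    fix e assume "e \<in> (\<Union>X\<in>set Xs. \<mu> X)"
    then obtain X where X: "X \<in> set Xs" "e \<in> \<mu> X" by blast
    then show "card e = 2" by (rule sub)
    fix f v assume "f \<in> (\<Union>X\<in>set Xs. \<mu> X)" and v: "v \<in> e" "v \<in> f"
    then obtain Y where Y: "Y \<in> set Xs" "f \<in> \<mu> Y" by blast
    then have "X = Y" using same[of X Y v] sub(1) X v by blast
    then show "e = f" using PM_unique[OF \<mu>[OF X(1)] X(2), of f v] Y v by simp
  qed
  then show "(\<Union>X\<in>set Xs. \<mu> X) \<in> RM V Xs" using sub by (auto simp: RM_def)
  show "(\<Union>X\<in>set Xs. \<mu> X) \<inter> Pow X = \<mu> X" if X: "X \<in> set Xs" for X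
  proof (intro equalityI subsetI)
    fix e assume "e \<in> (\<Union>X\<in>set Xs. \<mu> X) \<inter> Pow X"
    then obtain Y where Y: "Y \<in> set Xs" "e \<in> \<mu> Y" "e \<subseteq> X" by blast
    obtain v where "v \<in> e" using sub(2)[OF Y(1,2)] by fastforce
    then have "X = Y" using same[OF X Y(1)] sub(1)[OF Y(1,2)] Y(3) by blast
    then show "e \<in> \<mu> X" using Y by simp
  qed (use sub X in blast)
qed

lemma Ham_nonempty:
  assumes "finite X" "X \<noteq> {}" "m \<in> PM X" shows "Ham X m \<noteq> {}"
proof -
  have "card X = 2 * card m" using card_PM_edges[OF assms(1,3)] .
  moreover have "card X \<noteq> 0" using assms by simp
  ultimately obtain q where "card X = 2 * Suc q" by (metis mult_0_right not0_implies_Suc)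
  from card_Ham[OF assms(1,3) this] show ?thesis by auto
qed

text \<open>A Hamiltonian choice in the first row is completed by fixed Hamiltonian choices in the others.\<close>

lemma card_same_type_ge:
  assumes la: "la \<in> partitions n" "la = p # mu" and m0: "m0 \<in> RM {..<2*n} (row_blocks (dbl la))"
  shows "2 ^ (p - 1) * fact (p - 1) \<le>
     card {m \<in> RM {..<2*n} (row_blocks (dbl la)). cycle_type n m0 m = la}"
proof -
  let ?V = "{..<2*n}" and ?T = "row_blocks (dbl la)"
  note bl = blocks_row_blocks[OF la(1)]
  define X0 where "X0 = ?T ! 0"
  have X0: "X0 \<in> set ?T" and cX0: "card X0 = 2 * p" unfolding X0_def by (rule first_row[OF la(2)])+
  have p0: "p \<noteq> 0" using la by (auto simp: partitions_def)
  have XT: "finite X" "X \<noteq> {}" if "X \<in> set ?T" for X using bl that by (auto simp: blocks_iff)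
  have "\<exists>h. h \<in> Ham X (m0 \<inter> Pow X)" if "X \<in> set ?T" for X
    using Ham_nonempty[OF XT[OF that] restrict_block_PM[OF bl m0 that]] by blast
  then obtain c where c: "\<And>X. X \<in> set ?T \<Longrightarrow> c X \<in> Ham X (m0 \<inter> Pow X)" by metis
  \<comment> \<open>Varies only the choice in the first row. Restricting to that row recovers h,
    hence injectivity.\<close>
  define J where "J h = (\<Union>X\<in>set ?T. (c(X0 := h)) X)" for h
  let ?H = "Ham X0 (m0 \<inter> Pow X0)"
  have ham: "(c(X0 := h)) X \<in> Ham X (m0 \<inter> Pow X)" if "h \<in> ?H" "X \<in> set ?T" for h X
    using c that by simp
  have pm: "(c(X0 := h)) X \<in> PM X" if "h \<in> ?H" "X \<in> set ?T" for h X
    using ham[OF that] by (simp add: Ham_def)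
  have J: "J h \<in> RM ?V ?T" "X \<in> set ?T \<Longrightarrow> J h \<inter> Pow X = (c(X0 := h)) X" if h: "h \<in> ?H" for h X
    unfolding J_def by (rule Union_RM(1)[OF bl pm[OF h]], assumption)
      (rule Union_RM(2)[OF bl pm[OF h]], assumption+)
  have "inj_on J ?H"
  proof (rule inj_onI)
    fix h h' assume "h \<in> ?H" "h' \<in> ?H" "J h = J h'"
    then have "(c(X0 := h)) X0 = (c(X0 := h')) X0" using J(2)[OF _ X0] by metis
    then show "h = h'" by simp
  qed
  have type: "cycle_type n m0 (J h) = la" if h: "h \<in> ?H" for h
  proof -
    have comp_X: "comp m0 (J h) v = X" if X: "X \<in> set ?T" "v \<in> X" for X v
    proof
      show "comp m0 (J h) v \<subseteq> X" by (rule comp_in_block[OF bl m0 J(1)[OF h] X])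
      have "union_adj (m0 \<inter> Pow X) ((c(X0 := h)) X) \<subseteq> union_adj m0 (J h)"
        using J(2)[OF h X(1)] unfolding union_adj_def by blast
      then have "(union_adj (m0 \<inter> Pow X) ((c(X0 := h)) X))\<^sup>* \<subseteq> (union_adj m0 (J h))\<^sup>*" by (rule rtrancl_mono)
      then show "X \<subseteq> comp m0 (J h) v" using ham[OF h X(1)] X(2) unfolding Ham_def comp_def by blast
    qed
    have U: "\<Union>(set ?T) = ?V" using bl by (simp add: blocks_def)
    have "comp m0 (J h) ` ?V = set ?T"
    proof (intro equalityI subsetI)
      fix C assume "C \<in> comp m0 (J h) ` ?V"
      then obtain v where "v \<in> ?V" and C: "C = comp m0 (J h) v" by blast
      then obtain X where "X \<in> set ?T" "v \<in> X" using U by blast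
      then show "C \<in> set ?T" using comp_X C by simp
    next
      fix X assume X: "X \<in> set ?T"
      then obtain v where v: "v \<in> X" using XT(2) by blast
      then have "v \<in> ?V" using X U by blast
      then show "X \<in> comp m0 (J h) ` ?V" using comp_X[OF X v] by blast
    qed
    then have "cycle_type n m0 (J h) = sizes ?T"
      using bl la(1) by (intro cycle_type_eqI) (auto simp: blocks_iff sizes_row_blocks partitions_def)
    then show ?thesis by (simp add: sizes_row_blocks)
  qed
  have "2 ^ (p - 1) * fact (p - 1) = card ?H"
    using card_Ham[OF XT(1)[OF X0] restrict_block_PM[OF bl m0 X0], of "p - 1"] cX0 p0 by simp
  also have "\<dots> = card (J ` ?H)" using card_image[OF \<open>inj_on J ?H\<close>] by simp
  also have "\<dots> \<le> card {m \<in> RM ?V ?T. cycle_type n m0 m = la}"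
  proof (rule card_mono)
    show "finite {m \<in> RM ?V ?T. cycle_type n m0 m = la}"
      by (rule finite_subset[OF _ finite_PM[of ?V]]) (auto simp: RM_def)
    show "J ` ?H \<subseteq> {m \<in> RM ?V ?T. cycle_type n m0 m = la}" using J(1) type by blast
  qed
  finally show ?thesis .
qed

text \<open>The cycle of length \<open>2 * q\<close> lies in the first row; it is determined by its edges in \<open>m0\<close>
  together with a Hamiltonian matching on their vertices.\<close>

lemma card_type_le:
  assumes la: "la \<in> partitions n" "la = p # mu" and rho: "rho = q # nu" and qp: "n < p + q" "q \<le> p"
    and m0: "m0 \<in> RM {..<2*n} (row_blocks (dbl la))"
  shows "card {m \<in> RM {..<2*n} (row_blocks (dbl la)). cycle_type n m0 m = rho} \<le>
     n ^ (p - q) * (2 ^ (q - 1) * fact (q - 1)) * 2 ^ 2 ^ (2 * (n - q))"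
proof -
  let ?V = "{..<2*n}" and ?T = "row_blocks (dbl la)"
  note bl = blocks_row_blocks[OF la(1)]
  have m0P: "m0 \<in> PM ?V" using m0 by (simp add: RM_def)
  define X0 where "X0 = ?T ! 0"
  note len = length_row_blocks[of la] and row = card_row_blocks[of _ la]
  have X0: "X0 \<in> set ?T" and cX0: "card X0 = 2 * p" unfolding X0_def by (rule first_row[OF la(2)])+
  have XT: "finite X" "X \<noteq> {}" "X \<subseteq> ?V" if "X \<in> set ?T" for X using bl that by (auto simp: blocks_iff)
  have pn: "p \<le> n" using la by (simp add: partitions_def)
  then have q0: "q \<noteq> 0" using qp by simp
  \<comment> \<open>The other rows have total half-size n - p < q, too little for the long
    cycle.\<close>
  have small: "X = X0" if X: "X \<in> set ?T" and c: "2 * q \<le> card X" for X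
  proof -
    obtain i where i: "i < length la" "X = ?T ! i" using X len by (metis in_set_conv_nth)
    have "i = 0"
    proof (rule ccontr)
      assume "i \<noteq> 0"
      then have "la ! i \<in> set mu" using i la(2) by (cases i) auto
      then have "la ! i \<le> sum_list mu" using member_le_sum_list[of "la ! i" mu] by simp
      then have "la ! i + p \<le> n" using la by (simp add: partitions_def)
      then show False using row[OF i(1)] c i(2) qp by simp
    qed
    then show ?thesis using i by (simp add: X0_def)
  qed
  let ?E = "{E. E \<subseteq> m0 \<inter> Pow X0 \<and> card E = q}"
  \<comment> \<open>Off the long cycle the matching is counted crudely as an arbitrary family of
    subsets of the remaining 2(n - q) points. For fat types this costs only a constant depending on
    t.\<close>
  let ?G = "\<lambda>E. (\<lambda>(h, r). h \<union> r) ` (Ham (\<Union>E) E \<times> Pow (Pow (?V - \<Union>E)))"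
  have PMX0: "m0 \<inter> Pow X0 \<in> PM X0" by (rule restrict_block_PM[OF bl m0 X0])
  have cm: "card (m0 \<inter> Pow X0) = p" using card_PM_edges[OF XT(1)[OF X0] PMX0] cX0 by simp
  have finm: "finite (m0 \<inter> Pow X0)" using PM_finite[OF XT(1)[OF X0] PMX0] .
  have finE: "finite ?E" 
    using finm finite_Pow_iff by (intro finite_subset[of ?E "Pow (m0 \<inter> Pow X0)"]) blast+
  \<comment> \<open>Choosing the q edges on the cycle amounts to choosing the p - q edges of the
    first row off it.\<close>
  have cE: "card ?E \<le> n ^ (p - q)"
  proof -
    have "card ?E = p choose q" using n_subsets[OF finm, of q] cm by simp
    also have "\<dots> = p choose (p - q)" using qp(2) by (rule binomial_symmetric)
    also have "\<dots> \<le> p ^ (p - q)" by (rule binomial_le_pow) simp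
    also have "\<dots> \<le> n ^ (p - q)" using pn by (rule power_mono) simp
    finally show ?thesis .
  qed
  have EV: "finite (\<Union>E)" "\<Union>E \<subseteq> ?V" "card (\<Union>E) = 2 * q" "E \<in> PM (\<Union>E)" if E: "E \<in> ?E" for E
  proof -
    show s: "\<Union>E \<subseteq> ?V" using E XT(3)[OF X0] by blast
    then show "finite (\<Union>E)" by (rule finite_subset) simp
    show "card (\<Union>E) = 2 * q" using card_Union_edges[OF _ m0P, of E] E by auto
    show "E \<in> PM (\<Union>E)" using m0P E unfolding PM_iff by blast
  qed
  have cG: "card (?G E) \<le> (2 ^ (q - 1) * fact (q - 1)) * 2 ^ 2 ^ (2 * (n - q))"
    and finG: "finite (?G E)" if E: "E \<in> ?E" for E
  proof -
    have finH: "finite (Ham (\<Union>E) E)"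
      by (rule finite_subset[OF _ finite_PM[OF EV(1)[OF E]]]) (auto simp: Ham_def)
    then show "finite (?G E)" by simp
    have "card (?G E) \<le> card (Ham (\<Union>E) E \<times> Pow (Pow (?V - \<Union>E)))"
      by (rule card_image_le) (use finH in simp)
    also have "\<dots> = card (Ham (\<Union>E) E) * 2 ^ 2 ^ card (?V - \<Union>E)"
      by (simp add: card_cartesian_product card_Pow)
    also have "card (?V - \<Union>E) = 2 * (n - q)" using EV[OF E] by (simp add: card_Diff_subset)
    also have "card (Ham (\<Union>E) E) = 2 ^ (q - 1) * fact (q - 1)"
      using card_Ham[OF EV(1)[OF E] EV(4)[OF E], of "q - 1"] EV(3)[OF E] q0 by simp
    finally show "card (?G E) \<le> (2 ^ (q - 1) * fact (q - 1)) * 2 ^ 2 ^ (2 * (n - q))" .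
  qed
  have "{m \<in> RM ?V ?T. cycle_type n m0 m = rho} \<subseteq> (\<Union>E\<in>?E. ?G E)"
  proof
    fix m assume "m \<in> {m \<in> RM ?V ?T. cycle_type n m0 m = rho}"
    then have m: "m \<in> RM ?V ?T" "cycle_type n m0 m = rho" by auto
    then have mP: "m \<in> PM ?V" by (simp add: RM_def)
    obtain Cs where Cs: "blocks ?V Cs" "set Cs = comp m0 m ` ?V" "sizes Cs = rho"
      using comps_blocks[OF m0P mP] m(2) by metis
    then obtain C Cs' where C: "Cs = C # Cs'" "card C div 2 = q" using rho by (cases Cs) (auto simp: sizes_def)
    then have cC: "card C = 2 * q" using card_block[OF Cs(1), of C] by simp
    obtain v where v: "v \<in> ?V" "C = comp m0 m v" using C Cs(2) by (metis imageE list.set_intros(1))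
    then obtain X where X: "X \<in> set ?T" "v \<in> X" using bl by (auto simp: blocks_def)
    have "C \<subseteq> X" using comp_in_block[OF bl m0 m(1) X] v by simp
    then have "2 * q \<le> card X" using card_mono[OF XT(1)[OF X(1)]] cC by metis
    then have CX: "C \<subseteq> X0" using small[OF X(1)] \<open>C \<subseteq> X\<close> by simp
    let ?e = "m0 \<inter> Pow C"
    have eC: "?e \<in> PM C" "m \<inter> Pow C \<in> PM C" using comp_PM[OF m0P mP v(1)] v(2) by auto
    have UC: "\<Union>?e = C" using eC(1) by (simp add: PM_iff)
    have finC: "finite C" using CX XT(1)[OF X0] by (rule finite_subset)
    have "card ?e = q" using card_PM_edges[OF finC eC(1)] cC by simp
    then have eE: "?e \<in> ?E" using CX by auto
    have "(u, w) \<in> (union_adj ?e (m \<inter> Pow C))\<^sup>*" if u: "u \<in> C" "w \<in> C" for u w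
    proof -
      have "(u, w) \<in> (union_adj m0 m)\<^sup>*" using comp_eq[of u m0 m v] u v(2) by (auto simp: comp_def)
      then show ?thesis
      proof (induction rule: rtrancl_induct)
        case (step y z)
        have "y \<in> C" using step(1) comp_eq[of u m0 m v] u(1) v(2) by (auto simp: comp_def)
        then have "z \<in> C" using comp_step[of y m0 m v z] step(2) v(2) by simp
        then have "(y, z) \<in> union_adj ?e (m \<inter> Pow C)"
          using step(2) \<open>y \<in> C\<close> by (auto simp: union_adj_def)
        then show ?case using step(3) by simp
      qed simp
    qed
    then have ham: "m \<inter> Pow C \<in> Ham (\<Union>?e) ?e" unfolding UC using eC(2) by (simp add: Ham_def)
    have "m - Pow C \<in> Pow (Pow (?V - \<Union>?e))"
    proof -
      have "w \<notin> C" if f: "f \<in> m" "\<not> f \<subseteq> C" "w \<in> f" for f w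
      proof
        assume w: "w \<in> C"
        obtain y where y: "f = {w, y}" using PM_edge[OF mP f(1,3)] by blast
        then have "y \<in> C" using comp_step[of w m0 m v y] w f(1) v(2) by (simp add: union_adj_def)
        then show False using f(2) y w by simp
      qed
      then show ?thesis unfolding UC using PM_subset[OF mP] by blast
    qed
    then have "m \<in> ?G ?e"
      using ham by (intro image_eqI[of _ _ "(m \<inter> Pow C, m - Pow C)"]) auto
    then show "m \<in> (\<Union>E\<in>?E. ?G E)" using eE by blast
  qed
  then have "card {m \<in> RM ?V ?T. cycle_type n m0 m = rho} \<le> card (\<Union>E\<in>?E. ?G E)"
    by (intro card_mono) (use finE finG in auto)
  also have "\<dots> \<le> (\<Sum>E\<in>?E. card (?G E))" by (rule card_UN_le[OF finE])
  also have "\<dots> \<le> card ?E * ((2 ^ (q - 1) * fact (q - 1)) * 2 ^ 2 ^ (2 * (n - q)))"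
    using sum_bounded_above[of ?E "\<lambda>E. card (?G E)"] cG by simp
  also have "\<dots> \<le> n ^ (p - q) * ((2 ^ (q - 1) * fact (q - 1)) * 2 ^ 2 ^ (2 * (n - q)))"
    using cE by (rule mult_right_mono) simp
  finally show ?thesis by (simp add: mult.assoc)
qed

text \<open>A refining matching is a matching of the first row plus a family of subsets of the rest,
  while completing the first row freely gives at least n^(n-p) times as many matchings.\<close>

lemma refining_le:
  assumes la: "la \<in> partitions n" "la = p # mu" and np: "n \<le> 2 * p"
  shows "n ^ (n - p) * card (RM {..<2*n} (row_blocks (dbl la))) \<le> 2 ^ 2 ^ (2 * (n - p)) * card (PM {..<2*n})"
proof -
  let ?V = "{..<2*n}" and ?T = "row_blocks (dbl la)"
  note bl = blocks_row_blocks[OF la(1)]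
  define X0 where "X0 = ?T ! 0"
  have X0: "X0 \<in> set ?T" and cX0: "card X0 = 2 * p" unfolding X0_def by (rule first_row[OF la(2)])+
  have sub: "X0 \<subseteq> ?V" using bl X0 by (auto simp: blocks_def)
  have fin: "finite X0" using sub by (rule finite_subset) simp
  have pn: "p \<le> n" using la by (simp add: partitions_def)
  have cR: "card (?V - X0) = 2 * (n - p)" using sub fin cX0 by (simp add: card_Diff_subset)
  let ?G = "PM X0 \<times> Pow (Pow (?V - X0))"
  have "inj_on (\<lambda>m. (m \<inter> Pow X0, m - Pow X0)) A" for A :: "nat set set set"
    by (rule inj_onI) blast
  then have "card (RM ?V ?T) = card ((\<lambda>m. (m \<inter> Pow X0, m - Pow X0)) ` RM ?V ?T)" by (simp add: card_image)
  also have "\<dots> \<le> card ?G"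
  proof (rule card_mono)
    show "finite ?G" using finite_PM[OF fin] by simp
    show "(\<lambda>m. (m \<inter> Pow X0, m - Pow X0)) ` RM ?V ?T \<subseteq> ?G"
    proof clarsimp
      fix m assume m: "m \<in> RM ?V ?T"
      have mP: "m \<in> PM ?V" using m by (simp add: RM_def)
      have "w \<notin> X0" if f: "f \<in> m" "\<not> f \<subseteq> X0" "w \<in> f" for f w
      proof
        assume w: "w \<in> X0"
        obtain y where y: "f = {w, y}" using PM_edge[OF mP f(1,3)] by blast
        then have "y \<in> X0" using block_closed[OF bl m X0, of w y] w f(1) by simp
        then show False using f(2) y w by simp
      qed
      then show "m \<inter> Pow X0 \<in> PM X0 \<and> m - Pow X0 \<subseteq> Pow (?V - X0)"
        using restrict_block_PM[OF bl m X0] PM_subset[OF mP] by blast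
    qed
  qed
  also have "card ?G = card (PM X0) * 2 ^ 2 ^ (2 * (n - p))"
    using cR by (simp add: card_cartesian_product card_Pow)
  finally have "n ^ (n - p) * card (RM ?V ?T) \<le> (n ^ (n - p) * card (PM X0)) * 2 ^ 2 ^ (2 * (n - p))"
    by (simp add: mult.assoc)
  also have "\<dots> \<le> card (PM ?V) * 2 ^ 2 ^ (2 * (n - p))"
  proof (rule mult_right_mono)
    have "card ?V = card X0 + 2 * (n - p)" using cX0 pn by simp
    then show "n ^ (n - p) * card (PM X0) \<le> card (PM ?V)"
      by (intro card_PM_power[OF _ sub]) (use cX0 np in simp_all)
  qed simp
  finally show ?thesis by (simp add: mult.commute)
qed

section \<open>Solving the system\<close>

lemma exists_plt_max:
  assumes "finite S" "S \<noteq> {}" and "\<And>a b. a \<in> S \<Longrightarrow> b \<in> S \<Longrightarrow> a = b \<or> plt a b \<or> plt b a"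
  shows "\<exists>a\<in>S. \<forall>b\<in>S. b \<noteq> a \<longrightarrow> plt b a"
  using assms
proof (induction S rule: finite_ne_induct)
  case (insert x S)
  then obtain a where a: "a \<in> S" "\<And>b. b \<in> S \<Longrightarrow> b \<noteq> a \<Longrightarrow> plt b a" by blast
  consider "plt x a" | "plt a x" using insert.prems[of x a] a(1) insert.hyps by auto
  then show ?case
  proof cases
    case 1
    then show ?thesis using a by blast
  next
    case 2
    then show ?thesis using a plt_trans by (metis insert_iff)
  qed
qed simp

section \<open>The decreasing list of fat partitions\<close>

lemma ex_decreasing_list:
  assumes "finite S" and "\<And>a b. a \<in> S \<Longrightarrow> b \<in> S \<Longrightarrow> a = b \<or> plt a b \<or> plt b a"
  shows "\<exists>L. sorted_wrt (\<lambda>a b. plt b a) L \<and> set L = S"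
  using assms
proof (induction "card S" arbitrary: S rule: less_induct)
  case less
  show ?case
  proof (cases "S = {}")
    case False
    then obtain a where a: "a \<in> S" "\<And>b. b \<in> S \<Longrightarrow> b \<noteq> a \<Longrightarrow> plt b a"
      using exists_plt_max[OF less.prems(1)] less.prems(2) by blast
    have "card (S - {a}) < card S" using a(1) less.prems(1) by (rule card_Diff1_less[rotated])
    then obtain L where L: "sorted_wrt (\<lambda>a b. plt b a) L" "set L = S - {a}"
      using less.hyps[of "S - {a}"] less.prems by auto
    then have "sorted_wrt (\<lambda>a b. plt b a) (a # L) \<and> set (a # L) = S" using a by auto
    then show ?thesis by blast
  qed auto
qed

lemma decreasing_list_unique:
  assumes "sorted_wrt (\<lambda>a b. plt b a) L" "sorted_wrt (\<lambda>a b. plt b a) L'" "set L = set L'"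
  shows "L = L'"
  using assms
proof (induction L arbitrary: L')
  case (Cons a l)
  then obtain b l' where L': "L' = b # l'" by (cases L') auto
  have ab: "a = b"
  proof (rule ccontr)
    assume "a \<noteq> b"
    then have "a \<in> set l'" "b \<in> set l" using Cons.prems(3) L' by auto
    then have "plt a b" "plt b a" using Cons.prems(1,2) L' by auto
    then show False using plt_trans plt_irrefl by blast
  qed
  have "a \<notin> set l" "a \<notin> set l'" using Cons.prems(1,2) L' ab plt_irrefl by auto
  then have "set l = set l'" using Cons.prems(3) L' ab by auto
  then show ?case using Cons L' ab by simp
qed simp

lemma fat_list:
  shows "sorted_wrt (\<lambda>a b. plt b a) (fat_list n t)"
    and "set (fat_list n t) = {la \<in> partitions n. plt (hook n t) la}"
proof -
  let ?S = "{la \<in> partitions n. plt (hook n t) la}"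
  have fin: "finite ?S" using finite_partitions[of n] by simp
  have "\<exists>L. sorted_wrt (\<lambda>a b. plt b a) L \<and> set L = ?S"
  proof (rule ex_decreasing_list[OF fin])
    show "a = b \<or> plt a b \<or> plt b a" if "a \<in> ?S" "b \<in> ?S" for a b
      using that by (intro plt_total) (auto simp: partitions_def)
  qed
  then have "\<exists>!L. sorted_wrt (\<lambda>a b. plt b a) L \<and> set L = ?S" using decreasing_list_unique by (metis (no_types, lifting))
  from theI'[OF this, folded fat_list_def]
  show "sorted_wrt (\<lambda>a b. plt b a) (fat_list n t)" "set (fat_list n t) = ?S" by auto
qed

lemma decreasing_distinct: "sorted_wrt (\<lambda>a b. plt b a) L \<Longrightarrow> distinct L"
  by (induction L) auto

text \<open>The largest element a of S has coefficient 0 in every equation but its own. So the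
  system on the other elements is solved first, and the equation of a then determines its
  unknown.\<close>

lemma triangular_system:
  fixes K :: "nat list \<Rightarrow> nat list \<Rightarrow> real"
  assumes "finite S" and "\<And>a b. a \<in> S \<Longrightarrow> b \<in> S \<Longrightarrow> a = b \<or> plt a b \<or> plt b a"
    and "\<And>a b. a \<in> S \<Longrightarrow> b \<in> S \<Longrightarrow> plt a b \<Longrightarrow> K a b = 0"
    and "\<And>a. a \<in> S \<Longrightarrow> K a a > 0"
    and "\<And>a b. a \<in> S \<Longrightarrow> b \<in> S \<Longrightarrow> plt b a \<Longrightarrow> \<bar>K a b\<bar> \<le> M * K a a"
    and "\<And>a. a \<in> S \<Longrightarrow> \<bar>r a\<bar> \<le> e * K a a"
    and "M \<ge> 0" "e \<ge> 0"
  shows "\<exists>X. (\<forall>a\<in>S. (\<Sum>b\<in>S. X b * K a b) = r a) \<and> (\<Sum>b\<in>S. \<bar>X b\<bar>) \<le> e * card S * (1 + M) ^ card S"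
  using assms
proof (induction "card S" arbitrary: S rule: less_induct)
  case less
  note fin = less.prems(1)
  show ?case
  proof (cases "S = {}")
    case False
    then obtain a where a: "a \<in> S" "\<And>b. b \<in> S \<Longrightarrow> b \<noteq> a \<Longrightarrow> plt b a"
      using exists_plt_max[OF fin] less.prems(2) by blast
    define S' where "S' = S - {a}"
    have fin': "finite S'" using fin by (simp add: S'_def)
    have lt: "card S' < card S" unfolding S'_def using a(1) fin by (rule card_Diff1_less[rotated])
    have cS: "card S = Suc (card S')" using card_Suc_Diff1[OF fin a(1)] by (simp add: S'_def)
    have sub: "b \<in> S" if "b \<in> S'" for b using that by (simp add: S'_def)
    have "\<exists>X. (\<forall>c\<in>S'. (\<Sum>b\<in>S'. X b * K c b) = r c) \<and>
        (\<Sum>b\<in>S'. \<bar>X b\<bar>) \<le> e * card S' * (1 + M) ^ card S'"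
    proof (rule less.hyps[OF lt fin'])
      show "c = b \<or> plt c b \<or> plt b c" if "c \<in> S'" "b \<in> S'" for c b
        by (rule less.prems(2)[OF sub[OF that(1)] sub[OF that(2)]])
      show "K c b = 0" if "c \<in> S'" "b \<in> S'" "plt c b" for c b
        by (rule less.prems(3)[OF sub[OF that(1)] sub[OF that(2)] that(3)])
      show "\<bar>K c b\<bar> \<le> M * K c c" if "c \<in> S'" "b \<in> S'" "plt b c" for c b
        by (rule less.prems(5)[OF sub[OF that(1)] sub[OF that(2)] that(3)])
      show "K c c > 0" "\<bar>r c\<bar> \<le> e * K c c" if "c \<in> S'" for c
        using less.prems(4,6) sub[OF that] by blast+
    qed (rule less.prems(7,8))+
    then obtain X where X: "\<And>c. c \<in> S' \<Longrightarrow> (\<Sum>b\<in>S'. X b * K c b) = r c"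
      "(\<Sum>b\<in>S'. \<bar>X b\<bar>) \<le> e * card S' * (1 + M) ^ card S'" by blast
    have Kaa: "K a a > 0" using less.prems(4) a(1) .
    define y where "y = (r a - (\<Sum>b\<in>S'. X b * K a b)) / K a a"
    define Z where "Z = X(a := y)"
    have split: "(\<Sum>b\<in>S. f b) = f a + (\<Sum>b\<in>S'. f b)" for f :: "nat list \<Rightarrow> real"
      using sum.remove[OF fin a(1)] by (simp add: S'_def)
    have ZX: "Z b = X b" if "b \<in> S'" for b using that by (auto simp: Z_def S'_def)
    have Z: "(\<Sum>b\<in>S. Z b * K c b) = y * K c a + (\<Sum>b\<in>S'. X b * K c b)" for c
      unfolding split using ZX by (simp add: Z_def cong: sum.cong)
    have "(\<Sum>b\<in>S. Z b * K c b) = r c" if c: "c \<in> S" for c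
    proof (cases "c = a")
      case True
      then show ?thesis unfolding Z using Kaa by (simp add: y_def)
    next
      case False
      then have "K c a = 0" using less.prems(3)[OF c a(1) a(2)[OF c False]] by simp
      then show ?thesis unfolding Z using X(1)[of c] c False by (simp add: S'_def)
    qed
    moreover have "(\<Sum>b\<in>S. \<bar>Z b\<bar>) \<le> e * card S * (1 + M) ^ card S"
    proof -
      let ?s = "\<Sum>b\<in>S'. \<bar>X b\<bar>"
      have "\<bar>\<Sum>b\<in>S'. X b * K a b\<bar> \<le> (\<Sum>b\<in>S'. \<bar>X b * K a b\<bar>)" by (rule sum_abs)
      also have "\<dots> \<le> (\<Sum>b\<in>S'. \<bar>X b\<bar> * (M * K a a))"
      proof (rule sum_mono)
        fix b assume "b \<in> S'"
        then have "\<bar>K a b\<bar> \<le> M * K a a" using less.prems(5)[OF a(1), of b] a(2) by (simp add: S'_def)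
        then show "\<bar>X b * K a b\<bar> \<le> \<bar>X b\<bar> * (M * K a a)" unfolding abs_mult by (rule mult_left_mono) simp
      qed
      also have "\<dots> = ?s * (M * K a a)" by (rule sum_distrib_right[symmetric])
      finally have "\<bar>r a - (\<Sum>b\<in>S'. X b * K a b)\<bar> \<le> (e + ?s * M) * K a a"
        using less.prems(6)[OF a(1)] by (simp add: algebra_simps)
      then have y: "\<bar>y\<bar> \<le> e + ?s * M" using Kaa by (simp add: y_def divide_le_eq)
      \<comment> \<open>The sums of absolute values obey s(k+1) <= e + (1 + M) s(k), which gives the
        bound e k (1 + M)^k.\<close>
      have "(\<Sum>b\<in>S. \<bar>Z b\<bar>) = \<bar>y\<bar> + ?s"
        unfolding split using ZX by (simp add: Z_def cong: sum.cong)
      also have "\<dots> \<le> e + ?s * (1 + M)" using y by (simp add: algebra_simps)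
      also have "\<dots> \<le> e * (1 + M) ^ card S + (e * card S' * (1 + M) ^ card S') * (1 + M)"
      proof (rule add_mono)
        have "1 \<le> (1 + M) ^ card S" using less.prems(7) by (intro one_le_power) simp
        then show "e \<le> e * (1 + M) ^ card S" using less.prems(8) mult_left_mono[of 1 "(1 + M) ^ card S" e] by simp
        show "?s * (1 + M) \<le> (e * card S' * (1 + M) ^ card S') * (1 + M)"
          using X(2) less.prems(7) by (intro mult_right_mono) auto
      qed
      also have "\<dots> = e * card S * (1 + M) ^ card S" by (simp add: cS algebra_simps)
      finally show ?thesis .
    qed
    ultimately show ?thesis by blast
  qed auto
qed

section \<open>Size of the coefficients and of the right-hand sides\<close>

abbreviation ham :: "nat \<Rightarrow> nat" where
  "ham p \<equiv> 2 ^ (p - 1) * fact (p - 1)"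

lemma ham_Suc: "p > 0 \<Longrightarrow> ham (Suc p) = 2 * p * ham p"
  by (cases p) (simp_all add: algebra_simps)

text \<open>\<open>ham p\<close> is (2p-2)!!, and passing from q to p adds p - q factors, each at
  least 2q and so at least n. They absorb the choice of edges in
  \<open>card_type_le\<close>.\<close>

lemma ham_ge:
  assumes "q \<le> p" "0 < q" "n \<le> 2 * q" shows "n ^ (p - q) * ham q \<le> ham p"
  using assms(1)
proof (induction p rule: dec_induct)
  case (step p)
  have "n ^ (Suc p - q) * ham q = n * (n ^ (p - q) * ham q)" using step by (simp add: Suc_diff_le)
  also have "\<dots> \<le> (2 * p) * ham p" by (rule mult_le_mono) (use step assms in auto)
  finally show ?case using ham_Suc[of p] step assms by simp
qed simp

text \<open>The converse comparison: each of the n - p added factors is at most 2N. It converts the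
  diagonal bound with \<open>ham p\<close> into the common scale (2n-2)!!.\<close>

lemma ham_le:
  assumes "p \<le> n" "0 < p" "n \<le> N" shows "ham n \<le> (2 * N) ^ (n - p) * ham p"
  using assms(1,3)
proof (induction n rule: dec_induct)
  case (step n)
  have "ham (Suc n) = 2 * n * ham n" using ham_Suc[of n] step assms by simp
  also have "\<dots> \<le> (2 * N) * ((2 * N) ^ (n - p) * ham p)" by (rule mult_le_mono) (use step in auto)
  also have "\<dots> = (2 * N) ^ (Suc n - p) * ham p" using step by (simp add: Suc_diff_le)
  finally show ?case .
qed simp

text \<open>All t factors are at least n + 1, because k < t < n/2. The surplus of (n+1)^t over n^t
  pays for the 1 subtracted in the denominator; for this t must be positive.\<close>

lemma zeta_bound:
  assumes "0 < t" "2 * t < n" shows "\<bar>zeta n t\<bar> \<le> 1 / real n ^ t"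
proof -
  let ?p = "\<Prod>k<t. real (2*n - 1 - 2*k)"
  have "(\<Prod>k<t. real n + 1) \<le> ?p"
  proof (rule prod_mono)
    fix k assume "k \<in> {..<t}"
    then have "n + 1 \<le> 2*n - 1 - 2*k" using assms by simp
    then have "real (n + 1) \<le> real (2*n - 1 - 2*k)" by (simp only: of_nat_le_iff)
    then show "0 \<le> real n + 1 \<and> real n + 1 \<le> real (2*n - 1 - 2*k)" by simp
  qed
  moreover have "real n ^ t + 1 \<le> (real n + 1) ^ t"
  proof -
    have "n ^ t < (n + 1) ^ t" using assms by (intro power_strict_mono) auto
    then have "n ^ t + 1 \<le> (n + 1) ^ t" by simp
    then have "real (n ^ t + 1) \<le> real ((n + 1) ^ t)" by (simp only: of_nat_le_iff)
    then show ?thesis by (simp add: add.commute)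
  qed
  ultimately have "real n ^ t \<le> ?p - 1" by simp
  moreover have "0 < real n ^ t" using assms by simp
  ultimately show ?thesis by (simp add: zeta_def frac_le)
qed

lemma pair_count_card:
  "pair_count n la rho = (\<Sum>m\<in>RM {..<2*n} (row_blocks (dbl la)).
     real (card {m' \<in> RM {..<2*n} (row_blocks (dbl la)). cycle_type n m m' = rho}))"
proof -
  have "finite (RM {..<2*n} (row_blocks (dbl la)))"
    by (rule finite_subset[OF _ finite_PM[of "{..<2*n}"]]) (auto simp: RM_def)
  then show ?thesis unfolding pair_count_def
    by (intro sum.cong refl) (simp add: of_bool_def sum.If_cases Int_def)
qed

lemma fat_Cons:
  assumes "la \<in> partitions n" "plt (hook n t) la"
  obtains p mu where "la = p # mu" "n - t \<le> p" "p \<le> n" "sum_list mu = n - p"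
proof -
  obtain p mu where la: "la = p # mu" using assms(2) by (cases la) auto
  then have "n - t \<le> p" using assms(2) by (auto simp: hook_def plt_Cons)
  moreover have "p \<le> n" "sum_list mu = n - p" using assms(1) la by (auto simp: partitions_def)
  ultimately show ?thesis using that la by blast
qed

text \<open>A fat partition of n is determined by its tail, which has sum at most t. This bounds the
  number of unknowns independently of n.\<close>

lemma card_fat_le:
  assumes "2 * t < n"
  shows "card {la \<in> partitions n. plt (hook n t) la} \<le> card {xs. set xs \<subseteq> {..t} \<and> length xs \<le> t}"
proof (rule card_inj_on_le[of tl])
  show "finite {xs. set xs \<subseteq> {..t} \<and> length xs \<le> t}" by (rule finite_lists_length_le) simp
  show "tl ` {la \<in> partitions n. plt (hook n t) la} \<subseteq> {xs. set xs \<subseteq> {..t} \<and> length xs \<le> t}"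
  proof clarify
    fix la assume la: "la \<in> partitions n" "plt (hook n t) la"
    then obtain p mu where mu: "la = p # mu" "n - t \<le> p" "sum_list mu = n - p" by (rule fat_Cons)
    then have s: "sum_list mu \<le> t" by simp
    have "0 \<notin> set mu" using la(1) mu by (simp add: partitions_def)
    then have "length mu \<le> t" using length_le_sum_list[of mu] s by simp
    moreover have "x \<le> t" if "x \<in> set mu" for x using member_le_sum_list[OF that] s by simp
    ultimately show "set (tl la) \<subseteq> {..t} \<and> length (tl la) \<le> t" using mu by auto
  qed
  show "inj_on tl {la \<in> partitions n. plt (hook n t) la}"
  proof (rule inj_onI)
    fix la la' assume a: "la \<in> {la \<in> partitions n. plt (hook n t) la}" "la' \<in> {la \<in> partitions n. plt (hook n t) la}"
      "tl la = tl la'"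
    from a(1) obtain p mu where p: "la = p # mu" by (auto elim: fat_Cons)
    from a(2) obtain p' mu' where p': "la' = p' # mu'" by (auto elim: fat_Cons)
    have "sum_list la = sum_list la'" using a by (simp add: partitions_def)
    then show "la = la'" using a(3) p p' by simp
  qed
qed

text \<open>The positive sum in \<open>sum_young_dominoes\<close> cannot range over the empty
  set.\<close>

lemma refining_pos: "la \<in> partitions n \<Longrightarrow> refining n la > 0"
proof -
  assume la: "la \<in> partitions n"
  let ?R = "RM {..<2*n} (row_blocks (dbl la))"
  have "?R \<noteq> {}" using sum_young_dominoes[OF la] by auto
  moreover have "finite ?R" by (rule finite_subset[OF _ finite_PM[of "{..<2*n}"]]) (auto simp: RM_def)
  ultimately show ?thesis by (simp add: refining_def card_gt_0_iff)
qed

text \<open>\<open>triangular_system\<close> with M = C, the cost of the freedom off the long cycle,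
  and e = 3 C 2^t / (2n-2)!!. Here 3 collects the contributions of zeta and 1 - zeta, and 2^t comes
  from comparing (2n)^(n-p) with n^(n-p).\<close>

lemma fat_solution:
  assumes t: "0 < t" "2 * t < n"
  defines "S \<equiv> {la \<in> partitions n. plt (hook n t) la}" and "C \<equiv> 2 ^ 2 ^ (2 * t)"
  shows "\<exists>X. (\<forall>la\<in>S. (\<Sum>rho\<in>S. X rho * pair_count n la rho) =
        zeta n t * refining n la + (1 - zeta n t) * (refining n la)\<^sup>2 / real (card (PM {..<2*n}))) \<and>
      (\<Sum>rho\<in>S. \<bar>X rho\<bar>) \<le> 3 * C * 2 ^ t / dfact_even (n - 1) * card S * (1 + C) ^ card S"
proof (rule triangular_system)
  let ?R = "\<lambda>la. RM {..<2*n} (row_blocks (dbl la))"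
  let ?D = "dfact_even (n - 1)" and ?N = "real (card (PM {..<2*n}))" and ?z = "zeta n t"
  have C1: "1 \<le> C" by (simp add: C_def)
  have D: "?D = real (ham n)" "?D > 0" by (simp_all add: dfact_even_def)
  have Cmono: "(2 ^ 2 ^ (2 * (n - q)) :: real) \<le> C" if "n - t \<le> q" for q
    unfolding C_def by (intro power_increasing) (use that in auto)
  have N: "?N > 0" using dominoes_PM finite_PM[of "{..<2*n}"] by (auto simp: card_gt_0_iff)
  have n0: "real n > 0" using t by simp
  have diag: "refining n la * real (ham p) \<le> pair_count n la la" if la: "la \<in> S" "la = p # mu" for la p mu
  proof -
    have "(\<Sum>m\<in>?R la. real (ham p)) \<le> pair_count n la la"
      unfolding pair_count_card using la by (intro sum_mono of_nat_mono card_same_type_ge) (auto simp: S_def)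
    then show ?thesis by (simp add: refining_def)
  qed
  show "finite S" using finite_partitions[of n] by (simp add: S_def)
  show "a = b \<or> plt a b \<or> plt b a" if "a \<in> S" "b \<in> S" for a b
    using that by (intro plt_total) (auto simp: S_def partitions_def)
  show "pair_count n a b = 0" if "a \<in> S" "b \<in> S" "plt a b" for a b
    using that pair_count_eq_0 by (simp add: S_def)
  show "pair_count n a a > 0" if a: "a \<in> S" for a
  proof -
    obtain p mu where "a = p # mu" using a by (auto simp: S_def elim: fat_Cons)
    then have "refining n a * real (ham p) \<le> pair_count n a a" by (rule diag[OF a])
    moreover have "refining n a * real (ham p) > 0" using refining_pos[of a n] a by (simp add: S_def)
    ultimately show ?thesis by linarith
  qed
  show "\<bar>pair_count n a b\<bar> \<le> C * pair_count n a a" if ab: "a \<in> S" "b \<in> S" "plt b a" for a b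
  proof -
    obtain p mu where a: "a = p # mu" "n - t \<le> p" "p \<le> n" using ab(1) by (auto simp: S_def elim: fat_Cons)
    obtain q nu where b: "b = q # nu" "n - t \<le> q" "q \<le> n" using ab(2) by (auto simp: S_def elim: fat_Cons)
    have qp: "q \<le> p" using ab(3) a b by (auto simp: plt_Cons)
    have "card {m' \<in> ?R a. cycle_type n m m' = b} \<le> ham p * 2 ^ 2 ^ (2 * (n - q))" if m: "m \<in> ?R a" for m
    proof -
      have "card {m' \<in> ?R a. cycle_type n m m' = b} \<le> n ^ (p - q) * ham q * 2 ^ 2 ^ (2 * (n - q))"
        using card_type_le[OF _ a(1) b(1) _ qp m] ab(1) a b t by (auto simp: S_def)
      also have "\<dots> \<le> ham p * 2 ^ 2 ^ (2 * (n - q))"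
        using ham_ge[OF qp, of n] b t by (intro mult_right_mono) auto
      finally show ?thesis .
    qed
    then have "real (card {m' \<in> ?R a. cycle_type n m m' = b}) \<le> real (ham p) * C" if "m \<in> ?R a" for m
    proof -
      have "real (card {m' \<in> ?R a. cycle_type n m m' = b}) \<le> real (ham p * 2 ^ 2 ^ (2 * (n - q)))"
        using \<open>\<And>m. m \<in> ?R a \<Longrightarrow> card {m' \<in> ?R a. cycle_type n m m' = b} \<le> ham p * 2 ^ 2 ^ (2 * (n - q))\<close>[OF that]
        by (simp only: of_nat_le_iff)
      also have "\<dots> = real (ham p) * 2 ^ 2 ^ (2 * (n - q))" by simp
      also have "\<dots> \<le> real (ham p) * C" using Cmono[OF b(2)] by (intro mult_left_mono) simp_all
      finally show ?thesis .
    qed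
    then have "pair_count n a b \<le> (\<Sum>m\<in>?R a. real (ham p) * C)"
      unfolding pair_count_card by (rule sum_mono)
    also have "\<dots> = C * (refining n a * real (ham p))" by (simp add: refining_def)
    also have "\<dots> \<le> C * pair_count n a a" using diag[OF ab(1) a(1)] C1 by (intro mult_left_mono) auto
    finally have "pair_count n a b \<le> C * pair_count n a a" .
    moreover have "pair_count n a b \<ge> 0" unfolding pair_count_card by (rule sum_nonneg) simp
    ultimately show ?thesis by simp
  qed
  show "\<bar>?z * refining n a + (1 - ?z) * (refining n a)\<^sup>2 / ?N\<bar> \<le> 3 * C * 2 ^ t / ?D * pair_count n a a"
    if a: "a \<in> S" for a
  proof -
    obtain p mu where p: "a = p # mu" "n - t \<le> p" "p \<le> n" using a by (auto simp: S_def elim: fat_Cons)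
    have aP: "a \<in> partitions n" using a by (simp add: S_def)
    let ?r = "refining n a" and ?k = "n - p"
    have r0: "?r > 0" using refining_pos[OF aP] .
    have kt: "?k \<le> t" using p by simp
    \<comment> \<open>Fatness gives n - p <= t, so the bound on zeta is at least as strong as the
      rate n^(-(n-p)) required in this equation.\<close>
    have nk: "1 / real n ^ t \<le> 1 / real n ^ ?k"
      using kt n0 t by (intro frac_le power_increasing) auto
    have z: "\<bar>?z\<bar> \<le> 1 / real n ^ ?k" using zeta_bound[OF t] nk by linarith
    have "1 / real n ^ t \<le> 1" using t by (simp add: divide_le_eq)
    then have z1: "\<bar>1 - ?z\<bar> \<le> 2" using zeta_bound[OF t] by linarith
    have "real (n ^ ?k * card (?R a)) \<le> real (2 ^ 2 ^ (2 * ?k) * card (PM {..<2*n}))"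
      using refining_le[OF aP p(1)] p t by (simp only: of_nat_le_iff)
    then have "real n ^ ?k * ?r \<le> 2 ^ 2 ^ (2 * ?k) * ?N" by (simp add: refining_def)
    also have "\<dots> \<le> C * ?N" using Cmono[OF p(2)] N by (intro mult_right_mono) auto
    finally have rN: "?r / ?N \<le> C / real n ^ ?k" using N n0 by (simp add: field_simps)
    have "\<bar>?z * ?r + (1 - ?z) * ?r\<^sup>2 / ?N\<bar> \<le> ?r * (\<bar>?z\<bar> + \<bar>1 - ?z\<bar> * (?r / ?N))"
    proof -
      have "?z * ?r + (1 - ?z) * ?r\<^sup>2 / ?N = ?r * (?z + (1 - ?z) * (?r / ?N))"
        by (simp add: power2_eq_square algebra_simps)
      moreover have "\<bar>?z + (1 - ?z) * (?r / ?N)\<bar> \<le> \<bar>?z\<bar> + \<bar>1 - ?z\<bar> * (?r / ?N)"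
        using abs_triangle_ineq[of ?z "(1 - ?z) * (?r / ?N)"] r0 N by (simp add: abs_mult)
      ultimately show ?thesis using r0 by (simp add: abs_mult)
    qed
    \<comment> \<open>Both terms are of order n^(-(n-p)): zeta by \<open>z\<close>, the projection
      term by \<open>rN\<close> with the factor 2 from \<open>z1\<close>.\<close>
    also have "\<dots> \<le> ?r * (C / real n ^ ?k + 2 * (C / real n ^ ?k))"
    proof (intro mult_left_mono add_mono mult_mono)
      have "1 / real n ^ ?k \<le> C / real n ^ ?k" using C1 n0 by (intro divide_right_mono) auto
      then show "\<bar>?z\<bar> \<le> C / real n ^ ?k" using z by linarith
    qed (use z1 rN r0 N in auto)
    also have "\<dots> = 3 * C * ?r / real n ^ ?k" by simp
    also have "\<dots> \<le> 3 * C * 2 ^ t / ?D * (?r * real (ham p))"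
    proof -
      have "?D \<le> real ((2 * n) ^ ?k * ham p)"
        unfolding D(1) using ham_le[OF p(3), of n] p t by (simp only: of_nat_le_iff)
      also have "\<dots> = 2 ^ ?k * (real n ^ ?k * real (ham p))" by (simp add: power_mult_distrib)
      also have "\<dots> \<le> 2 ^ t * (real n ^ ?k * real (ham p))"
        using kt n0 by (intro mult_right_mono power_increasing) auto
      finally have "1 / real n ^ ?k \<le> 2 ^ t / ?D * real (ham p)"
        using D(2) n0 by (simp add: field_simps)
      then have "3 * C * ?r * (1 / real n ^ ?k) \<le> 3 * C * ?r * (2 ^ t / ?D * real (ham p))"
        using r0 C1 by (intro mult_left_mono) auto
      then show ?thesis by (simp add: mult_ac)
    qed
    also have "\<dots> \<le> 3 * C * 2 ^ t / ?D * pair_count n a a"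
      using diag[OF a p(1)] C1 D(2) by (intro mult_left_mono) auto
    finally show ?thesis .
  qed
  show "0 \<le> C" "0 \<le> 3 * C * 2 ^ t / ?D" using C1 D(2) by auto
qed

theorem mainTheorem4:
  "\<forall>t::nat. \<exists>B>0. \<forall>n::nat. 2 * t < n \<longrightarrow>
     (let L = fat_list n t; F = length L in
      \<exists>x :: nat \<Rightarrow> real.
        (\<forall>j\<in>{1..F}. \<bar>x j\<bar> \<le> B / dfact_even (n - 1)) \<and>
        (\<forall>i\<in>{1..F}. (\<Sum>j=1..F. x j * P n (L ! (i - 1)) (L ! (j - 1))) =
                       (if i = 1 then 1 else zeta n t)))"
proof (intro allI)
  fix t :: nat
  define C :: real where "C = 2 ^ 2 ^ (2 * t)"
  define W where "W = card {xs. set xs \<subseteq> {..t} \<and> length xs \<le> t}"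
  \<comment> \<open>W bounds the number of fat partitions uniformly in n; the summand 1 makes B
    visibly positive.\<close>
  define B where "B = 3 * C * 2 ^ t * W * (1 + C) ^ W + 1"
  have C1: "1 \<le> C" by (simp add: C_def)
  then have B0: "B > 0" by (simp add: B_def add_nonneg_pos)
  have "\<exists>x. (\<forall>j\<in>{1..length (fat_list n t)}. \<bar>x j\<bar> \<le> B / dfact_even (n - 1)) \<and>
        (\<forall>i\<in>{1..length (fat_list n t)}.
           (\<Sum>j=1..length (fat_list n t). x j * P n (fat_list n t ! (i - 1)) (fat_list n t ! (j - 1))) =
           (if i = 1 then 1 else zeta n t))" if n: "2 * t < n" for n
  proof -
    define L where "L = fat_list n t"
    define S where "S = {la \<in> partitions n. plt (hook n t) la}"
    have L: "sorted_wrt (\<lambda>a b. plt b a) L" "set L = S" using fat_list by (simp_all add: L_def S_def)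
    have D: "dfact_even (n - 1) > 0" by (simp add: dfact_even_def)
    show ?thesis
    \<comment> \<open>For t = 0 the hook is \<open>[n]\<close> itself, the largest partition, so the
      list is empty. The denominator of zeta is 0 here, and \<open>fat_solution\<close> requires t >
      0.\<close>
    proof (cases "t = 0")
      case True
      have "S = {}"
      proof (rule ccontr)
        assume "S \<noteq> {}"
        then obtain la where la: "la \<in> partitions n" "plt [n] la" using True by (auto simp: S_def hook_def)
        then have "la \<noteq> [n]" by auto
        then have "plt la [n]" using plt_singleton la(1) n by simp
        then show False using la(2) plt_trans plt_irrefl by blast
      qed
      then have "L = []" using L(2) by simp
      then show ?thesis by (simp flip: L_def)
    next
      case False
      then have t0: "0 < t" by simp
      obtain X where X: "\<forall>la\<in>S. (\<Sum>rho\<in>S. X rho * pair_count n la rho) =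
          zeta n t * refining n la + (1 - zeta n t) * (refining n la)\<^sup>2 / real (card (PM {..<2*n}))"
        "(\<Sum>rho\<in>S. \<bar>X rho\<bar>) \<le> 3 * C * 2 ^ t / dfact_even (n - 1) * card S * (1 + C) ^ card S"
        using fat_solution[OF t0 n] unfolding S_def C_def by blast
      have finS: "finite S" using finite_partitions[of n] by (simp add: S_def)
      have eig: "(\<Sum>rho\<in>S. X rho * P n la rho) = (if la = [n] then 1 else zeta n t)" if "la \<in> S" for la
        by (rule eigenvalues_from_pair_counts[OF _ S_def _ that]) (use X(1) n in auto)
      have dist: "distinct L" using L(1) by (rule decreasing_distinct)
      have nS: "[n] \<in> S" using t0 n by (auto simp: S_def partitions_def hook_def plt_Cons)
      \<comment> \<open>\<open>[n]\<close> is the largest partition and heads the list, so the case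
        distinction on \<open>la = [n]\<close> becomes the one on i = 1.\<close>
      have first: "L ! (i - 1) = [n] \<longleftrightarrow> i = 1" if i: "i \<in> {1..length L}" for i
      proof -
        have top: "L ! 0 = [n]"
        proof (rule ccontr)
          assume ne: "L ! 0 \<noteq> [n]"
          obtain j where j: "j < length L" "L ! j = [n]" using nS L(2) by (metis in_set_conv_nth)
          then have "j > 0" using ne by (cases j) auto
          then have "plt [n] (L ! 0)" using sorted_wrt_nth_less[OF L(1), of 0 j] j by simp
          moreover have "L ! 0 \<in> S" using L(2) nth_mem[of 0 L] j(1) by (cases L) auto
          then have "plt (L ! 0) [n]" using plt_singleton[of "L ! 0" n] ne n by (simp add: S_def)
          ultimately show False using plt_trans plt_irrefl by blast
        qed
        have "L ! (i - 1) = L ! 0 \<longleftrightarrow> i - 1 = 0" using dist i by (subst nth_eq_iff_index_eq) auto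
        then show ?thesis using top i by auto
      qed
      define x where "x j = X (L ! (j - 1))" for j
      have "\<bar>x j\<bar> \<le> B / dfact_even (n - 1)" if j: "j \<in> {1..length L}" for j
      proof -
        have "L ! (j - 1) \<in> S" using j L(2) nth_mem[of "j - 1" L] by auto
        then have "\<bar>x j\<bar> \<le> (\<Sum>rho\<in>S. \<bar>X rho\<bar>)"
          unfolding x_def by (intro member_le_sum[where f = "\<lambda>rho. \<bar>X rho\<bar>"]) (use finS in auto)
        also have "\<dots> \<le> 3 * C * 2 ^ t / dfact_even (n - 1) * card S * (1 + C) ^ card S" by (rule X(2))
        also have "\<dots> \<le> 3 * C * 2 ^ t / dfact_even (n - 1) * W * (1 + C) ^ W"
        proof -
          have "card S \<le> W" using card_fat_le[OF n] by (simp add: S_def W_def)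
          then show ?thesis using C1 D by (intro mult_mono power_increasing) auto
        qed
        also have "\<dots> = 3 * C * 2 ^ t * W * (1 + C) ^ W / dfact_even (n - 1)" by simp
        also have "\<dots> \<le> B / dfact_even (n - 1)" using D by (intro divide_right_mono) (auto simp: B_def)
        finally show ?thesis .
      qed
      moreover have "(\<Sum>j=1..length L. x j * P n (L ! (i - 1)) (L ! (j - 1))) = (if i = 1 then 1 else zeta n t)"
        if i: "i \<in> {1..length L}" for i
      proof -
        have "(\<Sum>j=1..length L. x j * P n (L ! (i - 1)) (L ! (j - 1))) =
          (\<Sum>j<length L. X (L ! j) * P n (L ! (i - 1)) (L ! j))"
          by (simp add: sum.atLeast1_atMost_eq x_def)
        also have "\<dots> = (\<Sum>rho\<in>S. X rho * P n (L ! (i - 1)) rho)"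
          by (rule sum.reindex_bij_betw[OF bij_betw_nth[OF dist refl L(2)[symmetric]]])
        also have "\<dots> = (if L ! (i - 1) = [n] then 1 else zeta n t)"
          by (rule eig) (use i L(2) nth_mem[of "i - 1" L] in auto)
        finally show ?thesis using first[OF i] by simp
      qed
      ultimately show ?thesis unfolding L_def by blast
    qed
  qed
  then show "\<exists>B>0. \<forall>n. 2 * t < n \<longrightarrow>
     (let L = fat_list n t; F = length L in
      \<exists>x :: nat \<Rightarrow> real.
        (\<forall>j\<in>{1..F}. \<bar>x j\<bar> \<le> B / dfact_even (n - 1)) \<and>
        (\<forall>i\<in>{1..F}. (\<Sum>j=1..F. x j * P n (L ! (i - 1)) (L ! (j - 1))) =
                       (if i = 1 then 1 else zeta n t)))"
    using B0 unfolding Let_def by blast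
qed

end
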